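(* Let $\Sigma_D=\frac1KP^\top P\in\mathbb{R}^{(N-1)\times(N-1)}$ and $\omega=\frac1{2+2\exp(2\bar c)}$. (a) Suppose the pairs of lotteries in the dataset $D$ are such that $\lambda_{\min}(\Sigma_D)=\bar\lambda>0$ (in this case $\Sigma_D$ is invertible and has rank $N-1$). Then for any $\delta\in(0,1)$, with probability at least $1-\delta$, $$\Big\|\frac{\hat\alpha^{\rm MLE}}{\hat\sigma_{\rm MLE}}-\frac{\alpha^*}{\sigma^*}\Big\|_\infty\le\Big\|\frac{\hat\alpha^{\rm MLE}}{\hat\sigma_{\rm MLE}}-\frac{\alpha^*}{\sigma^*}\Big\|_2\le\frac{2}{\sqrt{\bar\lambda}}\sqrt{\frac{N-1+2\sqrt{-(N-1)\log\delta}-2\log\delta}{\omega^2K}}=O\Big(\sqrt{\tfrac NK}\Big).$$ Furthermore: (a.1) if the cardinality $N$ of the overall support set induced by all lotteries is fixed (with $K$ increasing), then the estimation error with respect to the utility values at the breakpoints converges to $0$ at the rate $O\big(\frac1{\sqrt K}\big)$; (a.2) if $N$ grows asymptotically slower than $K$, i.e. $N=o(K)$, then the estimation error converges to $0$ as $K\to\infty$. (b) Suppose the pairs of lotteries in the dataset $D$ are such that $\lambda_{\min}(\Sigma_D)=0$ (in this case $\Sigma_D$ is not invertible and has rank less than $N-1$). Then for any $\lambda>0$ and any $\delta\in(0,1)$, with probability at least $1-\delta$, $$\Big\|\frac{\hat\alpha^{\rm MLE}}{\hat\sigma_{\rm MLE}}-\frac{\alpha^*}{\sigma^*}\Big\|_\infty\le\Big\|\frac{\hat\alpha^{\rm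 MLE}}{\hat\sigma_{\rm MLE}}-\frac{\alpha^*}{\sigma^*}\Big\|_2\le\frac{2}{\sqrt\lambda}\sqrt{\frac{N-1+2\sqrt{-(N-1)\log\delta}-2\log\delta}{\omega^2K}+\lambda\big(\bar c\sqrt{N-1}\big)^2}=O\Big(\sqrt{\tfrac NK}\Big)+O\big(\bar c\sqrt N\big).$$ In this case, the estimation error may fail to converge to zero as $K\to\infty$, since the pairwise comparison queries may be repeated or linearly dependent.
   Context: Fix constants $\bar b>0$, $L>0$, $\bar c>0$. $\mathcal{U}_c$ is the set of all functions $u:[0,\bar b]\to\mathbb{R}$ that are monotonically increasing (in the weak sense, i.e. nondecreasing), concave, Lipschitz continuous with modulus at most $L$, and satisfy $u(0)=0$, $u(\bar b)=1$. Data and model: the dataset is $D=\{(W_k,Y_k,Z_k): k=1,\dots,K\}$, where $(W_k,Y_k)$ are given pairs of lotteries, each lottery being a random variable with finite support in $[0,\bar b]$, and $Z_k\in\{1,-1\}$ is the observed choice of a decision-maker. There are a true utility function $u^*\in\mathcal{U}_c$ and a true scale parameter $\sigma^*\ge1/\bar c$ such that $Z_k=1$ if $\mathbb{E}[u^*(W_k)]+\varepsilon_{1k}\ge\mathbb{E}[u^*(Y_k)]+\varepsilon_{2k}$ and $Z_k=-1$ otherwise, where all response errors $\varepsilon_{1k},\varepsilon_{2k}$ are i.i.d. $\mathrm{Gumbel}(0,\sigma^* )$ (CDF $e^{-e^{-x/\sigma^*}}$), independent of the lotteries. Thus the $Z_k$ are independent with $\mathbb{P}(Z_k=1)=1/\big(1+\exp(-(\mathbb{E}[u^*(W_k)]-\mathbb{E}[u^*(Y_k)])/\sigma^*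 )\big)$; probability in the claim refers to the randomness of $(Z_1,\dots,Z_K)$. Let $\{y_1<\dots<y_N\}$ be the ordered list of all points of $\{0,\bar b\}\cup\bigcup_k \mathrm{supp}(W_k)\cup\bigcup_k\mathrm{supp}(Y_k)$ (the overall support set, or set of breakpoints; $y_1=0$, $y_N=\bar b$), and $\alpha^*=(u^*(y_1),\dots,u^*(y_N))^\top$. Put $p^k_j=\mathbb{P}[W_k=y_j]-\mathbb{P}[Y_k=y_j]$, $p^k_{2:N}=(p^k_2,\dots,p^k_N)^\top$, and let $P\in\mathbb{R}^{K\times(N-1)}$ have $k$-th row $(p^k_{2:N})^\top$. $\lambda_{\min}$ denotes the minimum eigenvalue. The estimation error means $\big\|\frac{\hat\alpha^{\rm MLE}}{\hat\sigma_{\rm MLE}}-\frac{\alpha^*}{\sigma^*}\big\|$ in the $\ell_2$ and $\ell_\infty$ norms. MLE: let $(\bar\alpha^*,\bar\beta^*,\gamma^* )$ be an optimal solution of: maximize $-\sum_{k=1}^K\log\big[1+\exp\big(\sum_{j=1}^N -Z_kp^k_j\bar\alpha_j\big)\big]$ over $\bar\alpha\in\mathbb{R}^N$, $\bar\beta\in\mathbb{R}^{N-1}$, $\gamma\in[0,\bar c]$ subject to $\bar\beta_j=(\bar\alpha_{j+1}-\bar\alpha_j)/(y_{j+1}-y_j)$ ($1\le j\le N-1$), $\bar\beta_{j+1}\le\bar\beta_j$ ($1\le j\le N-2$), $\bar\beta_1\le L\gamma$, $\bar\beta_{N-1}\ge0$, $\bar\alpha_1=0$, $\bar\alpha_N=\gamma$.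 Then $\hat\alpha^{\rm MLE}=\bar\alpha^*/\gamma^*$ and $\hat\sigma_{\rm MLE}=1/\gamma^*$, so that $\hat\alpha^{\rm MLE}/\hat\sigma_{\rm MLE}=\bar\alpha^*$; if $\gamma^*=0$ (where $\hat\sigma_{\rm MLE}=+\infty$ and the constraints force $\bar\alpha^*=0$), the ratio is read as $\bar\alpha^*=0$. *)

theory Defs
  imports
    "HOL-Probability.Probability"
    "HOL-Library.Landau_Symbols"
    "Jordan_Normal_Form.Char_Poly"
    "Jordan_Normal_Form.DL_Rank"
begin

text \<open>A lottery enters the model only through its (finitely supported) distribution, so it is
  represented by a \<^typ>\<open>real pmf\<close>. A query list \<open>D\<close> holds the pairs \<open>(W, Y)\<close>; entry \<open>D ! k\<close>
  with \<open>k < K = length D\<close> is the pair written \<open>(W_{k+1}, Y_{k+1})\<close> on paper.\<close>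

definition lottery :: "real \<Rightarrow> real pmf \<Rightarrow> bool" where
  "lottery b W \<longleftrightarrow> finite (set_pmf W) \<and> set_pmf W \<subseteq> {0..b}"

type_synonym queries = "(real pmf \<times> real pmf) list"

definition valid_queries :: "real \<Rightarrow> queries \<Rightarrow> bool" where
  "valid_queries b D \<longleftrightarrow> D \<noteq> [] \<and> (\<forall>(W, Y) \<in> set D. lottery b W \<and> lottery b Y)"

text \<open>A utility \<open>[0,b] \<rightarrow> \<real>\<close> is a function on \<open>\<real>\<close> of which only the values on \<open>{0..b}\<close> matter.\<close>

definition utility_class :: "real \<Rightarrow> real \<Rightarrow> (real \<Rightarrow> real) set" where
  "utility_class b L = {u. mono_on {0..b} u \<and> concave_on {0..b} u \<and> lipschitz_on L {0..b} u
     \<and> u 0 = 0 \<and> u b = 1}"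


subsection \<open>Breakpoints and design matrix\<close>

definition support_set :: "real \<Rightarrow> queries \<Rightarrow> real set" where
  "support_set b D = {0, b} \<union> (\<Union>(W, Y) \<in> set D. set_pmf W \<union> set_pmf Y)"

definition num_bp :: "real \<Rightarrow> queries \<Rightarrow> nat" where
  "num_bp b D = card (support_set b D)"

text \<open>\<open>bp b D j\<close> is \<open>y_j\<close>, with the index running over \<open>1, \<dots>, N = num_bp b D\<close>.\<close>

definition bp :: "real \<Rightarrow> queries \<Rightarrow> nat \<Rightarrow> real" where
  "bp b D j = sorted_list_of_set (support_set b D) ! (j - 1)"

definition pdiff :: "real \<Rightarrow> queries \<Rightarrow> nat \<Rightarrow> nat \<Rightarrow> real" where
  "pdiff b D k j = pmf (fst (D ! k)) (bp b D j) - pmf (snd (D ! k)) (bp b D j)"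

text \<open>Matrix indices start at 0, so column \<open>i\<close> belongs to the breakpoint \<open>y_{i+2}\<close>: the
  columns are those of \<open>y_2, \<dots>, y_N\<close>.\<close>

definition P_mat :: "real \<Rightarrow> queries \<Rightarrow> real mat" where
  "P_mat b D = mat (length D) (num_bp b D - 1) (\<lambda>(k, i). pdiff b D k (i + 2))"

definition Sigma_mat :: "real \<Rightarrow> queries \<Rightarrow> real mat" where
  "Sigma_mat b D = (1 / real (length D)) \<cdot>\<^sub>m (transpose_mat (P_mat b D) * P_mat b D)"

text \<open>Used for symmetric real matrices of positive dimension only, whose eigenvalues are real
  and form a finite nonempty set.\<close>

definition lambda_min :: "real mat \<Rightarrow> real" where
  "lambda_min A = Min {k. eigenvalue A k}"


subsection \<open>Choice model\<close>

definition gumbel_cdf :: "real \<Rightarrow> real \<Rightarrow> real \<Rightarrow> real" where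
  "gumbel_cdf \<mu> \<sigma> x = exp (- exp (- (x - \<mu>) / \<sigma>))"

text \<open>\<open>eps 1 k\<close> and \<open>eps 2 k\<close> are the response errors attached to the first and the second
  lottery of query \<open>k\<close>.\<close>

definition response_errors ::
  "'w measure \<Rightarrow> real \<Rightarrow> nat \<Rightarrow> (nat \<Rightarrow> nat \<Rightarrow> 'w \<Rightarrow> real) \<Rightarrow> bool" where
  "response_errors M \<sigma> K eps \<longleftrightarrow>
     prob_space M \<and>
     prob_space.indep_vars M (\<lambda>_. borel) (\<lambda>(i, k). eps i k) ({1, 2} \<times> {..<K}) \<and>
     (\<forall>i\<in>{1, 2}. \<forall>k<K. cdf (distr M borel (eps i k)) = gumbel_cdf 0 \<sigma>)"

definition choice :: "(real \<Rightarrow> real) \<Rightarrow> real pmf \<times> real pmf \<Rightarrow> real \<Rightarrow> real \<Rightarrow> int" where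
  "choice u q e1 e2 =
     (if measure_pmf.expectation (fst q) u + e1 \<ge> measure_pmf.expectation (snd q) u + e2
      then 1 else - 1)"

definition responses ::
  "(real \<Rightarrow> real) \<Rightarrow> queries \<Rightarrow> (nat \<Rightarrow> nat \<Rightarrow> 'w \<Rightarrow> real) \<Rightarrow> 'w \<Rightarrow> int list" where
  "responses u D eps x = map (\<lambda>k. choice u (D ! k) (eps 1 k x) (eps 2 k x)) [0..<length D]"


subsection \<open>Maximum likelihood estimator\<close>

text \<open>A candidate \<open>(\<alpha>, \<beta>, \<gamma>)\<close> uses \<open>\<alpha>\<close> only on \<open>{1..N}\<close> and \<open>\<beta>\<close> only on \<open>{1..N - 1}\<close>.\<close>

type_synonym candidate = "(nat \<Rightarrow> real) \<times> (nat \<Rightarrow> real) \<times> real"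

definition log_likelihood :: "real \<Rightarrow> queries \<Rightarrow> int list \<Rightarrow> (nat \<Rightarrow> real) \<Rightarrow> real" where
  "log_likelihood b D z \<alpha> =
     - (\<Sum>k<length D. ln (1 + exp (\<Sum>j=1..num_bp b D. - of_int (z ! k) * pdiff b D k j * \<alpha> j)))"

definition feasible :: "real \<Rightarrow> real \<Rightarrow> real \<Rightarrow> queries \<Rightarrow> candidate \<Rightarrow> bool" where
  "feasible b L c D = (\<lambda>(\<alpha>, \<beta>, \<gamma>). let N = num_bp b D in
     0 \<le> \<gamma> \<and> \<gamma> \<le> c \<and>
     (\<forall>j\<in>{1..N - 1}. \<beta> j = (\<alpha> (j + 1) - \<alpha> j) / (bp b D (j + 1) - bp b D j)) \<and>
     (\<forall>j\<in>{1..N - 2}. \<beta> (j + 1) \<le> \<beta> j) \<and>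
     \<beta> 1 \<le> L * \<gamma> \<and> \<beta> (N - 1) \<ge> 0 \<and>
     \<alpha> 1 = 0 \<and> \<alpha> N = \<gamma>)"

definition optimal :: "real \<Rightarrow> real \<Rightarrow> real \<Rightarrow> queries \<Rightarrow> int list \<Rightarrow> candidate \<Rightarrow> bool" where
  "optimal b L c D z s \<longleftrightarrow> feasible b L c D s \<and>
     (\<forall>s'. feasible b L c D s' \<longrightarrow> log_likelihood b D z (fst s') \<le> log_likelihood b D z (fst s))"

text \<open>An arbitrary selection of one optimal solution for each possible response vector. Being a
  function of the responses, every quantity computed from it is a simple random variable.\<close>

definition mle_rule ::
  "real \<Rightarrow> real \<Rightarrow> real \<Rightarrow> queries \<Rightarrow> (int list \<Rightarrow> candidate) \<Rightarrow> bool" where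
  "mle_rule b L c D est \<longleftrightarrow>
     (\<forall>z. length z = length D \<and> set z \<subseteq> {1, - 1} \<longrightarrow> optimal b L c D z (est z))"

definition alpha_hat :: "candidate \<Rightarrow> nat \<Rightarrow> real" where
  "alpha_hat = (\<lambda>(\<alpha>, \<beta>, \<gamma>) j. \<alpha> j / \<gamma>)"

definition sigma_hat :: "candidate \<Rightarrow> real" where
  "sigma_hat = (\<lambda>(\<alpha>, \<beta>, \<gamma>). 1 / \<gamma>)"

text \<open>For \<open>\<gamma> = 0\<close> the first quotient below is 0 because division by 0 yields 0; this is the
  intended value, since then \<open>\<alpha> = 0\<close> on \<open>{1..N}\<close> by feasibility.\<close>

definition est_err ::
  "real \<Rightarrow> (real \<Rightarrow> real) \<Rightarrow> real \<Rightarrow> queries \<Rightarrow> candidate \<Rightarrow> nat \<Rightarrow> real" where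
  "est_err b u \<sigma> D s j = alpha_hat s j / sigma_hat s - u (bp b D j) / \<sigma>"

definition err_l2 ::
  "real \<Rightarrow> (real \<Rightarrow> real) \<Rightarrow> real \<Rightarrow> queries \<Rightarrow> candidate \<Rightarrow> real" where
  "err_l2 b u \<sigma> D s = L2_set (est_err b u \<sigma> D s) {1..num_bp b D}"

definition err_linf ::
  "real \<Rightarrow> (real \<Rightarrow> real) \<Rightarrow> real \<Rightarrow> queries \<Rightarrow> candidate \<Rightarrow> real" where
  "err_linf b u \<sigma> D s = Max ((\<lambda>j. \<bar>est_err b u \<sigma> D s j\<bar>) ` {1..num_bp b D})"

definition choice_experiment ::
  "real \<Rightarrow> real \<Rightarrow> real \<Rightarrow> real \<Rightarrow> 'w measure \<Rightarrow> queries \<Rightarrow>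
   (nat \<Rightarrow> nat \<Rightarrow> 'w \<Rightarrow> real) \<Rightarrow> (int list \<Rightarrow> candidate) \<Rightarrow> bool" where
  "choice_experiment b L c \<sigma> M D eps est \<longleftrightarrow>
     valid_queries b D \<and> response_errors M \<sigma> (length D) eps \<and> mle_rule b L c D est"

definition estimate ::
  "(real \<Rightarrow> real) \<Rightarrow> queries \<Rightarrow> (nat \<Rightarrow> nat \<Rightarrow> 'w \<Rightarrow> real) \<Rightarrow> (int list \<Rightarrow> candidate) \<Rightarrow>
   'w \<Rightarrow> candidate" where
  "estimate u D eps est x = est (responses u D eps x)"


subsection \<open>Error bounds and convergence\<close>

definition omega :: "real \<Rightarrow> real" where
  "omega c = 1 / (2 + 2 * exp (2 * c))"

definition noise_term :: "real \<Rightarrow> real \<Rightarrow> nat \<Rightarrow> nat \<Rightarrow> real" where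
  "noise_term c \<delta> N K =
     (real N - 1 + 2 * sqrt (- (real N - 1) * ln \<delta>) - 2 * ln \<delta>) / ((omega c)\<^sup>2 * real K)"

definition bound_regular :: "real \<Rightarrow> real \<Rightarrow> real \<Rightarrow> nat \<Rightarrow> nat \<Rightarrow> real" where
  "bound_regular c l \<delta> N K = 2 / sqrt l * sqrt (noise_term c \<delta> N K)"

definition bound_singular :: "real \<Rightarrow> real \<Rightarrow> real \<Rightarrow> nat \<Rightarrow> nat \<Rightarrow> real" where
  "bound_singular c l \<delta> N K =
     2 / sqrt l * sqrt (noise_term c \<delta> N K + l * (c * sqrt (real N - 1))\<^sup>2)"

text \<open>With this principal filter, an O-statement has one constant for all admissible \<open>(N, K)\<close>.\<close>

definition all_sizes :: "(nat \<times> nat) filter" where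
  "all_sizes = principal ({2..} \<times> {1..})"

definition tendsto_zero_in_prob :: "(nat \<Rightarrow> 'w measure) \<Rightarrow> (nat \<Rightarrow> 'w \<Rightarrow> real) \<Rightarrow> bool" where
  "tendsto_zero_in_prob M X \<longleftrightarrow>
     (\<forall>e>0. (\<lambda>n. measure (M n) {x \<in> space (M n). \<bar>X n x\<bar> > e}) \<longlonglongrightarrow> 0)"

text \<open>Stochastic big O: for every confidence level, \<open>X n \<le> C * r n\<close> holds with that probability,
  with \<open>C\<close> not depending on \<open>n\<close>.\<close>

definition rate_in_prob ::
  "(nat \<Rightarrow> 'w measure) \<Rightarrow> (nat \<Rightarrow> 'w \<Rightarrow> real) \<Rightarrow> (nat \<Rightarrow> real) \<Rightarrow> bool" where
  "rate_in_prob M X r \<longleftrightarrow>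
     (\<forall>\<delta>. 0 < \<delta> \<and> \<delta> < 1 \<longrightarrow> (\<exists>C. \<forall>n.
        measure (M n) {x \<in> space (M n). \<bar>X n x\<bar> \<le> C * r n} \<ge> 1 - \<delta>))"

end

theory Submission
  imports Defs "Jordan_Normal_Form.Spectral_Radius" "HOL-Real_Asymp.Real_Asymp"
begin

text \<open>Comparing the likelihood at the estimate and at the truth, and using that the logistic loss has
  curvature at least \<open>omega c\<close> on the range of utility gaps, bounds \<open>\<parallel>P \<Delta>\<parallel>\<close> by \<open>2 / omega c\<close> times the norm
  of the orthogonal projection of the residual vector onto the column space of \<open>P\<close>; the smallest
  eigenvalue of \<open>P\<^sup>T P / K\<close> converts this into a bound on \<open>\<Delta>\<close>. The residuals are independent, centred
  and take values in intervals of length 1, so by Hoeffding's lemma linear functionals of them are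
  sub-Gaussian with variance proxy 1/4. Integrating over Gaussian coefficients gives
  \<open>E (exp (Q / 2)) \<le> exp (d / 2)\<close> for the squared norm \<open>Q\<close> of a projection of rank \<open>d\<close>, and Markov's
  inequality gives \<open>Q \<le> d - 2 ln \<delta>\<close> with probability at least \<open>1 - \<delta>\<close>. In the singular case the
  claimed bound exceeds the diameter of the feasible set. If every query compares \<open>b / 2\<close> for sure
  with a fair lottery over \<open>0\<close> and \<open>b\<close>, the linear utility yields coin flips for every scale
  parameter, so no estimator is consistent at two different scales.\<close>

subsection \<open>The smallest eigenvalue of the Gram matrix\<close>

text \<open>Projecting the residual keeps the noise at the size of \<open>N - 1\<close>:
  Cauchy-Schwarz in the full response space would bring in the norm of a vector with
  \<open>K\<close> entries. There are \<open>N - 1\<close> directions rather than \<open>N\<close>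
  because estimate and truth both vanish at the breakpoint 0. The quantile in the claim has the
  shape known for quadratic forms in sub-Gaussian vectors with variance proxy 1. With proxy 1/4 the
  exponential moment of order 1/2 costs only a factor \<open>sqrt (4 / 3) \<le> exp (1 / 2)\<close>
  per direction, and this one fixed order already yields \<open>d - 2 * ln \<delta>\<close>, which
  that quantile dominates. The estimator is an arbitrary selection of maximisers, so no regularity
  of it is available; measurability of its events comes from the responses having countably many
  values. For the failure of consistency, the errors are \<open>\<sigma>\<close> times standard
  Gumbel variables on one common space, so that the two scales produce the same responses, hence the
  same estimate, at every outcome, while the targets at the breakpoint \<open>b\<close> are
  \<open>c\<close> and \<open>c / 2\<close>.\<close>

no_notation inner (infix "\<bullet>" 70)
no_notation vec_nth (infixl "$" 90)

text \<open>First-order condition at the minimum \<open>t = 0\<close>: a nonzero linear term would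
  beat the quadratic one for small \<open>t\<close> of the opposite sign. The test point
  \<open>- p / r\<close> is small enough because \<open>r > q\<close>.\<close>

lemma quadratic_nonneg_imp_linear_zero:
  fixes p q :: real
  assumes "\<And>t. 0 \<le> 2 * t * p + t\<^sup>2 * q"
  shows "p = 0"
proof (rule ccontr)
  assume "p \<noteq> 0"
  define r where "r = \<bar>q\<bar> + 1"
  have r: "r > 0" "q < r" by (auto simp: r_def)
  have "0 \<le> 2 * (- p / r) * p + (- p / r)\<^sup>2 * q" by (rule assms)
  also have "\<dots> = p\<^sup>2 / r * (q / r - 2)" using r by (simp add: field_simps power2_eq_square)
  also have "\<dots> < 0" using r \<open>p \<noteq> 0\<close> by (intro mult_pos_neg) (auto simp: field_simps)
  finally show False by simp
qed

text \<open>The dimension is a variable, so vectors are sequences padded with zeros. Inside the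
  function space the sphere is a closed subset of a product of intervals and singletons, and
  Tychonoff's theorem makes it compact.\<close>

lemma unit_sphere_attains_inf:
  fixes F :: "(nat \<Rightarrow> real) \<Rightarrow> real"
  assumes "n > 0" and F: "continuous_on UNIV F"
  defines "S \<equiv> {f. (\<forall>i\<ge>n. f i = 0) \<and> (\<Sum>i<n. (f i)\<^sup>2) = 1}"
  obtains f where "f \<in> S" "\<And>g. g \<in> S \<Longrightarrow> F f \<le> F g"
proof -
  define B :: "nat \<Rightarrow> real set" where "B i = (if i < n then {-1..1} else {0})" for i
  have "compactin (product_topology (\<lambda>_. euclidean) UNIV) (PiE UNIV B)"
    by (subst compactin_PiE) (auto simp: B_def)
  then have cB: "compact (PiE UNIV B)"
    by (simp add: euclidean_product_topology)
  have S_eq: "S = PiE UNIV B \<inter> {f. (\<Sum>i<n. (f i)\<^sup>2) = 1}"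
  proof -
    have "f i \<in> B i" if "f \<in> S" for f i
    proof (cases "i < n")
      case True
      have "(f i)\<^sup>2 \<le> (\<Sum>i<n. (f i)\<^sup>2)" using True by (intro member_le_sum) auto
      then have "(f i)\<^sup>2 \<le> 1" using that by (simp add: S_def)
      then show ?thesis using True abs_square_le_1 [of "f i"] by (auto simp: B_def)
    qed (use that in \<open>auto simp: S_def B_def\<close>)
    moreover have "f i = 0" if "\<forall>i. f i \<in> B i" "i \<ge> n" for f i
      using that(1)[rule_format, of i] that(2) by (simp add: B_def)
    ultimately have "f \<in> S \<longleftrightarrow> f \<in> PiE UNIV B \<inter> {f. (\<Sum>i<n. (f i)\<^sup>2) = 1}" for f
      unfolding S_def PiE_UNIV_domain Pi_iff Int_iff mem_Collect_eq by blast
    then show ?thesis by blast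
  qed
  have "closed {f :: nat \<Rightarrow> real. (\<Sum>i<n. (f i)\<^sup>2) = 1}"
    by (intro closed_Collect_eq continuous_intros continuous_on_product_coordinates)
  with cB have "compact S" unfolding S_eq by (rule compact_Int_closed)
  moreover have "(\<lambda>i. if i = 0 then 1 else 0) \<in> S"
  proof -
    have "(\<Sum>i<n. (if i = 0 then 1 else 0 :: real)\<^sup>2) = (\<Sum>i<n. if i = 0 then 1 else 0)"
      by (intro sum.cong) auto
    then show ?thesis using \<open>n > 0\<close> by (auto simp: S_def)
  qed
  ultimately obtain f where "f \<in> S" "\<forall>g\<in>S. F f \<le> F g"
    using continuous_attains_inf[of S F] F continuous_on_subset by blast
  then show ?thesis using that by blast
qed

text \<open>The minimum \<open>m\<close> of the Rayleigh quotient exists by compactness; a minimiser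
  \<open>x\<close> must be an eigenvector, since otherwise moving along the defect
  \<open>A x - m x\<close> would lower the quotient.\<close>

lemma symmetric_mat_min_eigenvalue:
  fixes A :: "real mat"
  assumes A: "A \<in> carrier_mat n n" and sym: "transpose_mat A = A" and "n > 0"
  obtains m where "eigenvalue A m" "\<And>v. v \<in> carrier_vec n \<Longrightarrow> m * (v \<bullet> v) \<le> v \<bullet> (A *\<^sub>v v)"
proof -
  let ?F = "\<lambda>f. \<Sum>i<n. f i * (\<Sum>j<n. A $$ (i, j) * f j)"
  have form: "v \<bullet> (A *\<^sub>v v) = ?F (\<lambda>i. v $ i)" if "v \<in> carrier_vec n" for v
    using that A by (auto simp: scalar_prod_def atLeast0LessThan intro!: sum.cong)
  have "continuous_on UNIV ?F"
    by (intro continuous_intros continuous_on_product_coordinates)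
  then obtain f where f: "f \<in> {f. (\<forall>i\<ge>n. f i = 0) \<and> (\<Sum>i<n. (f i)\<^sup>2) = 1}"
    and min: "\<And>g. g \<in> {f. (\<forall>i\<ge>n. f i = 0) \<and> (\<Sum>i<n. (f i)\<^sup>2) = 1} \<Longrightarrow> ?F f \<le> ?F g"
    using unit_sphere_attains_inf[OF \<open>n > 0\<close>] by blast
  define m where "m = ?F f"
  define x where "x = vec n f"
  have x: "x \<in> carrier_vec n" by (simp add: x_def)
  have xx: "x \<bullet> x = 1"
    using f by (simp add: x_def scalar_prod_def atLeast0LessThan power2_eq_square)
  have xAx: "x \<bullet> (A *\<^sub>v x) = m"
    by (subst form[OF x]) (simp add: m_def x_def)
  have rayleigh: "m * (v \<bullet> v) \<le> v \<bullet> (A *\<^sub>v v)" if v: "v \<in> carrier_vec n" for v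
  proof (cases "v \<bullet> v = 0")
    case True
    have "v $ i = 0" if "i < n" for i
      using True that v by (simp add: scalar_prod_def sum_nonneg_eq_0_iff)
    then show ?thesis using True by (simp add: form[OF v])
  next
    case False
    define r where "r = sqrt (v \<bullet> v)"
    have vv: "v \<bullet> v = (\<Sum>i<n. (v $ i)\<^sup>2)"
      using v by (simp add: scalar_prod_def atLeast0LessThan power2_eq_square)
    then have r2: "r\<^sup>2 = v \<bullet> v" by (simp add: r_def sum_nonneg)
    with False have "r \<noteq> 0" by auto
    define g where "g i = (if i < n then v $ i / r else 0)" for i
    have "(\<Sum>i<n. (g i)\<^sup>2) = (\<Sum>i<n. (v $ i)\<^sup>2) / r\<^sup>2"
      by (simp add: g_def power_divide sum_divide_distrib)
    also have "\<dots> = 1" using False vv r2 by simp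
    finally have "m \<le> ?F g" unfolding m_def by (intro min) (auto simp: g_def)
    also have "?F g = (\<Sum>i<n. \<Sum>j<n. (v $ i * (A $$ (i, j) * v $ j)) / r\<^sup>2)"
      by (simp add: g_def sum_distrib_left power2_eq_square mult.assoc)
    also have "\<dots> = v \<bullet> (A *\<^sub>v v) / r\<^sup>2"
      unfolding form[OF v] by (simp only: sum_divide_distrib sum_distrib_left)
    finally show ?thesis using \<open>r \<noteq> 0\<close> unfolding r2[symmetric] by (simp add: pos_le_divide_eq)
  qed
  define y where "y = A *\<^sub>v x - m \<cdot>\<^sub>v x"
  have y: "y \<in> carrier_vec n" using A x by (simp add: y_def)
  \<comment> \<open>This is the Rayleigh inequality at \<open>x + t y\<close>. The constant terms
    cancel because \<open>x\<close> attains \<open>m\<close>, symmetry merges the two cross terms,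
    and \<open>A x = y + m x\<close> turns them into \<open>2 * t * (y \<bullet> y)\<close>.\<close>
  have "0 \<le> 2 * t * (y \<bullet> y) + t\<^sup>2 * (y \<bullet> (A *\<^sub>v y) - m * (y \<bullet> y))" for t
  proof -
    have xAy: "x \<bullet> (A *\<^sub>v y) = (A *\<^sub>v x) \<bullet> y"
      using A x y sym by (metis transpose_vec_mult_scalar)
    have Ax: "A *\<^sub>v x \<in> carrier_vec n" "A *\<^sub>v y \<in> carrier_vec n"
      using mult_mat_vec_carrier[OF A x] mult_mat_vec_carrier[OF A y] by blast+
    have expand: "(x + t \<cdot>\<^sub>v y) \<bullet> (p + t \<cdot>\<^sub>v q) = x \<bullet> p + t * (y \<bullet> p) + t * (x \<bullet> q) + t\<^sup>2 * (y \<bullet> q)"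
      if pq: "p \<in> carrier_vec n" "q \<in> carrier_vec n" for p q
    proof -
      have "(x + t \<cdot>\<^sub>v y) \<bullet> (p + t \<cdot>\<^sub>v q) = x \<bullet> (p + t \<cdot>\<^sub>v q) + t * (y \<bullet> (p + t \<cdot>\<^sub>v q))"
        using x y pq by (subst add_scalar_prod_distrib[where n=n]) auto
      moreover have "x \<bullet> (p + t \<cdot>\<^sub>v q) = x \<bullet> p + t * (x \<bullet> q)"
        using x pq by (subst scalar_prod_add_distrib[where n=n]) auto
      moreover have "y \<bullet> (p + t \<cdot>\<^sub>v q) = y \<bullet> p + t * (y \<bullet> q)"
        using y pq by (subst scalar_prod_add_distrib[where n=n]) auto
      ultimately show ?thesis by (simp add: distrib_left power2_eq_square)
    qed
    have "m * ((x + t \<cdot>\<^sub>v y) \<bullet> (x + t \<cdot>\<^sub>v y)) \<le> (x + t \<cdot>\<^sub>v y) \<bullet> (A *\<^sub>v (x + t \<cdot>\<^sub>v y))"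
      using x y by (intro rayleigh) auto
    also have "A *\<^sub>v (x + t \<cdot>\<^sub>v y) = A *\<^sub>v x + t \<cdot>\<^sub>v (A *\<^sub>v y)"
      using A x y by (simp add: mult_add_distrib_mat_vec mult_mat_vec)
    finally have "m * (1 + 2 * t * (x \<bullet> y) + t\<^sup>2 * (y \<bullet> y))
        \<le> m + 2 * t * ((A *\<^sub>v x) \<bullet> y) + t\<^sup>2 * (y \<bullet> (A *\<^sub>v y))"
      unfolding expand[OF x y] expand[OF Ax] xAy comm_scalar_prod[OF y x]
        comm_scalar_prod[OF y Ax(1)] xx xAx by (simp add: ac_simps)
    moreover have "(A *\<^sub>v x) \<bullet> y = y \<bullet> y + m * (x \<bullet> y)"
    proof -
      have "(A *\<^sub>v x - m \<cdot>\<^sub>v x) \<bullet> y = (A *\<^sub>v x) \<bullet> y - m * (x \<bullet> y)"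
        using Ax x y by (subst minus_scalar_prod_distrib[where n=n]) auto
      then show ?thesis by (simp flip: y_def)
    qed
    ultimately show ?thesis by (simp add: algebra_simps)
  qed
  then have "y \<bullet> y = 0" by (rule quadratic_nonneg_imp_linear_zero)
  then have "y $ i = 0" if "i < n" for i
    using that y by (simp add: scalar_prod_def sum_nonneg_eq_0_iff)
  then have "A *\<^sub>v x = m \<cdot>\<^sub>v x"
    using A x by (intro eq_vecI) (auto simp: y_def)
  moreover have "x \<noteq> 0\<^sub>v n" using xx by auto
  ultimately have "eigenvalue A m"
    using A x by (auto simp: eigenvalue_def eigenvector_def)
  with rayleigh that show ?thesis by blast
qed

text \<open>The finite spectrum is nonempty, so its minimum is attained. That minimum lies below the
  Rayleigh minimum, which is itself an eigenvalue, so the quadratic bound passes to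
  \<open>lambda_min A\<close>.\<close>

lemma lambda_min_symmetric:
  fixes A :: "real mat"
  assumes A: "A \<in> carrier_mat n n" and sym: "transpose_mat A = A" and "n > 0"
  shows "eigenvalue A (lambda_min A)"
    and "v \<in> carrier_vec n \<Longrightarrow> lambda_min A * (v \<bullet> v) \<le> v \<bullet> (A *\<^sub>v v)"
proof -
  obtain m where m: "eigenvalue A m" "\<And>v. v \<in> carrier_vec n \<Longrightarrow> m * (v \<bullet> v) \<le> v \<bullet> (A *\<^sub>v v)"
    using symmetric_mat_min_eigenvalue[OF assms] by blast
  have fin: "finite {k. eigenvalue A k}"
    using card_finite_spectrum(1)[OF A] by (simp add: spectrum_def)
  then show "eigenvalue A (lambda_min A)"
    using m(1) Min_in[of "{k. eigenvalue A k}"] by (auto simp: lambda_min_def)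
  have "lambda_min A \<le> m" using fin m(1) by (simp add: lambda_min_def)
  moreover have "0 \<le> v \<bullet> v" by (simp add: scalar_prod_def sum_nonneg)
  ultimately show "lambda_min A * (v \<bullet> v) \<le> v \<bullet> (A *\<^sub>v v)" if "v \<in> carrier_vec n"
    using m(2)[OF that] mult_right_mono[of "lambda_min A" m "v \<bullet> v"] by linarith
qed

lemma eigenvalue_0_iff_det:
  fixes A :: "real mat"
  assumes A: "A \<in> carrier_mat n n"
  shows "eigenvalue A 0 \<longleftrightarrow> det A = 0"
proof -
  have "0 \<cdot>\<^sub>v v = 0\<^sub>v n" if "v \<in> carrier_vec n" for v :: "real vec"
    using that by auto
  then show ?thesis
    unfolding det_0_iff_vec_prod_zero_field[OF A] eigenvalue_def eigenvector_def
    using A by auto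
qed

lemma invertible_mat_iff_det:
  fixes A :: "real mat"
  assumes A: "A \<in> carrier_mat n n"
  shows "invertible_mat A \<longleftrightarrow> det A \<noteq> 0"
proof
  assume "invertible_mat A"
  then obtain B where AB: "A * B = 1\<^sub>m n" and BA: "B * A = 1\<^sub>m (dim_row B)"
    using A by (auto simp: invertible_mat_def inverts_mat_def)
  \<comment> \<open>\<open>invertible_mat\<close> does not fix the format of the inverse; the two
    products determine it.\<close>
  have "dim_col B = n" using AB by (metis index_mult_mat(3) index_one_mat(3))
  moreover have "dim_row B = n" using BA A by (metis carrier_matD(2) index_mult_mat(3) index_one_mat(3))
  ultimately have "B \<in> carrier_mat n n" by auto
  then have "det A * det B = 1" using det_mult[OF A, of B] AB by simp
  then show "det A \<noteq> 0" by auto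
next
  assume "det A \<noteq> 0"
  from det_non_zero_imp_unit[OF A this]
  obtain B where "B \<in> carrier_mat n n" "B * A = 1\<^sub>m n" "A * B = 1\<^sub>m n"
    by (auto simp: Units_def ring_mat_def)
  then show "invertible_mat A"
    using A unfolding invertible_mat_def inverts_mat_def by auto
qed

lemma Sigma_mat_carrier: "Sigma_mat b D \<in> carrier_mat (num_bp b D - 1) (num_bp b D - 1)"
  by (rule carrier_matI) (simp_all add: Sigma_mat_def P_mat_def)

lemma transpose_smult_mat: "transpose_mat (k \<cdot>\<^sub>m A) = k \<cdot>\<^sub>m transpose_mat A"
  by (rule eq_matI) auto

lemma smult_mat_mult_vec:
  assumes "A \<in> carrier_mat n m" "v \<in> carrier_vec m"
  shows "(k \<cdot>\<^sub>m A) *\<^sub>v v = k \<cdot>\<^sub>v (A *\<^sub>v (v :: 'a :: comm_ring_1 vec))"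
  using assms by (intro eq_vecI) (auto simp: scalar_prod_def sum_distrib_left mult.assoc)

lemma Sigma_mat_symmetric: "transpose_mat (Sigma_mat b D) = Sigma_mat b D"
proof -
  let ?P = "P_mat b D"
  have P: "?P \<in> carrier_mat (length D) (num_bp b D - 1)" by (simp add: P_mat_def)
  then have "transpose_mat (transpose_mat ?P * ?P) = transpose_mat ?P * ?P"
    by (simp add: transpose_mult[of "transpose_mat ?P" "num_bp b D - 1" "length D"])
  then show ?thesis unfolding Sigma_mat_def transpose_smult_mat by (rule arg_cong)
qed

lemma Sigma_mat_quadratic_form:
  assumes v: "v \<in> carrier_vec (num_bp b D - 1)"
  shows "v \<bullet> (Sigma_mat b D *\<^sub>v v)
    = (\<Sum>k<length D. (\<Sum>i<num_bp b D - 1. pdiff b D k (i + 2) * v $ i)\<^sup>2) / real (length D)"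
proof -
  let ?P = "P_mat b D" and ?n = "num_bp b D - 1"
  have P: "?P \<in> carrier_mat (length D) ?n" by (simp add: P_mat_def)
  then have PT: "transpose_mat ?P \<in> carrier_mat ?n (length D)" by simp
  have Pv: "?P *\<^sub>v v \<in> carrier_vec (length D)" using mult_mat_vec_carrier[OF P v] .
  have "Sigma_mat b D *\<^sub>v v = (1 / real (length D)) \<cdot>\<^sub>v ((transpose_mat ?P * ?P) *\<^sub>v v)"
    unfolding Sigma_mat_def using P v by (intro smult_mat_mult_vec[of _ ?n ?n]) auto
  also have "(transpose_mat ?P * ?P) *\<^sub>v v = transpose_mat ?P *\<^sub>v (?P *\<^sub>v v)"
    using P v by (intro assoc_mult_mat_vec[of _ _ "length D" _ ?n]) auto
  finally have Sv: "Sigma_mat b D *\<^sub>v v = (1 / real (length D)) \<cdot>\<^sub>v (transpose_mat ?P *\<^sub>v (?P *\<^sub>v v))" .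
  have PPv: "transpose_mat ?P *\<^sub>v (?P *\<^sub>v v) \<in> carrier_vec ?n"
    by (rule mult_mat_vec_carrier[OF PT Pv])
  have "v \<bullet> (Sigma_mat b D *\<^sub>v v) = (v \<bullet> (transpose_mat ?P *\<^sub>v (?P *\<^sub>v v))) / real (length D)"
    unfolding Sv scalar_prod_smult_distrib[OF v PPv] by simp
  also have "v \<bullet> (transpose_mat ?P *\<^sub>v (?P *\<^sub>v v)) = (transpose_mat (transpose_mat ?P) *\<^sub>v v) \<bullet> (?P *\<^sub>v v)"
    by (rule transpose_vec_mult_scalar[symmetric, OF PT Pv v])
  also have "\<dots> = (?P *\<^sub>v v) \<bullet> (?P *\<^sub>v v)" by simp
  also have "\<dots> = (\<Sum>k<length D. (\<Sum>i<?n. pdiff b D k (i + 2) * v $ i)\<^sup>2)"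
  proof -
    have "(?P *\<^sub>v v) $ k = (\<Sum>i<?n. pdiff b D k (i + 2) * v $ i)" if "k < length D" for k
      using that v by (simp add: P_mat_def scalar_prod_def atLeast0LessThan)
    then show ?thesis
      using P by (simp add: scalar_prod_def[of "?P *\<^sub>v v"] atLeast0LessThan power2_eq_square)
  qed
  finally show ?thesis .
qed

text \<open>The quadratic form of \<open>Sigma_mat b D\<close> is the squared norm of
  \<open>P d\<close> divided by \<open>K\<close>, so Rayleigh's inequality turns a bound on the
  prediction error into a bound on the parameter error. With a kernel vector of \<open>P\<close> it
  forces a nonpositive \<open>lambda_min\<close>.\<close>

lemma lambda_min_Sigma_mat:
  assumes "num_bp b D \<ge> 2" "D \<noteq> []"
  shows "real (length D) * lambda_min (Sigma_mat b D) * (\<Sum>i<num_bp b D - 1. (d i)\<^sup>2)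
    \<le> (\<Sum>k<length D. (\<Sum>i<num_bp b D - 1. pdiff b D k (i + 2) * d i)\<^sup>2)"
proof -
  define v where "v = vec (num_bp b D - 1) d"
  have v: "v \<in> carrier_vec (num_bp b D - 1)" by (simp add: v_def)
  have "lambda_min (Sigma_mat b D) * (v \<bullet> v) \<le> v \<bullet> (Sigma_mat b D *\<^sub>v v)"
    using assms by (intro lambda_min_symmetric(2)[OF Sigma_mat_carrier Sigma_mat_symmetric _ v]) auto
  moreover have "v \<bullet> v = (\<Sum>i<num_bp b D - 1. (d i)\<^sup>2)"
    by (simp add: v_def scalar_prod_def atLeast0LessThan power2_eq_square)
  moreover have "(\<Sum>i<num_bp b D - 1. pdiff b D k (i + 2) * v $ i)
      = (\<Sum>i<num_bp b D - 1. pdiff b D k (i + 2) * d i)" for k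
    by (intro sum.cong) (auto simp: v_def)
  ultimately have "lambda_min (Sigma_mat b D) * (\<Sum>i<num_bp b D - 1. (d i)\<^sup>2)
      \<le> (\<Sum>k<length D. (\<Sum>i<num_bp b D - 1. pdiff b D k (i + 2) * d i)\<^sup>2) / real (length D)"
    by (simp only: Sigma_mat_quadratic_form[OF v])
  then show ?thesis
    using assms(2) by (simp add: pos_le_divide_eq mult.commute mult.left_commute)
qed

lemma det_Sigma_mat:
  assumes "num_bp b D \<ge> 2"
  shows "lambda_min (Sigma_mat b D) > 0 \<Longrightarrow> det (Sigma_mat b D) \<noteq> 0"
    and "lambda_min (Sigma_mat b D) = 0 \<Longrightarrow> det (Sigma_mat b D) = 0"
proof -
  have n: "num_bp b D - 1 > 0" using assms by simp
  note S = Sigma_mat_carrier[of b D]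
  note lam = lambda_min_symmetric[OF S Sigma_mat_symmetric n]
  show "det (Sigma_mat b D) = 0" if "lambda_min (Sigma_mat b D) = 0"
    using lam(1) that eigenvalue_0_iff_det[OF S] by simp
  show "det (Sigma_mat b D) \<noteq> 0" if pos: "lambda_min (Sigma_mat b D) > 0"
  proof
    assume "det (Sigma_mat b D) = 0"
    then have "eigenvalue (Sigma_mat b D) 0" using eigenvalue_0_iff_det[OF S] by simp
    moreover have "finite {k. eigenvalue (Sigma_mat b D) k}"
      using card_finite_spectrum(1)[OF S] by (simp add: spectrum_def)
    ultimately have "lambda_min (Sigma_mat b D) \<le> 0" by (simp add: lambda_min_def)
    with pos show False by simp
  qed
qed

lemma Sigma_mat_regular:
  assumes "num_bp b D \<ge> 2" "lambda_min (Sigma_mat b D) > 0"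
  shows "invertible_mat (Sigma_mat b D)"
    and "vec_space.rank (num_bp b D - 1) (Sigma_mat b D) = num_bp b D - 1"
  using det_Sigma_mat(1)[OF assms] invertible_mat_iff_det[OF Sigma_mat_carrier, of b D]
    vec_space.det_rank_iff[OF Sigma_mat_carrier, of b D] by simp_all

lemma Sigma_mat_singular:
  assumes "num_bp b D \<ge> 2" "lambda_min (Sigma_mat b D) = 0"
  shows "\<not> invertible_mat (Sigma_mat b D)"
    and "vec_space.rank (num_bp b D - 1) (Sigma_mat b D) < num_bp b D - 1"
proof -
  note det = det_Sigma_mat(2)[OF assms]
  then show "\<not> invertible_mat (Sigma_mat b D)"
    using invertible_mat_iff_det[OF Sigma_mat_carrier, of b D] by simp
  have "vec_space.rank (num_bp b D - 1) (Sigma_mat b D) \<noteq> num_bp b D - 1"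
    using det vec_space.det_rank_iff[OF Sigma_mat_carrier, of b D] by simp
  then show "vec_space.rank (num_bp b D - 1) (Sigma_mat b D) < num_bp b D - 1"
    using vec_space.rank_le_nc[OF Sigma_mat_carrier] by (rule le_neq_implies_less[rotated])
qed

subsection \<open>Strong convexity and projections\<close>

text \<open>The right-hand side is \<open>1 / (2 + exp t + exp (- t))\<close>, and each exponential
  is at most \<open>exp (2 * c)\<close>.\<close>

lemma logistic_curvature_ge_omega:
  assumes "\<bar>t\<bar> \<le> c"
  shows "omega c \<le> exp t / (1 + exp t)\<^sup>2"
proof -
  have "exp t \<le> exp (2 * c)" "exp (- t) \<le> exp (2 * c)" using assms by auto
  then have "exp t + exp (- t) \<le> 2 * exp (2 * c)" by linarith
  then have "exp t * (exp t + exp (- t)) \<le> exp t * (2 * exp (2 * c))" by (intro mult_left_mono) auto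
  then have "(1 + exp t)\<^sup>2 \<le> exp t * (2 + 2 * exp (2 * c))"
    by (simp add: algebra_simps power2_eq_square exp_minus)
  moreover have "0 < 1 + exp t" by (simp add: add_pos_pos)
  then have "0 < (1 + exp t)\<^sup>2" by simp
  moreover have "0 < 2 + 2 * exp (2 * c)" by (simp add: add_pos_pos)
  ultimately show ?thesis unfolding omega_def by (simp add: field_simps)
qed

text \<open>Subtracting \<open>omega c / 2 * t\<^sup>2\<close> from the loss leaves a function that
  is still convex on \<open>{-c..c}\<close>; the claim is its tangent inequality at
  \<open>x\<close>.\<close>

lemma logistic_loss_strong_convexity:
  assumes "\<bar>x\<bar> \<le> c" "\<bar>y\<bar> \<le> c"
  shows "ln (1 + exp (- x)) - (y - x) / (1 + exp x) + omega c / 2 * (y - x)\<^sup>2 \<le> ln (1 + exp (- y))"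
proof -
  define w where "w = omega c"
  define f where "f t = ln (1 + exp (- t)) - w / 2 * t\<^sup>2" for t :: real
  define f' where "f' t = - 1 / (1 + exp t) - w * t" for t :: real
  define f'' where "f'' t = exp t / (1 + exp t)\<^sup>2 - w" for t :: real
  have pos: "1 + exp t > 0" for t :: real by (simp add: add_pos_pos)
  have pos': "1 + exp t \<noteq> 0" for t :: real using pos[of t] by simp
  have e: "exp (- t) / (1 + exp (- t)) = 1 / (1 + exp t)" for t :: real
    using pos'[of t] pos'[of "-t"] by (simp add: field_simps exp_minus)
  have "f' x * (y - x) \<le> f y - f x"
  proof (rule f''_imp_f'[of "{-c..c}" f f' f''])
    show "(f has_real_derivative f' t) (at t)" for t
      unfolding f_def f'_def using pos[of "-t"] e[of t]
      by (auto intro!: derivative_eq_intros simp: power2_eq_square)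
    show "(f' has_real_derivative f'' t) (at t)" for t
      unfolding f'_def f''_def using pos'[of t]
      by (auto intro!: derivative_eq_intros simp: power2_eq_square)
    show "0 \<le> f'' t" if "t \<in> {-c..c}" for t
      using logistic_curvature_ge_omega[of t c] that by (auto simp: f''_def w_def abs_le_iff)
  qed (use assms in \<open>auto simp: abs_le_iff\<close>)
  moreover have "f' x * (y - x) = - ((y - x) / (1 + exp x)) - w * (x * (y - x))"
    unfolding f'_def by (simp add: left_diff_distrib)
  moreover have "w / 2 * (y - x)\<^sup>2 = w / 2 * y\<^sup>2 - w / 2 * x\<^sup>2 - w * (x * (y - x))"
    by (simp add: power2_eq_square field_simps)
  ultimately show ?thesis unfolding f_def w_def by linarith
qed

definition dot :: "nat \<Rightarrow> (nat \<Rightarrow> real) \<Rightarrow> (nat \<Rightarrow> real) \<Rightarrow> real" where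
  "dot K x y = (\<Sum>k<K. x k * y k)"

lemma dot_commute: "dot K x y = dot K y x"
  by (simp add: dot_def mult.commute)

lemma dot_cong: "(\<And>k. k < K \<Longrightarrow> x k = x' k) \<Longrightarrow> (\<And>k. k < K \<Longrightarrow> y k = y' k) \<Longrightarrow> dot K x y = dot K x' y'"
  by (simp add: dot_def)

lemma dot_add_right: "dot K x (\<lambda>k. y k + z k) = dot K x y + dot K x z"
  by (simp add: dot_def distrib_left sum.distrib)

lemma dot_diff_left: "dot K (\<lambda>k. y k - z k) x = dot K y x - dot K z x"
  by (simp add: dot_def left_diff_distrib sum_subtractf)

lemma dot_scale_right: "dot K x (\<lambda>k. a * y k) = a * dot K x y"
  by (simp add: dot_def sum_distrib_left mult.left_commute)

lemma dot_scale_left: "dot K (\<lambda>k. a * y k) x = a * dot K y x"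
  by (simp add: dot_def sum_distrib_left mult.assoc)

lemma dot_sum_left: "dot K (\<lambda>k. \<Sum>j\<in>J. f j k) x = (\<Sum>j\<in>J. dot K (f j) x)"
  unfolding dot_def sum_distrib_right by (rule sum.swap)

lemma dot_sum_right: "dot K x (\<lambda>k. \<Sum>j\<in>J. f j k) = (\<Sum>j\<in>J. dot K x (f j))"
  unfolding dot_def sum_distrib_left by (rule sum.swap)

lemma dot_self_nonneg: "0 \<le> dot K x x"
  by (simp add: dot_def sum_nonneg)

lemma dot_self_zeroD: "dot K x x = 0 \<Longrightarrow> k < K \<Longrightarrow> x k = 0"
  by (simp add: dot_def sum_nonneg_eq_0_iff)

text \<open>Linearly dependent vectors contribute zero vectors to the family, so that its length is
  that of the given list.\<close>

definition orthonormal_or_zero :: "nat \<Rightarrow> nat \<Rightarrow> (nat \<Rightarrow> nat \<Rightarrow> real) \<Rightarrow> bool" where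
  "orthonormal_or_zero K d e \<longleftrightarrow>
     (\<forall>i<d. dot K (e i) (e i) \<in> {0, 1}) \<and> (\<forall>i<d. \<forall>j<d. i \<noteq> j \<longrightarrow> dot K (e i) (e j) = 0)"

lemma gram_schmidt_family:
  obtains e where "orthonormal_or_zero K d e"
    "\<And>i k. i < d \<Longrightarrow> k < K \<Longrightarrow> v i k = (\<Sum>j<d. dot K (v i) (e j) * e j k)"
proof -
  have "\<exists>e. orthonormal_or_zero K d e \<and>
    (\<forall>i<d. \<forall>k<K. v i k = (\<Sum>j<d. dot K (v i) (e j) * e j k))"
  proof (induction d)
    case 0
    show ?case by (simp add: orthonormal_or_zero_def)
  next
    case (Suc d)
    then obtain e where e: "orthonormal_or_zero K d e"
      and rep: "\<forall>i<d. \<forall>k<K. v i k = (\<Sum>j<d. dot K (v i) (e j) * e j k)" by blast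
    define w where "w k = v d k - (\<Sum>j<d. dot K (v d) (e j) * e j k)" for k
    define r where "r = sqrt (dot K w w)"
    \<comment> \<open>If \<open>v d\<close> depends on the earlier vectors, then
      \<open>r = 0\<close> and division by 0 gives \<open>s = 0\<close>: the new member of the
      family is the zero vector.\<close>
    define s where "s = 1 / r"
    define e' where "e' = e(d := \<lambda>k. s * w k)"
    have w_e: "dot K w (e i) = 0" if "i < d" for i
    proof -
      have "dot K w (e i) = dot K (v d) (e i) - (\<Sum>j<d. dot K (v d) (e j) * dot K (e j) (e i))"
        unfolding w_def dot_diff_left dot_sum_left dot_scale_left by simp
      also have "(\<Sum>j<d. dot K (v d) (e j) * dot K (e j) (e i))
          = (\<Sum>j<d. if j = i then dot K (v d) (e i) * dot K (e i) (e i) else 0)"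
        using e that by (intro sum.cong) (auto simp: orthonormal_or_zero_def)
      also have "\<dots> = dot K (v d) (e i) * dot K (e i) (e i)" using that by simp
      \<comment> \<open>A zero vector \<open>e i\<close> makes both sides vanish; otherwise its
        squared norm is 1.\<close>
      also have "\<dots> = dot K (v d) (e i)"
      proof (cases "dot K (e i) (e i) = 0")
        case True
        then have "dot K (v d) (e i) = 0"
          using dot_self_zeroD[OF True] by (simp add: dot_def)
        then show ?thesis by simp
      next
        case False
        with e that show ?thesis by (auto simp: orthonormal_or_zero_def)
      qed
      finally show ?thesis by simp
    qed
    have r2: "r\<^sup>2 = dot K w w" by (simp add: r_def dot_self_nonneg)
    \<comment> \<open>\<open>v d\<close> and \<open>w\<close> differ by a combination of the earlier
      \<open>e j\<close>, all orthogonal to \<open>w\<close>.\<close>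
    have v_w: "dot K (v d) w = r\<^sup>2"
    proof -
      have "dot K (v d) w = dot K (\<lambda>k. w k + (\<Sum>j<d. dot K (v d) (e j) * e j k)) w"
        by (intro dot_cong) (auto simp: w_def)
      also have "\<dots> = dot K w w + (\<Sum>j<d. dot K (v d) (e j) * dot K (e j) w)"
        by (subst dot_commute) (simp only: dot_add_right dot_sum_right dot_scale_right dot_commute)
      also have "\<dots> = dot K w w" using w_e by (simp add: dot_commute)
      finally show ?thesis using r2 by simp
    qed
    have "dot K (e' d) (e' d) = s * (s * r\<^sup>2)"
      by (simp add: e'_def dot_scale_left dot_scale_right r2)
    then have norm: "dot K (e' d) (e' d) \<in> {0, 1}"
      by (cases "r = 0") (auto simp: s_def power2_eq_square)
    have ortho: "dot K (e' d) (e i) = 0" "dot K (e i) (e' d) = 0" if "i < d" for i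
      using w_e[OF that] by (simp_all add: e'_def dot_scale_left dot_commute[of K "e i"])
    have "orthonormal_or_zero K (Suc d) e'"
      using e norm ortho unfolding orthonormal_or_zero_def
      by (auto simp: less_Suc_eq) (auto simp: e'_def)
    moreover have "v i k = (\<Sum>j<Suc d. dot K (v i) (e' j) * e' j k)" if "i < Suc d" "k < K" for i k
    proof (cases "i = d")
      case True
      have "dot K (v d) (e' d) * e' d k = s * r\<^sup>2 * (s * w k)"
        by (simp add: e'_def dot_scale_right v_w)
      also have "\<dots> = w k"
        using dot_self_zeroD[of K w k] that
        by (cases "r = 0") (auto simp: s_def power2_eq_square simp flip: r2)
      finally have "dot K (v d) (e' d) * e' d k = w k" .
      then have "(\<Sum>j<Suc d. dot K (v d) (e' j) * e' j k) = (\<Sum>j<d. dot K (v d) (e j) * e j k) + w k"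
        by (simp add: e'_def)
      then show ?thesis using True by (simp add: w_def)
    next
      case False
      then have i: "i < d" using that by simp
      have "dot K (v i) (e' d) = dot K (\<lambda>k. \<Sum>j<d. dot K (v i) (e j) * e j k) (e' d)"
        using rep i by (intro dot_cong) auto
      also have "\<dots> = 0" unfolding dot_sum_left dot_scale_left using ortho by simp
      finally show ?thesis using rep i that by (simp add: e'_def)
    qed
    ultimately show ?case by blast
  qed
  then show ?thesis using that by blast
qed

text \<open>On the span of the \<open>v i\<close> the expansion in \<open>e\<close> is exact, so
  pairing with \<open>x\<close> only sees the \<open>d\<close> coefficients of \<open>V\<close>.
  Cauchy-Schwarz is applied to these coefficient vectors, and pairing the expansion of
  \<open>x\<close> with \<open>x\<close> itself is Parseval's identity.\<close>

lemma dot_sq_le_projection: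
  assumes rep: "\<And>i k. i < d \<Longrightarrow> k < K \<Longrightarrow> v i k = (\<Sum>j<d. dot K (v i) (e j) * e j k)"
    and x: "\<And>k. k < K \<Longrightarrow> x k = (\<Sum>i<d. a i * v i k)"
  shows "(dot K V x)\<^sup>2 \<le> (\<Sum>j<d. (dot K V (e j))\<^sup>2) * dot K x x"
proof -
  have x_e: "dot K x (e j) = (\<Sum>i<d. a i * dot K (v i) (e j))" for j
  proof -
    have "dot K x (e j) = dot K (\<lambda>k. \<Sum>i<d. a i * v i k) (e j)" using x by (intro dot_cong) auto
    then show ?thesis by (simp only: dot_sum_left dot_scale_left)
  qed
  have x_rep: "x k = (\<Sum>j<d. dot K x (e j) * e j k)" if "k < K" for k
  proof -
    have "x k = (\<Sum>i<d. a i * (\<Sum>j<d. dot K (v i) (e j) * e j k))"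
      using x that rep by simp
    also have "\<dots> = (\<Sum>j<d. \<Sum>i<d. a i * (dot K (v i) (e j) * e j k))"
      unfolding sum_distrib_left by (rule sum.swap)
    also have "\<dots> = (\<Sum>j<d. dot K x (e j) * e j k)"
      unfolding x_e sum_distrib_right by (simp only: mult.assoc)
    finally show ?thesis .
  qed
  have y_x: "dot K y x = (\<Sum>j<d. dot K x (e j) * dot K y (e j))" for y
  proof -
    have "dot K y x = dot K y (\<lambda>k. \<Sum>j<d. dot K x (e j) * e j k)" using x_rep by (intro dot_cong) auto
    then show ?thesis by (simp only: dot_sum_right dot_scale_right)
  qed
  have "(dot K V x)\<^sup>2 \<le> (\<Sum>j<d. (dot K x (e j))\<^sup>2) * (\<Sum>j<d. (dot K V (e j))\<^sup>2)"
    unfolding y_x[of V] by (rule Cauchy_Schwarz_ineq_sum)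
  also have "(\<Sum>j<d. (dot K x (e j))\<^sup>2) = dot K x x"
    unfolding y_x[of x] by (simp add: power2_eq_square)
  finally show ?thesis by (simp add: mult.commute)
qed

section \<open>Breakpoints as an increasing enumeration of the support set\<close>

lemma
  assumes "0 < b" "valid_queries b D"
  shows finite_support_set: "finite (support_set b D)"
    and support_set_subset: "support_set b D \<subseteq> {0..b}"
    and num_bp_ge_2: "2 \<le> num_bp b D"
proof -
  show fin: "finite (support_set b D)"
    using assms by (auto simp: support_set_def valid_queries_def lottery_def split: prod.splits)
  show "support_set b D \<subseteq> {0..b}"
    using assms by (fastforce simp: support_set_def valid_queries_def lottery_def split: prod.splits)
  have "card {0, b} \<le> num_bp b D"
    unfolding num_bp_def by (intro card_mono fin) (auto simp: support_set_def)
  then show "2 \<le> num_bp b D" using assms(1) by simp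
qed

lemma bp_bij_betw:
  assumes "0 < b" "valid_queries b D"
  shows "bij_betw (bp b D) {1..num_bp b D} (support_set b D)"
proof -
  let ?S = "support_set b D"
  have "bij_betw ((!) (sorted_list_of_set ?S)) {..<length (sorted_list_of_set ?S)} (set (sorted_list_of_set ?S))"
    by (intro bij_betw_nth) auto
  then have "bij_betw ((!) (sorted_list_of_set ?S)) {..<num_bp b D} ?S"
    using finite_support_set[OF assms] by (simp add: num_bp_def)
  moreover have "bij_betw (\<lambda>j. j - 1) {1..num_bp b D} {..<num_bp b D}"
    by (rule bij_betw_byWitness[where f' = Suc]) auto
  ultimately have "bij_betw ((!) (sorted_list_of_set ?S) \<circ> (\<lambda>j. j - 1)) {1..num_bp b D} ?S"
    by (rule bij_betw_trans[rotated])
  moreover have "(!) (sorted_list_of_set ?S) \<circ> (\<lambda>j. j - 1) = bp b D" by (auto simp: bp_def)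
  ultimately show ?thesis by simp
qed

lemma bp_strict_mono:
  assumes "1 \<le> i" "i < j" "j \<le> num_bp b D"
  shows "bp b D i < bp b D j"
proof -
  let ?xs = "sorted_list_of_set (support_set b D)"
  have "sorted_wrt (<) ?xs" "i - 1 < j - 1" "j - 1 < length ?xs"
    using assms by (auto simp: num_bp_def)
  then show ?thesis unfolding bp_def by (rule sorted_wrt_nth_less)
qed

lemma
  assumes "0 < b" "valid_queries b D"
  shows bp_first: "bp b D 1 = 0" and bp_last: "bp b D (num_bp b D) = b"
    and bp_range: "j \<in> {1..num_bp b D} \<Longrightarrow> bp b D j \<in> {0..b}"
proof -
  note bij = bp_bij_betw[OF assms] and sub = support_set_subset[OF assms]
  have N: "2 \<le> num_bp b D" using num_bp_ge_2[OF assms] .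
  show range: "bp b D j \<in> {0..b}" if "j \<in> {1..num_bp b D}" for j
    using bij_betwE[OF bij] sub that by blast
  have "0 \<in> bp b D ` {1..num_bp b D}" "b \<in> bp b D ` {1..num_bp b D}"
    using bij by (auto simp: bij_betw_def support_set_def)
  then obtain i j where i: "i \<in> {1..num_bp b D}" "bp b D i = 0"
    and j: "j \<in> {1..num_bp b D}" "bp b D j = b" by auto
  show "bp b D 1 = 0"
    using bp_strict_mono[of 1 i b D] i range[of 1] N by (cases "i = 1") auto
  show "bp b D (num_bp b D) = b"
    using bp_strict_mono[of j "num_bp b D" b D] j range[of "num_bp b D"] N
    by (cases "j = num_bp b D") auto
qed

subsection \<open>Deterministic error bound\<close>

lemma support_set_nth:
  assumes "k < length D"
  shows "set_pmf (fst (D ! k)) \<subseteq> support_set b D" "set_pmf (snd (D ! k)) \<subseteq> support_set b D"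
  using nth_mem[OF assms] by (force simp: support_set_def split: prod.splits)+

lemma expectation_bp:
  assumes "0 < b" "valid_queries b D" "set_pmf W \<subseteq> support_set b D"
  shows "measure_pmf.expectation W u = (\<Sum>j=1..num_bp b D. pmf W (bp b D j) * u (bp b D j))"
proof -
  have "measure_pmf.expectation W u = (\<Sum>y\<in>support_set b D. u y * pmf W y)"
    using assms finite_support_set by (intro integral_measure_pmf_real) auto
  also have "\<dots> = (\<Sum>j=1..num_bp b D. u (bp b D j) * pmf W (bp b D j))"
    by (rule sum.reindex_bij_betw[OF bp_bij_betw[OF assms(1,2)], symmetric])
  finally show ?thesis by (simp add: mult.commute)
qed

lemma sum_pdiff_utility:
  assumes "0 < b" "valid_queries b D" "k < length D"
  shows "(\<Sum>j=1..num_bp b D. pdiff b D k j * u (bp b D j))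
    = measure_pmf.expectation (fst (D ! k)) u - measure_pmf.expectation (snd (D ! k)) u"
  using support_set_nth[OF assms(3), of b]
  by (simp add: expectation_bp[OF assms(1,2)] pdiff_def left_diff_distrib sum_subtractf)

text \<open>The sum is a difference of two means of \<open>a\<close>, each in the interval from 0 to
  \<open>g\<close>. Hence the scaled utility gaps at the estimate and at the truth lie in
  \<open>{-c..c}\<close>, where the curvature bound is available.\<close>

lemma abs_sum_pdiff_le:
  assumes "0 < b" "valid_queries b D" "k < length D"
    and a: "\<And>j. j \<in> {1..num_bp b D} \<Longrightarrow> 0 \<le> a j \<and> a j \<le> g"
  shows "\<bar>\<Sum>j=1..num_bp b D. pdiff b D k j * a j\<bar> \<le> g"
proof -
  have mean: "0 \<le> (\<Sum>j=1..num_bp b D. pmf W (bp b D j) * a j)"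
    "(\<Sum>j=1..num_bp b D. pmf W (bp b D j) * a j) \<le> g"
    if W: "set_pmf W \<subseteq> support_set b D" for W
  proof -
    show "0 \<le> (\<Sum>j=1..num_bp b D. pmf W (bp b D j) * a j)" using a by (intro sum_nonneg) auto
    have "(\<Sum>j=1..num_bp b D. pmf W (bp b D j) * a j) \<le> (\<Sum>j=1..num_bp b D. pmf W (bp b D j) * g)"
      using a by (intro sum_mono mult_left_mono) auto
    also have "\<dots> = measure_pmf.expectation W (\<lambda>_. g)"
      using expectation_bp[OF assms(1,2) W, of "\<lambda>_. g"] by simp
    finally show "(\<Sum>j=1..num_bp b D. pmf W (bp b D j) * a j) \<le> g" by simp
  qed
  show ?thesis
    using mean[OF support_set_nth(1)[OF assms(3), of b]] mean[OF support_set_nth(2)[OF assms(3), of b]]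
    by (simp add: pdiff_def left_diff_distrib sum_subtractf)
qed

text \<open>The slopes decrease and the last one is nonnegative, so downward induction makes all of
  them nonnegative; thus \<open>\<alpha>\<close> increases from 0 to
  \<open>\<gamma>\<close>.\<close>

lemma feasible_alpha_range:
  assumes b: "0 < b" "valid_queries b D" and feas: "feasible b L c D (\<alpha>, \<beta>, \<gamma>)"
    and j: "j \<in> {1..num_bp b D}"
  shows "0 \<le> \<alpha> j" "\<alpha> j \<le> \<gamma>" "\<gamma> \<le> c" "0 \<le> \<gamma>"
proof -
  let ?N = "num_bp b D"
  have N: "2 \<le> ?N" using num_bp_ge_2[OF b] .
  have dec: "\<beta> (i + 1) \<le> \<beta> i" if "i \<in> {1..?N - 2}" for i
    using feas that by (auto simp: feasible_def Let_def)
  have last: "0 \<le> \<beta> (?N - 1)" using feas by (auto simp: feasible_def Let_def)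
  have ends: "\<alpha> 1 = 0" "\<alpha> ?N = \<gamma>" using feas by (auto simp: feasible_def Let_def)
  have \<beta>: "0 \<le> \<beta> i" if "1 \<le> i" "i \<le> ?N - 1" for i
    using that(2,1)
  proof (induction i rule: inc_induct)
    case (step i)
    then show ?case using dec[of i] by force
  qed (rule last)
  have incr: "\<alpha> i \<le> \<alpha> (i + 1)" if "1 \<le> i" "i \<le> ?N - 1" for i
  proof -
    have "\<beta> i = (\<alpha> (i + 1) - \<alpha> i) / (bp b D (i + 1) - bp b D i)"
      using feas that by (auto simp: feasible_def Let_def)
    moreover have "bp b D i < bp b D (i + 1)" using that N by (intro bp_strict_mono) auto
    ultimately show ?thesis using \<beta>[OF that] by (simp add: zero_le_divide_iff)
  qed
  have mono: "\<alpha> i \<le> \<alpha> i'" if "i \<le> i'" "1 \<le> i" "i' \<le> ?N" for i i'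
    using that
  proof (induction i' rule: dec_induct)
    case (step m)
    then show ?case using incr[of m] by force
  qed simp
  show "0 \<le> \<alpha> j" "\<alpha> j \<le> \<gamma>" using mono[of 1 j] mono[of j ?N] j ends by auto
  show "\<gamma> \<le> c" "0 \<le> \<gamma>" using feas by (auto simp: feasible_def Let_def)
qed

text \<open>For \<open>\<gamma> > 0\<close> the scale cancels. For \<open>\<gamma> = 0\<close> the
  quotient is 0 by the convention on division, and \<open>\<alpha> j\<close> is squeezed between 0
  and \<open>\<gamma>\<close>.\<close>

lemma ratio_hat_eq_alpha:
  assumes "0 < b" "valid_queries b D" "feasible b L c D s" "j \<in> {1..num_bp b D}"
  shows "alpha_hat s j / sigma_hat s = fst s j"
proof -
  obtain \<alpha> \<beta> \<gamma> where s: "s = (\<alpha>, \<beta>, \<gamma>)" by (cases s) auto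
  show ?thesis
    using feasible_alpha_range[OF assms(1,2) assms(3)[unfolded s] assms(4)]
    by (cases "\<gamma> = 0") (auto simp: alpha_hat_def sigma_hat_def s)
qed

lemma
  assumes u: "u \<in> utility_class b L"
  shows utility_mono: "\<And>x y. 0 \<le> x \<Longrightarrow> x \<le> y \<Longrightarrow> y \<le> b \<Longrightarrow> u x \<le> u y"
    and utility_ends: "u 0 = 0" "u b = 1"
    and utility_lipschitz: "\<And>x y. 0 \<le> x \<Longrightarrow> x \<le> y \<Longrightarrow> y \<le> b \<Longrightarrow> u y - u x \<le> L * (y - x)"
    and utility_slope: "\<And>x y z. 0 \<le> x \<Longrightarrow> x < y \<Longrightarrow> y < z \<Longrightarrow> z \<le> b \<Longrightarrow>
      (u z - u y) / (z - y) \<le> (u y - u x) / (y - x)"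
proof -
  show "u 0 = 0" "u b = 1" using u by (auto simp: utility_class_def)
  show "u x \<le> u y" if "0 \<le> x" "x \<le> y" "y \<le> b" for x y
    using u that by (auto simp: utility_class_def mono_on_def)
  show "u y - u x \<le> L * (y - x)" if "0 \<le> x" "x \<le> y" "y \<le> b" for x y
  proof -
    have "dist (u y) (u x) \<le> L * dist y x"
      using u that by (intro lipschitz_onD[of L "{0..b}"]) (auto simp: utility_class_def)
    then show ?thesis using that by (simp add: dist_real_def)
  qed
  show "(u z - u y) / (z - y) \<le> (u y - u x) / (y - x)"
    if xyz: "0 \<le> x" "x < y" "y < z" "z \<le> b" for x y z
  proof -
    have "convex_on {0..b} (\<lambda>x. - u x)" using u by (auto simp: utility_class_def concave_on_def)
    then have "(- u x - - u y) / (x - y) \<le> (- u x - - u z) / (x - z)"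
      "(- u x - - u z) / (x - z) \<le> (- u y - - u z) / (y - z)"
      using xyz convex_on_slope_le[of "{0..b}" "\<lambda>x. - u x" x z y]
      by auto
    moreover have "(- u x - - u y) / (x - y) = - ((u y - u x) / (y - x))"
      using xyz by (simp add: field_simps)
    moreover have "(- u y - - u z) / (y - z) = - ((u z - u y) / (z - y))"
      using xyz by (simp add: field_simps)
    ultimately show ?thesis by linarith
  qed
qed

text \<open>Makes the truth a competitor in the likelihood maximisation. Chord slopes inherit
  monotonicity from concavity and the bound \<open>L / \<sigma>\<close> from the Lipschitz
  condition; \<open>1 / c \<le> \<sigma>\<close> is the constraint \<open>\<gamma> \<le> c\<close>
  at \<open>\<gamma> = 1 / \<sigma>\<close>.\<close>

lemma truth_feasible:
  assumes b: "0 < b" "valid_queries b D" and u: "u \<in> utility_class b L"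
    and "0 < c" "1 / c \<le> \<sigma>"
  obtains \<beta> where "feasible b L c D (\<lambda>j. u (bp b D j) / \<sigma>, \<beta>, 1 / \<sigma>)"
proof -
  let ?N = "num_bp b D" and ?y = "bp b D"
  have N: "2 \<le> ?N" using num_bp_ge_2[OF b] .
  have "0 < 1 / c" using assms(4) by simp
  then have \<sigma>: "0 < \<sigma>" using assms(5) by linarith
  then have \<sigma>c: "1 / \<sigma> \<le> c" using assms(4,5) by (simp add: field_simps)
  define \<beta> where "\<beta> j = (u (?y (j + 1)) / \<sigma> - u (?y j) / \<sigma>) / (?y (j + 1) - ?y j)" for j
  have \<beta>: "\<beta> j = ((u (?y (j + 1)) - u (?y j)) / (?y (j + 1) - ?y j)) / \<sigma>" for j
    by (simp add: \<beta>_def flip: diff_divide_distrib)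
  have N1: "1 \<le> ?N - 1" using N by simp
  have lt: "?y j < ?y (j + 1)" "0 \<le> ?y j" "?y (j + 1) \<le> b" if "1 \<le> j" "j \<le> ?N - 1" for j
    using bp_strict_mono[of j "j + 1" b D] bp_range[OF b, of j] bp_range[OF b, of "j + 1"] that N by auto
  have "\<beta> (j + 1) \<le> \<beta> j" if "j \<in> {1..?N - 2}" for j
  proof -
    have "(u (?y (j + 1 + 1)) - u (?y (j + 1))) / (?y (j + 1 + 1) - ?y (j + 1))
        \<le> (u (?y (j + 1)) - u (?y j)) / (?y (j + 1) - ?y j)"
      using lt[of j] lt[of "j + 1"] that N by (intro utility_slope[OF u]) auto
    then show ?thesis unfolding \<beta> using \<sigma> by (intro divide_right_mono) auto
  qed
  moreover have "\<beta> 1 \<le> L * (1 / \<sigma>)"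
  proof -
    have "u (?y (1 + 1)) - u (?y 1) \<le> L * (?y (1 + 1) - ?y 1)"
      using lt[OF order_refl N1] by (intro utility_lipschitz[OF u]) auto
    then have "(u (?y (1 + 1)) - u (?y 1)) / (?y (1 + 1) - ?y 1) \<le> L"
      using lt[OF order_refl N1] by (simp add: pos_divide_le_eq)
    from divide_right_mono[OF this, of \<sigma>] show ?thesis unfolding \<beta> using \<sigma> by simp
  qed
  moreover have "0 \<le> \<beta> (?N - 1)"
    unfolding \<beta> using lt[OF N1 order_refl] N \<sigma> utility_mono[OF u, of "?y (?N - 1)" "?y (?N - 1 + 1)"]
    by (intro divide_nonneg_nonneg) auto
  ultimately have "feasible b L c D (\<lambda>j. u (bp b D j) / \<sigma>, \<beta>, 1 / \<sigma>)"
    unfolding feasible_def Let_def using \<sigma> \<sigma>c bp_first[OF b] bp_last[OF b] utility_ends[OF u]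
    by (auto simp: \<beta>_def)
  then show ?thesis using that by blast
qed

definition utility_gap :: "(real \<Rightarrow> real) \<Rightarrow> queries \<Rightarrow> nat \<Rightarrow> real" where
  "utility_gap u D k =
     measure_pmf.expectation (fst (D ! k)) u - measure_pmf.expectation (snd (D ! k)) u"

text \<open>The response residual \<open>Z_k / (1 + exp (Z_k m_k))\<close>, minus the derivative of the loss of
  query \<open>k\<close> at the true parameter, equals \<open>1 - p\<close> for \<open>Z_k = 1\<close> and \<open>- p\<close> for \<open>Z_k = - 1\<close>,
  where \<open>p\<close> is the probability of \<open>Z_k = 1\<close>.\<close>

definition residual :: "(real \<Rightarrow> real) \<Rightarrow> real \<Rightarrow> queries \<Rightarrow> int list \<Rightarrow> nat \<Rightarrow> real" where
  "residual u \<sigma> D z k = of_int (z ! k) / (1 + exp (of_int (z ! k) * (utility_gap u D k / \<sigma>)))"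

text \<open>Optimality says that the total loss at the estimate is at most the loss at the truth.
  Expanding the former around the latter by strong convexity leaves the quadratic term against the
  linear one, whose coefficients are the residuals.\<close>

lemma basic_inequality:
  assumes b: "0 < b" "valid_queries b D" and u: "u \<in> utility_class b L"
    and c: "0 < c" "1 / c \<le> \<sigma>"
    and z: "length z = length D" "set z \<subseteq> {1, - 1}" and opt: "optimal b L c D z s"
  defines "x \<equiv> \<lambda>k. \<Sum>j=1..num_bp b D. pdiff b D k j * est_err b u \<sigma> D s j"
  shows "omega c / 2 * dot (length D) x x \<le> dot (length D) (residual u \<sigma> D z) x"
proof -
  let ?N = "num_bp b D" and ?y = "bp b D"
  obtain \<alpha> \<beta> \<gamma> where s: "s = (\<alpha>, \<beta>, \<gamma>)" by (cases s) auto
  have feas: "feasible b L c D (\<alpha>, \<beta>, \<gamma>)" using opt by (simp add: optimal_def s)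
  define m where "m k = utility_gap u D k / \<sigma>" for k
  define a where "a k = (\<Sum>j=1..?N. pdiff b D k j * \<alpha> j)" for k
  have m_eq: "(\<Sum>j=1..?N. pdiff b D k j * (u (?y j) / \<sigma>)) = m k" if "k < length D" for k
    using sum_pdiff_utility[OF b that, of u]
    by (simp add: m_def utility_gap_def flip: sum_divide_distrib)
  have x_eq: "x k = a k - m k" if "k < length D" for k
  proof -
    have "x k = (\<Sum>j=1..?N. pdiff b D k j * (\<alpha> j - u (?y j) / \<sigma>))"
      unfolding x_def est_err_def using ratio_hat_eq_alpha[OF b feas]
      by (intro sum.cong) (auto simp: s)
    also have "\<dots> = a k - m k"
      using m_eq[OF that] by (simp add: a_def right_diff_distrib sum_subtractf)
    finally show ?thesis .
  qed
  obtain \<beta>' where feas': "feasible b L c D (\<lambda>j. u (?y j) / \<sigma>, \<beta>', 1 / \<sigma>)"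
    using truth_feasible[OF b u c] .
  have abs_a: "\<bar>a k\<bar> \<le> c" if "k < length D" for k
    unfolding a_def using feasible_alpha_range[OF b feas]
    by (intro abs_sum_pdiff_le[OF b that]) force
  have abs_m: "\<bar>m k\<bar> \<le> c" if "k < length D" for k
    unfolding m_eq[OF that, symmetric] using feasible_alpha_range[OF b feas']
    by (intro abs_sum_pdiff_le[OF b that]) force
  have zk: "z ! k = 1 \<or> z ! k = - 1" if "k < length D" for k
    using z(1) subsetD[OF z(2) nth_mem[of k z]] that by simp
  have ll: "log_likelihood b D z f = - (\<Sum>k<length D. ln (1 + exp (- (of_int (z ! k) * (\<Sum>j=1..?N. pdiff b D k j * f j)))))" for f
    unfolding log_likelihood_def by (simp add: sum_distrib_left mult.assoc sum_negf)
  have sum_m: "(\<Sum>k<length D. ln (1 + exp (- (of_int (z ! k) * (\<Sum>j=1..?N. pdiff b D k j * (u (?y j) / \<sigma>))))))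
      = (\<Sum>k<length D. ln (1 + exp (- (of_int (z ! k) * m k))))"
  proof (rule sum.cong[OF refl])
    fix k assume "k \<in> {..<length D}"
    then show "ln (1 + exp (- (of_int (z ! k) * (\<Sum>j=1..?N. pdiff b D k j * (u (?y j) / \<sigma>)))))
        = ln (1 + exp (- (of_int (z ! k) * m k)))"
      by (simp only: m_eq lessThan_iff)
  qed
  have "log_likelihood b D z (\<lambda>j. u (?y j) / \<sigma>) \<le> log_likelihood b D z \<alpha>"
    using opt feas' by (force simp: optimal_def s)
  then have "(\<Sum>k<length D. ln (1 + exp (- (of_int (z ! k) * a k))))
      \<le> (\<Sum>k<length D. ln (1 + exp (- (of_int (z ! k) * m k))))"
    unfolding ll a_def[symmetric] neg_le_iff_le sum_m .
  moreover have "(\<Sum>k<length D. ln (1 + exp (- (of_int (z ! k) * m k))) - residual u \<sigma> D z k * x k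
        + omega c / 2 * (x k)\<^sup>2) \<le> (\<Sum>k<length D. ln (1 + exp (- (of_int (z ! k) * a k))))"
  proof (intro sum_mono)
    fix k assume "k \<in> {..<length D}"
    then have k: "k < length D" by simp
    let ?z = "of_int (z ! k) :: real"
    have "\<bar>?z * m k\<bar> \<le> c" "\<bar>?z * a k\<bar> \<le> c"
      using zk[OF k] abs_m[OF k] abs_a[OF k] by (auto simp: abs_mult)
    from logistic_loss_strong_convexity[OF this]
    have "ln (1 + exp (- (?z * m k))) - (?z * a k - ?z * m k) / (1 + exp (?z * m k))
        + omega c / 2 * (?z * a k - ?z * m k)\<^sup>2 \<le> ln (1 + exp (- (?z * a k)))" .
    moreover have "(?z * a k - ?z * m k) / (1 + exp (?z * m k)) = residual u \<sigma> D z k * x k"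
      unfolding residual_def x_eq[OF k] m_def right_diff_distrib[symmetric] by simp
    \<comment> \<open>The response is a sign and disappears when squared.\<close>
    moreover have "(?z * a k - ?z * m k)\<^sup>2 = (x k)\<^sup>2"
      using zk[OF k] by (auto simp: x_eq[OF k] power2_commute)
    ultimately show "ln (1 + exp (- (?z * m k))) - residual u \<sigma> D z k * x k + omega c / 2 * (x k)\<^sup>2
        \<le> ln (1 + exp (- (?z * a k)))" by simp
  qed
  ultimately have "(\<Sum>k<length D. omega c / 2 * (x k)\<^sup>2) \<le> (\<Sum>k<length D. residual u \<sigma> D z k * x k)"
    unfolding sum.distrib sum_subtractf by linarith
  then show ?thesis
    unfolding dot_def sum_distrib_left power2_eq_square .
qed

lemma omega_pos: "0 < omega c"
  by (simp add: omega_def add_pos_pos)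

text \<open>Squaring the basic inequality and bounding its right side by the projected residual
  gives a common factor, the squared norm of \<open>x = P d\<close>. Cancelling it bounds that norm
  by \<open>4 / (omega c)\<^sup>2\<close> times the projection, and \<open>lambda_min\<close> passes
  from \<open>x\<close> to \<open>d\<close>.\<close>

lemma err_l2_sq_le_projected_residual:
  assumes b: "0 < b" "valid_queries b D" and u: "u \<in> utility_class b L"
    and c: "0 < c" "1 / c \<le> \<sigma>"
    and z: "length z = length D" "set z \<subseteq> {1, - 1}" and opt: "optimal b L c D z s"
    and rep: "\<And>i k. i < num_bp b D - 1 \<Longrightarrow> k < length D \<Longrightarrow> pdiff b D k (i + 2)
      = (\<Sum>j<num_bp b D - 1. dot (length D) (\<lambda>k. pdiff b D k (i + 2)) (e j) * e j k)"
  shows "real (length D) * lambda_min (Sigma_mat b D) * (err_l2 b u \<sigma> D s)\<^sup>2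
    \<le> 4 / (omega c)\<^sup>2 * (\<Sum>j<num_bp b D - 1. (dot (length D) (residual u \<sigma> D z) (e j))\<^sup>2)"
proof -
  let ?N = "num_bp b D" and ?K = "length D" and ?V = "residual u \<sigma> D z"
  define d where "d = est_err b u \<sigma> D s"
  define x where "x k = (\<Sum>j=1..?N. pdiff b D k j * d j)" for k
  define Q where "Q = (\<Sum>j<?N - 1. (dot ?K ?V (e j))\<^sup>2)"
  have N: "2 \<le> ?N" using num_bp_ge_2[OF b] .
  have feas: "feasible b L c D s" using opt by (simp add: optimal_def)
  have d1: "d 1 = 0"
    using ratio_hat_eq_alpha[OF b feas, of 1] feas N utility_ends[OF u] bp_first[OF b]
    by (auto simp: d_def est_err_def feasible_def Let_def split: prod.splits)
  \<comment> \<open>The first breakpoint has zero error, so the sums shrink to the columns of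
    \<open>P_mat\<close>, where column \<open>i\<close> belongs to \<open>j = i + 2\<close>. The
    identity as \<open>g\<close> serves the prediction, the square serves the norm.\<close>
  have drop: "(\<Sum>j=1..?N. f j * g (d j)) = (\<Sum>i<?N - 1. f (i + 2) * g (d (i + 2)))"
    if "g 0 = 0" for f and g :: "real \<Rightarrow> real"
  proof -
    have "(\<Sum>j=1..?N. f j * g (d j)) = f 1 * g (d 1) + (\<Sum>j=Suc 1..?N. f j * g (d j))"
      using N by (intro sum.atLeast_Suc_atMost) simp
    also have "(\<Sum>j=Suc 1..?N. f j * g (d j)) = (\<Sum>i<?N - 1. f (i + 2) * g (d (i + 2)))"
    proof (rule sum.reindex_bij_witness[of _ "\<lambda>i. i + 2" "\<lambda>j. j - 2"])
      fix j assume "j \<in> {Suc 1..?N}"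
      then show "j - 2 + 2 = j" "j - 2 \<in> {..<?N - 1}" by auto
      then show "f (j - 2 + 2) * g (d (j - 2 + 2)) = f j * g (d j)" by simp
    qed auto
    finally show ?thesis using d1 that by simp
  qed
  have x: "x k = (\<Sum>i<?N - 1. d (i + 2) * pdiff b D k (i + 2))" for k
    unfolding x_def drop[where g = "\<lambda>t. t", OF refl] by (simp add: mult.commute)
  have "omega c / 2 * dot ?K x x \<le> dot ?K ?V x"
    using basic_inequality[OF b u c z opt] by (simp add: x_def[abs_def] d_def)
  then have "(omega c / 2 * dot ?K x x)\<^sup>2 \<le> (dot ?K ?V x)\<^sup>2"
    using omega_pos[of c] dot_self_nonneg[of ?K x] by (intro power_mono) auto
  also have "\<dots> \<le> Q * dot ?K x x"
    unfolding Q_def using rep x by (intro dot_sq_le_projection[where v = "\<lambda>i k. pdiff b D k (i + 2)"]) auto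
  finally have "((omega c)\<^sup>2 / 4 * dot ?K x x) * dot ?K x x \<le> Q * dot ?K x x"
    by (simp add: power2_eq_square mult_ac)
  moreover have "0 \<le> Q" by (simp add: Q_def sum_nonneg)
  ultimately have "(omega c)\<^sup>2 / 4 * dot ?K x x \<le> Q"
    using dot_self_nonneg[of ?K x] by (cases "dot ?K x x = 0") auto
  then have "dot ?K x x \<le> 4 / (omega c)\<^sup>2 * Q"
    using omega_pos[of c] by (simp add: field_simps)
  moreover have "real ?K * lambda_min (Sigma_mat b D) * (err_l2 b u \<sigma> D s)\<^sup>2 \<le> dot ?K x x"
  proof -
    have "(err_l2 b u \<sigma> D s)\<^sup>2 = (\<Sum>j=1..?N. 1 * (d j)\<^sup>2)"
      by (simp add: err_l2_def L2_set_def d_def sum_nonneg)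
    also have "\<dots> = (\<Sum>i<?N - 1. (d (i + 2))\<^sup>2)"
      by (subst drop) auto
    finally have "(err_l2 b u \<sigma> D s)\<^sup>2 = (\<Sum>i<?N - 1. (d (i + 2))\<^sup>2)" .
    moreover have "dot ?K x x = (\<Sum>k<?K. (\<Sum>i<?N - 1. pdiff b D k (i + 2) * d (i + 2))\<^sup>2)"
      by (simp add: dot_def x power2_eq_square mult.commute)
    moreover have "D \<noteq> []" using b by (simp add: valid_queries_def)
    ultimately show ?thesis using lambda_min_Sigma_mat[OF N, of "\<lambda>i. d (i + 2)"] by simp
  qed
  ultimately show ?thesis by (simp add: Q_def)
qed

lemma err_linf_le_l2:
  assumes "0 < b" "valid_queries b D"
  shows "0 \<le> err_linf b u \<sigma> D s" "err_linf b u \<sigma> D s \<le> err_l2 b u \<sigma> D s"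
proof -
  have N: "2 \<le> num_bp b D" using num_bp_ge_2[OF assms] .
  have "\<bar>est_err b u \<sigma> D s j\<bar> \<le> err_l2 b u \<sigma> D s" if "j \<in> {1..num_bp b D}" for j
    using that member_le_L2_set[of "{1..num_bp b D}" j "\<lambda>j. \<bar>est_err b u \<sigma> D s j\<bar>"]
    by (simp add: err_l2_def L2_set_def)
  then show "err_linf b u \<sigma> D s \<le> err_l2 b u \<sigma> D s"
    unfolding err_linf_def using N by (subst Max_le_iff) auto
  have "\<bar>est_err b u \<sigma> D s 1\<bar> \<le> err_linf b u \<sigma> D s"
    unfolding err_linf_def using N by (intro Max_ge) auto
  then show "0 \<le> err_linf b u \<sigma> D s" by linarith
qed

text \<open>At every breakpoint estimate and truth both lie between 0 and \<open>c\<close>, and at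
  the first one they agree, which leaves \<open>N - 1\<close> coordinates of size at most
  \<open>c\<close>.\<close>

lemma err_l2_le_diameter:
  assumes b: "0 < b" "valid_queries b D" and u: "u \<in> utility_class b L"
    and c: "0 < c" "1 / c \<le> \<sigma>" and feas: "feasible b L c D s"
  shows "err_l2 b u \<sigma> D s \<le> c * sqrt (real (num_bp b D) - 1)"
proof -
  let ?N = "num_bp b D"
  obtain \<alpha> \<beta> \<gamma> where s: "s = (\<alpha>, \<beta>, \<gamma>)" by (cases s) auto
  obtain \<beta>' where feas': "feasible b L c D (\<lambda>j. u (bp b D j) / \<sigma>, \<beta>', 1 / \<sigma>)"
    using truth_feasible[OF b u c] .
  have N: "2 \<le> ?N" using num_bp_ge_2[OF b] .
  have err: "est_err b u \<sigma> D s j = \<alpha> j - u (bp b D j) / \<sigma>" if "j \<in> {1..?N}" for j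
    using ratio_hat_eq_alpha[OF b feas that] by (simp add: est_err_def s)
  have sq: "(est_err b u \<sigma> D s j)\<^sup>2 \<le> c\<^sup>2" if "j \<in> {1..?N}" for j
  proof -
    have "\<bar>est_err b u \<sigma> D s j\<bar> \<le> c"
      using feasible_alpha_range[OF b feas[unfolded s] that] feasible_alpha_range[OF b feas' that]
      unfolding err[OF that] by linarith
    from power_mono[OF this, of 2] show ?thesis by simp
  qed
  have "est_err b u \<sigma> D s 1 = 0"
    using err[of 1] feas N utility_ends[OF u] bp_first[OF b] by (auto simp: feasible_def Let_def s)
  then have "(\<Sum>j=1..?N. (est_err b u \<sigma> D s j)\<^sup>2) = (\<Sum>j=Suc 1..?N. (est_err b u \<sigma> D s j)\<^sup>2)"
    using N sum.atLeast_Suc_atMost[of 1 ?N "\<lambda>j. (est_err b u \<sigma> D s j)\<^sup>2"] by simp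
  also have "\<dots> \<le> (\<Sum>j=Suc 1..?N. c\<^sup>2)" using sq by (intro sum_mono) auto
  also have "\<dots> = c\<^sup>2 * (real ?N - 1)" using N by (simp add: of_nat_diff algebra_simps)
  finally have "err_l2 b u \<sigma> D s \<le> sqrt (c\<^sup>2 * (real ?N - 1))"
    unfolding err_l2_def L2_set_def by (rule real_sqrt_le_mono)
  then show ?thesis using c(1) by (simp add: real_sqrt_mult)
qed

subsection \<open>Tail bound for projected sub-Gaussian vectors\<close>

text \<open>Completing the square turns the integrand into \<open>exp (y\<^sup>2 / 2)\<close> times
  the normal density with mean \<open>y\<close>.\<close>

lemma nn_integral_gaussian_exp:
  "(\<integral>\<^sup>+g. ennreal (exp (g * y)) * ennreal (std_normal_density g) \<partial>lborel) = ennreal (exp (y\<^sup>2 / 2))"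
proof -
  have "exp (g * y) * std_normal_density g = exp (y\<^sup>2 / 2) * normal_density y 1 g" for g
  proof -
    have "g * y + - g\<^sup>2 / 2 = y\<^sup>2 / 2 + - (g - y)\<^sup>2 / 2" by (simp add: field_simps power2_eq_square)
    then have "exp (g * y) * exp (- g\<^sup>2 / 2) = exp (y\<^sup>2 / 2) * exp (- (g - y)\<^sup>2 / 2)"
      by (simp flip: exp_add)
    then show ?thesis by (simp add: normal_density_def)
  qed
  then have "(\<integral>\<^sup>+g. ennreal (exp (g * y)) * ennreal (std_normal_density g) \<partial>lborel)
      = (\<integral>\<^sup>+g. ennreal (exp (y\<^sup>2 / 2)) * ennreal (normal_density y 1 g) \<partial>lborel)"
    by (simp flip: ennreal_mult)
  also have "\<dots> = ennreal (exp (y\<^sup>2 / 2)) * (\<integral>\<^sup>+g. ennreal (normal_density y 1 g) \<partial>lborel)"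
    by (rule nn_integral_cmult) simp
  also have "(\<integral>\<^sup>+g. ennreal (normal_density y 1 g) \<partial>lborel) = 1"
    using prob_space.emeasure_space_1[OF prob_space_normal_density[of 1 y]]
    by (simp add: emeasure_density)
  finally show ?thesis by simp
qed

lemma nn_integral_gaussian_exp_square:
  "(\<integral>\<^sup>+g. ennreal (exp (g\<^sup>2 / 8)) * ennreal (std_normal_density g) \<partial>lborel) \<le> ennreal (exp (1 / 2))"
proof -
  \<comment> \<open>The combined exponent has coefficient
    \<open>1 / 8 - 1 / 2 = - 3 / 8 = - 1 / (2 * s\<^sup>2)\<close>. The integrand is therefore
    \<open>s\<close> times a normal density of standard deviation \<open>s\<close>, and the integral
    is exactly \<open>s\<close>.\<close>
  define s where "s = sqrt (4 / 3 :: real)"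
  have s: "s > 0" "s\<^sup>2 = 4 / 3" by (auto simp: s_def)
  have "exp (g\<^sup>2 / 8) * std_normal_density g = s * normal_density 0 s g" for g
  proof -
    have "g\<^sup>2 / 8 + - g\<^sup>2 / 2 = - g\<^sup>2 / (2 * s\<^sup>2)" by (simp add: s)
    then have "exp (g\<^sup>2 / 8) * exp (- g\<^sup>2 / 2) = exp (- g\<^sup>2 / (2 * s\<^sup>2))"
      by (simp flip: exp_add)
    moreover have "sqrt (2 * pi * s\<^sup>2) = sqrt (2 * pi) * s" using s(1) by (simp add: real_sqrt_mult)
    ultimately show ?thesis using s(1) unfolding normal_density_def by simp
  qed
  then have "(\<integral>\<^sup>+g. ennreal (exp (g\<^sup>2 / 8)) * ennreal (std_normal_density g) \<partial>lborel)
      = (\<integral>\<^sup>+g. ennreal s * ennreal (normal_density 0 s g) \<partial>lborel)"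
    using s by (simp flip: ennreal_mult)
  also have "\<dots> = ennreal s * (\<integral>\<^sup>+g. ennreal (normal_density 0 s g) \<partial>lborel)"
    by (rule nn_integral_cmult) simp
  also have "(\<integral>\<^sup>+g. ennreal (normal_density 0 s g) \<partial>lborel) = 1"
    using prob_space.emeasure_space_1[OF prob_space_normal_density[of s 0]] s
    by (simp add: emeasure_density)
  also have "ennreal s * 1 \<le> ennreal (exp (1 / 2))"
  proof -
    have "s\<^sup>2 \<le> exp 1" using exp_ge_add_one_self[of 1] s by simp
    also have "exp 1 = (exp (1 / 2 :: real))\<^sup>2" by (simp flip: exp_of_nat_mult)
    finally have "s \<le> exp (1 / 2)" by (rule power2_le_imp_le) simp
    then show ?thesis by (simp add: ennreal_leI)
  qed
  finally show ?thesis .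
qed

text \<open>Linearising each square by \<open>exp (x\<^sup>2 / 2) = E (exp (g x))\<close> for a standard Gaussian \<open>g\<close>
  reduces the quadratic exponential moment to the sub-Gaussian bound for linear functionals; the
  vector \<open>w\<close> carries the directions that have already been linearised.\<close>

lemma (in prob_space) quadratic_mgf:
  fixes V :: "nat \<Rightarrow> 'a \<Rightarrow> real"
  assumes [measurable]: "\<And>k. k < K \<Longrightarrow> V k \<in> borel_measurable M"
    and subgauss: "\<And>w. (\<integral>\<^sup>+x. ennreal (exp (dot K (\<lambda>k. V k x) w)) \<partial>M) \<le> ennreal (exp (dot K w w / 8))"
    and e: "orthonormal_or_zero K d e"
  shows "(\<integral>\<^sup>+x. ennreal (exp ((\<Sum>j<d. (dot K (\<lambda>k. V k x) (e j))\<^sup>2) / 2)) \<partial>M) \<le> ennreal (exp (real d / 2))"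
proof -
  have meas[measurable]: "(\<lambda>x. dot K (\<lambda>k. V k x) w) \<in> borel_measurable M" for w
    unfolding dot_def by (intro borel_measurable_sum) measurable
  let ?Q = "\<lambda>d x. (\<Sum>j<d. (dot K (\<lambda>k. V k x) (e j))\<^sup>2) / 2"
  have "(\<integral>\<^sup>+x. ennreal (exp (?Q d x + dot K (\<lambda>k. V k x) w)) \<partial>M)
      \<le> ennreal (exp (real d / 2 + dot K w w / 8))"
    if "orthonormal_or_zero K d e" "\<And>j. j < d \<Longrightarrow> dot K (e j) w = 0" for d w
    using that
  proof (induction d arbitrary: w)
    case 0
    then show ?case using subgauss[of w] by simp
  next
    case (Suc d)
    let ?v = "\<lambda>g k. w k + g * e d k"
    have e': "orthonormal_or_zero K d e" and nrm: "dot K (e d) (e d) \<in> {0, 1}"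
      and orth: "\<And>j. j < d \<Longrightarrow> dot K (e j) (e d) = 0"
      using Suc.prems(1) by (auto simp: orthonormal_or_zero_def)
    have w: "dot K (e d) w = 0" using Suc.prems(2)[of d] by simp
    have split: "ennreal (exp (?Q (Suc d) x + dot K (\<lambda>k. V k x) w))
        = (\<integral>\<^sup>+g. ennreal (exp (?Q d x + dot K (\<lambda>k. V k x) (?v g))) * ennreal (std_normal_density g) \<partial>lborel)" for x
    proof -
      let ?y = "dot K (\<lambda>k. V k x) (e d)" and ?r = "?Q d x + dot K (\<lambda>k. V k x) w"
      have "ennreal (exp (?Q (Suc d) x + dot K (\<lambda>k. V k x) w)) = ennreal (exp ?r) * ennreal (exp (?y\<^sup>2 / 2))"
        by (simp add: add_divide_distrib algebra_simps flip: ennreal_mult exp_add)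
      also have "\<dots> = (\<integral>\<^sup>+g. ennreal (exp ?r) * (ennreal (exp (g * ?y)) * ennreal (std_normal_density g)) \<partial>lborel)"
        unfolding nn_integral_gaussian_exp[symmetric] by (rule nn_integral_cmult[symmetric]) simp
      also have "\<dots> = (\<integral>\<^sup>+g. ennreal (exp (?Q d x + dot K (\<lambda>k. V k x) (?v g))) * ennreal (std_normal_density g) \<partial>lborel)"
        by (intro nn_integral_cong)
          (simp add: dot_add_right dot_scale_right exp_add ennreal_mult mult_ac)
      finally show ?thesis .
    qed
    interpret pair_sigma_finite M lborel ..
    have "(\<integral>\<^sup>+x. ennreal (exp (?Q (Suc d) x + dot K (\<lambda>k. V k x) w)) \<partial>M)
        = (\<integral>\<^sup>+x. \<integral>\<^sup>+g. ennreal (exp (?Q d x + (dot K (\<lambda>k. V k x) w + g * dot K (\<lambda>k. V k x) (e d))))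
             * ennreal (std_normal_density g) \<partial>lborel \<partial>M)"
      unfolding split by (simp add: dot_add_right dot_scale_right)
    also have "\<dots> = (\<integral>\<^sup>+g. \<integral>\<^sup>+x. ennreal (exp (?Q d x + (dot K (\<lambda>k. V k x) w + g * dot K (\<lambda>k. V k x) (e d))))
             * ennreal (std_normal_density g) \<partial>M \<partial>lborel)"
      \<comment> \<open>Everything is nonnegative, so the exchange requires no
        integrability.\<close>
      by (rule Fubini'[symmetric]) measurable
    also have "\<dots> = (\<integral>\<^sup>+g. (\<integral>\<^sup>+x. ennreal (exp (?Q d x + dot K (\<lambda>k. V k x) (?v g))) \<partial>M)
             * ennreal (std_normal_density g) \<partial>lborel)"
      by (intro nn_integral_cong, subst nn_integral_multc) (auto simp: dot_add_right dot_scale_right)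
    also have "\<dots> \<le> (\<integral>\<^sup>+g. ennreal (exp (real d / 2 + dot K w w / 8))
             * (ennreal (exp (g\<^sup>2 / 8)) * ennreal (std_normal_density g)) \<partial>lborel)"
    proof (intro nn_integral_mono)
      fix g :: real
      \<comment> \<open>\<open>w\<close> is orthogonal to the new direction, so there is no cross
        term. The new direction has squared norm 0 or 1, and only the upper bound 1 enters.\<close>
      have "dot K (?v g) (?v g) = dot K w w + g\<^sup>2 * dot K (e d) (e d)"
        using w unfolding dot_add_right dot_scale_right dot_commute[of K "?v g"]
        by (simp add: dot_commute power2_eq_square)
      also have "\<dots> \<le> dot K w w + g\<^sup>2" using nrm by auto
      finally have le: "exp (real d / 2 + dot K (?v g) (?v g) / 8) \<le> exp (real d / 2 + dot K w w / 8) * exp (g\<^sup>2 / 8)"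
        by (simp flip: exp_add add: field_simps)
      have "(\<integral>\<^sup>+x. ennreal (exp (?Q d x + dot K (\<lambda>k. V k x) (?v g))) \<partial>M)
          \<le> ennreal (exp (real d / 2 + dot K (?v g) (?v g) / 8))"
        using Suc.prems(2) orth by (intro Suc.IH[OF e']) (simp add: dot_add_right dot_scale_right)
      also have "\<dots> \<le> ennreal (exp (real d / 2 + dot K w w / 8) * exp (g\<^sup>2 / 8))"
        using le by (rule ennreal_leI)
      also have "\<dots> = ennreal (exp (real d / 2 + dot K w w / 8)) * ennreal (exp (g\<^sup>2 / 8))"
        by (rule ennreal_mult) auto
      finally show "(\<integral>\<^sup>+x. ennreal (exp (?Q d x + dot K (\<lambda>k. V k x) (?v g))) \<partial>M) * ennreal (std_normal_density g)
          \<le> ennreal (exp (real d / 2 + dot K w w / 8)) * (ennreal (exp (g\<^sup>2 / 8)) * ennreal (std_normal_density g))"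
        unfolding mult.assoc[symmetric] by (intro mult_right_mono) auto
    qed
    also have "\<dots> = ennreal (exp (real d / 2 + dot K w w / 8))
        * (\<integral>\<^sup>+g. ennreal (exp (g\<^sup>2 / 8)) * ennreal (std_normal_density g) \<partial>lborel)"
      by (rule nn_integral_cmult) simp
    also have "\<dots> \<le> ennreal (exp (real d / 2 + dot K w w / 8)) * ennreal (exp (1 / 2))"
      by (intro mult_left_mono nn_integral_gaussian_exp_square) simp
    also have "\<dots> = ennreal (exp (real (Suc d) / 2 + dot K w w / 8))"
      by (simp add: add_divide_distrib algebra_simps flip: ennreal_mult exp_add)
    finally show ?case .
  qed
  from this[OF e, of "\<lambda>_. 0"] show ?thesis by (simp add: dot_def)
qed

lemma (in prob_space) quadratic_tail_bound:
  fixes V :: "nat \<Rightarrow> 'a \<Rightarrow> real"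
  assumes V[measurable]: "\<And>k. k < K \<Longrightarrow> V k \<in> borel_measurable M"
    and subgauss: "\<And>w. (\<integral>\<^sup>+x. ennreal (exp (dot K (\<lambda>k. V k x) w)) \<partial>M) \<le> ennreal (exp (dot K w w / 8))"
    and e: "orthonormal_or_zero K d e" and "0 < \<delta>" and q: "real d - 2 * ln \<delta> \<le> q"
  shows "1 - \<delta> \<le> prob {x \<in> space M. (\<Sum>j<d. (dot K (\<lambda>k. V k x) (e j))\<^sup>2) \<le> q}"
proof -
  let ?Q = "\<lambda>x. \<Sum>j<d. (dot K (\<lambda>k. V k x) (e j))\<^sup>2"
  have [measurable]: "(\<lambda>x. dot K (\<lambda>k. V k x) w) \<in> borel_measurable M" for w
    unfolding dot_def by (intro borel_measurable_sum) measurable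
  have "emeasure M {x \<in> space M. 1 \<le> ennreal (exp (- q / 2)) * ennreal (exp (?Q x / 2))}
      \<le> ennreal (exp (- q / 2)) * (\<integral>\<^sup>+x. ennreal (exp (?Q x / 2)) * indicator (space M) x \<partial>M)"
    by (intro nn_integral_Markov_inequality) auto
  also have "(\<integral>\<^sup>+x. ennreal (exp (?Q x / 2)) * indicator (space M) x \<partial>M) = (\<integral>\<^sup>+x. ennreal (exp (?Q x / 2)) \<partial>M)"
    by (intro nn_integral_cong) simp
  also have "ennreal (exp (- q / 2)) * \<dots> \<le> ennreal (exp (- q / 2)) * ennreal (exp (real d / 2))"
    using quadratic_mgf[OF V subgauss e] by (intro mult_left_mono) auto
  also have "\<dots> = ennreal (exp (- q / 2 + real d / 2))" by (simp flip: ennreal_mult exp_add)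
  also have "\<dots> \<le> ennreal \<delta>"
  proof (intro ennreal_leI)
    have "exp (- q / 2 + real d / 2) \<le> exp (ln \<delta>)" using q by simp
    then show "exp (- q / 2 + real d / 2) \<le> \<delta>" using \<open>0 < \<delta>\<close> by simp
  qed
  finally have "emeasure M {x \<in> space M. 1 \<le> ennreal (exp (- q / 2)) * ennreal (exp (?Q x / 2))} \<le> ennreal \<delta>" .
  moreover have "1 \<le> ennreal (exp (- q / 2)) * ennreal (exp (?Q x / 2)) \<longleftrightarrow> q \<le> ?Q x" for x
  proof -
    have "ennreal (exp (- q / 2)) * ennreal (exp (?Q x / 2)) = ennreal (exp (- q / 2 + ?Q x / 2))"
      unfolding exp_add by (rule ennreal_mult[symmetric]) auto
    moreover have "1 \<le> ennreal (exp (- q / 2 + ?Q x / 2)) \<longleftrightarrow> 1 \<le> exp (- q / 2 + ?Q x / 2)"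
      using ennreal_le_iff[of "exp (- q / 2 + ?Q x / 2)" 1] by (simp del: ennreal_le_iff)
    ultimately show ?thesis by simp
  qed
  ultimately have "prob {x \<in> space M. q \<le> ?Q x} \<le> \<delta>"
    using \<open>0 < \<delta>\<close> by (simp add: emeasure_eq_measure)
  \<comment> \<open>Markov's inequality controls the closed event \<open>q \<le> ?Q x\<close>; its
    complement is the strict one, contained in the event of the claim.\<close>
  moreover have "prob {x \<in> space M. ?Q x < q} = 1 - prob {x \<in> space M. \<not> ?Q x < q}"
  proof -
    have "prob (space M - {x \<in> space M. \<not> ?Q x < q}) = 1 - prob {x \<in> space M. \<not> ?Q x < q}"
      by (rule prob_compl) measurable
    moreover have "space M - {x \<in> space M. \<not> ?Q x < q} = {x \<in> space M. ?Q x < q}" by auto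
    ultimately show ?thesis by simp
  qed
  moreover have "prob {x \<in> space M. ?Q x < q} \<le> prob {x \<in> space M. ?Q x \<le> q}"
    by (intro finite_measure_mono) auto
  ultimately show ?thesis by (simp add: not_less)
qed

subsection \<open>Responses under Gumbel errors\<close>

text \<open>Hoeffding's lemma for both signs of the parameter: it is stated for positive ones, and a
  negative \<open>l\<close> is handled by passing to \<open>- f\<close>.\<close>

lemma (in prob_space) subgaussian_bounded_centered:
  fixes f :: "'a \<Rightarrow> real"
  assumes [measurable]: "f \<in> borel_measurable M" and range: "\<And>x. f x \<in> {a..b}"
    and E0: "expectation f = 0"
  shows "(\<integral>\<^sup>+x. ennreal (exp (f x * l)) \<partial>M) \<le> ennreal (exp (l\<^sup>2 * (b - a)\<^sup>2 / 8))"
proof -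
  consider "l = 0" | "l > 0" | "l < 0" by linarith
  then show ?thesis
  proof cases
    case 1
    then show ?thesis by (simp add: emeasure_space_1)
  next
    case 2
    interpret interval_bounded_random_variable M f a b
      by unfold_locales (use range in auto)
    show ?thesis using Hoeffdings_lemma_nn_integral_0[OF 2 E0] by (simp add: mult.commute)
  next
    case 3
    interpret interval_bounded_random_variable M "\<lambda>x. - f x" "- b" "- a"
      by unfold_locales (use range in auto)
    have "- l > 0" "expectation (\<lambda>x. - f x) = 0" using 3 E0 by auto
    from Hoeffdings_lemma_nn_integral_0[OF this] show ?thesis
      by (simp add: mult.commute add.commute)
  qed
qed

text \<open>The event \<open>exp (- X / \<sigma>) \<le> a\<close> is
  \<open>X \<ge> - \<sigma> * ln a\<close>, and the Gumbel distribution function at that point is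
  \<open>exp (- a)\<close>.\<close>

lemma (in prob_space) exponential_of_gumbel:
  assumes X: "X \<in> borel_measurable M" and cdf: "cdf (distr M borel X) = gumbel_cdf 0 \<sigma>" and "0 < \<sigma>"
  shows "distributed M lborel (\<lambda>x. exp (- X x / \<sigma>)) (exponential_density 1)"
proof (subst exponential_distributed_iff, simp, intro conjI allI impI)
  note [measurable] = X
  show "(\<lambda>x. exp (- X x / \<sigma>)) \<in> borel_measurable M" by measurable
  interpret D: real_distribution "distr M borel X" by (rule real_distribution_distr) fact
  fix a :: real assume "0 \<le> a"
  show "prob {x \<in> space M. exp (- X x / \<sigma>) \<le> a} = 1 - exp (- a * 1)"
  proof (cases "a = 0")
    case False
    with \<open>0 \<le> a\<close> have a: "0 < a" by simp
    define y where "y = - \<sigma> * ln a"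
    have iff: "exp (- t / \<sigma>) \<le> a \<longleftrightarrow> y \<le> t" for t
    proof -
      have "exp (- t / \<sigma>) \<le> a \<longleftrightarrow> - t / \<sigma> \<le> ln a" using a by (simp add: ln_ge_iff)
      also have "\<dots> \<longleftrightarrow> y \<le> t" using \<open>0 < \<sigma>\<close> by (auto simp: y_def field_simps)
      finally show ?thesis .
    qed
    \<comment> \<open>The complement of \<open>X \<ge> y\<close> is the strict event, while the
      distribution function measures the closed one; continuity rules out an atom at
      \<open>y\<close>.\<close>
    have "isCont (gumbel_cdf 0 \<sigma>) y"
      unfolding gumbel_cdf_def[abs_def] using \<open>0 < \<sigma>\<close> by (intro continuous_intros) auto
    then have atom: "measure (distr M borel X) {y} = 0" by (simp add: D.isCont_cdf flip: cdf)
    have "measure (distr M borel X) ({..y} - {y}) = measure (distr M borel X) {..y} - measure (distr M borel X) {y}"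
      by (rule D.finite_measure_Diff) auto
    also have "{..y} - {y} = {..<y}" by auto
    also have "measure (distr M borel X) {..y} = gumbel_cdf 0 \<sigma> y"
      using fun_cong[OF cdf, of y] by (simp add: cdf_def)
    also have "\<dots> = exp (- a)"
      using a \<open>0 < \<sigma>\<close> by (simp add: gumbel_cdf_def y_def)
    finally have "prob (X -` {..<y} \<inter> space M) = exp (- a)"
      using atom by (simp add: measure_distr)
    moreover have "prob (space M - (X -` {..<y} \<inter> space M)) = 1 - prob (X -` {..<y} \<inter> space M)"
      by (rule prob_compl) measurable
    moreover have "space M - (X -` {..<y} \<inter> space M) = {x \<in> space M. exp (- X x / \<sigma>) \<le> a}"
      unfolding iff by auto
    ultimately show ?thesis by simp
  qed (simp add: not_le)
qed

text \<open>Tilting by \<open>exp (- a * t)\<close> turns the density of rate 1 into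
  \<open>1 / (1 + a)\<close> times the density of rate \<open>1 + a\<close>.\<close>

lemma (in prob_space) laplace_exponential:
  assumes T: "distributed M lborel T (exponential_density 1)" and "0 < a"
  shows "(\<integral>\<^sup>+x. ennreal (exp (- a * T x)) \<partial>M) = ennreal (1 / (1 + a))"
proof -
  have "(\<integral>\<^sup>+x. ennreal (exp (- a * T x)) \<partial>M)
      = (\<integral>\<^sup>+t. ennreal (exponential_density 1 t) * ennreal (exp (- a * t)) \<partial>lborel)"
    by (rule distributed_nn_integral[OF T, symmetric]) simp
  also have "\<dots> = (\<integral>\<^sup>+t. ennreal (1 / (1 + a)) * ennreal (exponential_density (1 + a) t) \<partial>lborel)"
  proof (intro nn_integral_cong)
    fix t :: real
    have "exponential_density 1 t * exp (- a * t) = 1 / (1 + a) * exponential_density (1 + a) t"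
    proof (cases "t < 0")
      case False
      have "exp (- t) * exp (- a * t) = exp (- t * (1 + a))" by (simp add: algebra_simps flip: exp_add)
      then show ?thesis using False \<open>0 < a\<close> by (simp add: exponential_density_def)
    qed (simp add: exponential_density_def)
    then show "ennreal (exponential_density 1 t) * ennreal (exp (- a * t))
        = ennreal (1 / (1 + a)) * ennreal (exponential_density (1 + a) t)"
      using \<open>0 < a\<close> by (simp add: exponential_density_nonneg flip: ennreal_mult)
  qed
  also have "\<dots> = ennreal (1 / (1 + a)) * (\<integral>\<^sup>+t. ennreal (exponential_density (1 + a) t) \<partial>lborel)"
    by (rule nn_integral_cmult) simp
  also have "(\<integral>\<^sup>+t. ennreal (exponential_density (1 + a) t) \<partial>lborel) = 1"
    using prob_space.emeasure_space_1[OF prob_space_exponential_density[of "1 + a"]] \<open>0 < a\<close>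
    by (simp add: emeasure_density)
  finally show ?thesis by simp
qed

text \<open>Conditioning on the first error, the choice probability is the Laplace transform of the
  exponential variable \<open>exp (- X / \<sigma>)\<close> at \<open>exp (- d / \<sigma>)\<close>.\<close>

lemma (in prob_space) prob_gumbel_difference_le:
  assumes indep: "indep_var borel X borel Y" and "0 < \<sigma>"
    and cX: "cdf (distr M borel X) = gumbel_cdf 0 \<sigma>" and cY: "cdf (distr M borel Y) = gumbel_cdf 0 \<sigma>"
  shows "prob {x \<in> space M. Y x \<le> d + X x} = 1 / (1 + exp (- d / \<sigma>))"
proof -
  have rv[measurable]: "X \<in> borel_measurable M" "Y \<in> borel_measurable M"
    using indep indep_var_rv1 indep_var_rv2 by blast+
  interpret Y: prob_space "distr M borel Y" by (rule prob_space_distr) simp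
  let ?S = "{p. snd p \<le> d + fst p} :: (real \<times> real) set"
  have S: "?S \<in> sets (borel \<Otimes>\<^sub>M borel)"
  proof -
    have "{p \<in> space (borel \<Otimes>\<^sub>M borel). snd p \<le> d + fst p} \<in> sets (borel \<Otimes>\<^sub>M (borel :: real measure))"
      by measurable
    then show ?thesis by (simp add: space_pair_measure)
  qed
  have "emeasure M {x \<in> space M. Y x \<le> d + X x} = emeasure (distr M (borel \<Otimes>\<^sub>M borel) (\<lambda>x. (X x, Y x))) ?S"
    using S by (subst emeasure_distr) (auto intro!: arg_cong[where f = "emeasure M"])
  also have "distr M (borel \<Otimes>\<^sub>M borel) (\<lambda>x. (X x, Y x)) = distr M borel X \<Otimes>\<^sub>M distr M borel Y"
    using indep by (simp add: indep_var_distribution_eq)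
  also have "emeasure \<dots> ?S = (\<integral>\<^sup>+a. emeasure (distr M borel Y) (Pair a -` ?S) \<partial>distr M borel X)"
    using S by (intro Y.emeasure_pair_measure_alt) (simp cong: sets_pair_measure_cong)
  also have "\<dots> = (\<integral>\<^sup>+a. ennreal (exp (- exp (- (d + a) / \<sigma>))) \<partial>distr M borel X)"
  proof (intro nn_integral_cong)
    fix a
    have "Pair a -` ?S = {..d + a}" by auto
    then show "emeasure (distr M borel Y) (Pair a -` ?S) = ennreal (exp (- exp (- (d + a) / \<sigma>)))"
      using fun_cong[OF cY, of "d + a"] by (simp add: Y.emeasure_eq_measure cdf_def gumbel_cdf_def)
  qed
  also have "\<dots> = (\<integral>\<^sup>+x. ennreal (exp (- exp (- d / \<sigma>) * exp (- X x / \<sigma>))) \<partial>M)"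
  proof -
    have "exp (- (d + a) / \<sigma>) = exp (- d / \<sigma>) * exp (- a / \<sigma>)" for a
      by (simp add: diff_divide_distrib flip: exp_add)
    then show ?thesis by (simp add: nn_integral_distr)
  qed
  also have "\<dots> = ennreal (1 / (1 + exp (- d / \<sigma>)))"
    using laplace_exponential[OF exponential_of_gumbel[OF rv(1) cX \<open>0 < \<sigma>\<close>], of "exp (- d / \<sigma>)"] by simp
  finally show ?thesis by (simp add: emeasure_eq_measure add_nonneg_nonneg)
qed

lemma length_responses[simp]: "length (responses u D eps x) = length D"
  by (simp add: responses_def)

lemma set_responses: "set (responses u D eps x) \<subseteq> {1, - 1}"
  by (auto simp: responses_def choice_def)

lemma responses_nth:
  assumes "k < length D"
  shows "responses u D eps x ! k = (if eps 2 k x \<le> utility_gap u D k + eps 1 k x then 1 else - 1)"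
  using assms by (auto simp: responses_def choice_def utility_gap_def)

lemma response_errors_measurable:
  assumes "response_errors M \<sigma> K eps" "k < K" "i \<in> {1, 2}"
  shows "eps i k \<in> borel_measurable M"
  using assms prob_space.indep_vars_def[of M "\<lambda>_. borel" "\<lambda>(i, k). eps i k" "{1, 2} \<times> {..<K}"]
  by (force simp: response_errors_def)

lemma responses_measurable:
  assumes "response_errors M \<sigma> (length D) eps"
  shows "responses u D eps \<in> measurable M (count_space UNIV)"
proof (subst measurable_count_space_eq2_countable, intro conjI ballI)
  fix z :: "int list"
  have [measurable]: "eps 1 k \<in> borel_measurable M" "eps 2 k \<in> borel_measurable M" if "k < length D" for k
    using response_errors_measurable[OF assms that] by auto
  have "responses u D eps -` {z} \<inter> space M
    = {x \<in> space M. length z = length D \<and>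
        (\<forall>k\<in>{..<length D}. z ! k = (if eps 2 k x \<le> utility_gap u D k + eps 1 k x then 1 else - 1))}"
    by (auto simp: list_eq_iff_nth_eq responses_nth)
  also have "\<dots> \<in> sets M" by measurable
  finally show "responses u D eps -` {z} \<inter> space M \<in> sets M" .
qed auto

text \<open>The responses are measurable into a discrete space, where every set is measurable. Hence
  any statement about the estimate defines an event, whatever selection \<open>est\<close>
  makes.\<close>

lemma estimate_event_measurable:
  assumes "response_errors M \<sigma> (length D) eps"
  shows "{x \<in> space M. P (estimate u D eps est x)} \<in> sets M"
proof -
  have "responses u D eps -` {z. P (est z)} \<inter> space M \<in> sets M"
    by (rule measurable_sets[OF responses_measurable[OF assms]]) simp
  moreover have "responses u D eps -` {z. P (est z)} \<inter> space M = {x \<in> space M. P (estimate u D eps est x)}"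
    by (auto simp: estimate_def)
  ultimately show ?thesis by simp
qed

text \<open>Each residual is the indicator of the first lottery being chosen, minus the probability
  of that choice. It is therefore centred and has range of length 1, and Hoeffding's lemma gives
  \<open>exp ((w k)\<^sup>2 / 8)\<close>. Independence across queries multiplies these
  factors.\<close>

lemma
  fixes u :: "real \<Rightarrow> real"
  assumes err: "response_errors M \<sigma> (length D) eps" and "0 < \<sigma>"
  defines "V \<equiv> \<lambda>k x. residual u \<sigma> D (responses u D eps x) k"
  shows residual_measurable: "k < length D \<Longrightarrow> V k \<in> borel_measurable M"
    and residual_subgaussian: "(\<integral>\<^sup>+x. ennreal (exp (dot (length D) (\<lambda>k. V k x) w)) \<partial>M)
      \<le> ennreal (exp (dot (length D) w w / 8))"
proof -
  let ?K = "length D"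
  interpret prob_space M using err by (simp add: response_errors_def)
  have ind: "indep_vars (\<lambda>_. borel) (\<lambda>(i, k). eps i k) ({1, 2} \<times> {..<?K})"
    using err by (simp add: response_errors_def)
  have cdf: "cdf (distr M borel (eps i k)) = gumbel_cdf 0 \<sigma>" if "i \<in> {1, 2}" "k < ?K" for i k
    using err that by (auto simp: response_errors_def)
  have eps_meas[measurable]: "eps 1 k \<in> borel_measurable M" "eps 2 k \<in> borel_measurable M" if "k < ?K" for k
    using response_errors_measurable[OF err that] by auto
  define p where "p k = 1 / (1 + exp (- utility_gap u D k / \<sigma>))" for k
  have V: "V k x = (if eps 2 k x \<le> utility_gap u D k + eps 1 k x then 1 else 0) - p k" if "k < ?K" for k x
  proof -
    let ?m = "utility_gap u D k / \<sigma>"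
    have "0 < 1 + exp t" for t :: real by (simp add: add_pos_pos)
    then have "1 + exp ?m \<noteq> 0" "1 + exp (- ?m) \<noteq> 0" by (metis less_irrefl)+
    then have "1 / (1 + exp ?m) = 1 - p k" by (simp add: p_def field_simps exp_minus)
    then show ?thesis by (simp add: V_def residual_def responses_nth[OF that] p_def)
  qed
  have V_meas: "V k \<in> borel_measurable M" if "k < ?K" for k
  proof -
    note [measurable] = eps_meas[OF that]
    have "(\<lambda>x. (if eps 2 k x \<le> utility_gap u D k + eps 1 k x then 1 else 0) - p k) \<in> borel_measurable M"
      by measurable
    moreover have "V k = (\<lambda>x. (if eps 2 k x \<le> utility_gap u D k + eps 1 k x then 1 else 0) - p k)"
      by (rule ext) (rule V[OF that])
    ultimately show ?thesis by simp
  qed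
  then show "k < ?K \<Longrightarrow> V k \<in> borel_measurable M" .
  \<comment> \<open>The errors are grouped into one block per query. Disjoint blocks are
    independent, and the residual of a query is a function of its block alone.\<close>
  have "indep_vars (\<lambda>j. PiM ({1, 2} \<times> {j}) (\<lambda>_. borel))
      (\<lambda>j x. restrict (\<lambda>i. (case i of (i, k) \<Rightarrow> eps i k) x) ({1, 2} \<times> {j})) {..<?K}"
    by (rule indep_vars_restrict[OF ind]) (auto simp: disjoint_family_on_def)
  then have "indep_vars (\<lambda>_. borel) (\<lambda>j x. (\<lambda>f. ennreal (exp (((if f (2, j) \<le> utility_gap u D j + f (1, j) then 1 else 0) - p j) * w j)))
      (restrict (\<lambda>i. (case i of (i, k) \<Rightarrow> eps i k) x) ({1, 2} \<times> {j}))) {..<?K}"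
  proof (rule indep_vars_compose2)
    fix j :: nat
    have [measurable]: "(\<lambda>f. f (1 :: nat, j)) \<in> borel_measurable (PiM ({1, 2} \<times> {j}) (\<lambda>_. borel :: real measure))"
      "(\<lambda>f. f (2 :: nat, j)) \<in> borel_measurable (PiM ({1, 2} \<times> {j}) (\<lambda>_. borel :: real measure))"
      by (auto intro!: measurable_component_singleton)
    show "(\<lambda>f. ennreal (exp (((if f (2, j) \<le> utility_gap u D j + f (1, j) then 1 else 0) - p j) * w j)))
        \<in> borel_measurable (PiM ({1, 2} \<times> {j}) (\<lambda>_. borel :: real measure))"
      by measurable
  qed
  then have indV: "indep_vars (\<lambda>_. borel) (\<lambda>k x. ennreal (exp (V k x * w k))) {..<?K}"
    by (rule indep_vars_cong[THEN iffD1, rotated -1]) (auto simp: V fun_eq_iff)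
  have mgf: "(\<integral>\<^sup>+x. ennreal (exp (V k x * w k)) \<partial>M) \<le> ennreal (exp ((w k)\<^sup>2 / 8))" if k: "k < ?K" for k
  proof -
    have comp: "(\<lambda>f. f (i, k)) \<in> borel_measurable (PiM {(i, k)} (\<lambda>_. borel :: real measure))" for i :: nat
      by (intro measurable_component_singleton) simp
    have "indep_var borel ((\<lambda>f. f (1, k)) \<circ> (\<lambda>x. restrict (\<lambda>i. (case i of (i, k) \<Rightarrow> eps i k) x) {(1, k)}))
        borel ((\<lambda>f. f (2, k)) \<circ> (\<lambda>x. restrict (\<lambda>i. (case i of (i, k) \<Rightarrow> eps i k) x) {(2, k)}))"
      by (rule indep_var_compose[OF indep_var_restrict[OF ind] comp comp]) (use k in auto)
    then have "indep_var borel (eps 1 k) borel (eps 2 k)" by (simp add: comp_def)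
    then have prob: "prob {x \<in> space M. eps 2 k x \<le> utility_gap u D k + eps 1 k x} = p k"
      unfolding p_def using cdf k \<open>0 < \<sigma>\<close> by (intro prob_gumbel_difference_le) auto
    define A where "A = {x \<in> space M. eps 2 k x \<le> utility_gap u D k + eps 1 k x}"
    have A: "A \<in> sets M"
    proof -
      note [measurable] = eps_meas[OF k]
      show ?thesis unfolding A_def by measurable
    qed
    then have "integrable M (indicat_real A)"
      by (intro integrable_real_indicator) (auto simp: emeasure_eq_measure)
    then have "expectation (\<lambda>x. indicat_real A x - p k) = 0"
      using A prob by (subst Bochner_Integration.integral_diff) (auto simp: prob_space A_def)
    moreover have "expectation (V k) = expectation (\<lambda>x. indicat_real A x - p k)"
      by (intro Bochner_Integration.integral_cong) (auto simp: V[OF k] A_def indicator_def)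
    ultimately have "expectation (V k) = 0" by simp
    moreover have "V k x \<in> {- p k..1 - p k}" for x by (simp add: V[OF k])
    ultimately show ?thesis
      using subgaussian_bounded_centered[OF V_meas[OF k], of "- p k" "1 - p k" "w k"] by simp
  qed
  have "(\<integral>\<^sup>+x. ennreal (exp (dot ?K (\<lambda>k. V k x) w)) \<partial>M) = (\<integral>\<^sup>+x. (\<Prod>k\<in>{..<?K}. ennreal (exp (V k x * w k))) \<partial>M)"
    by (simp add: dot_def exp_sum prod_ennreal)
  also have "\<dots> = (\<Prod>k\<in>{..<?K}. \<integral>\<^sup>+x. ennreal (exp (V k x * w k)) \<partial>M)"
    by (rule indep_vars_nn_integral) (use indV in auto)
  also have "\<dots> \<le> (\<Prod>k\<in>{..<?K}. ennreal (exp ((w k)\<^sup>2 / 8)))"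
    by (intro prod_mono_ennreal) (use mgf in auto)
  also have "\<dots> = ennreal (exp (dot ?K w w / 8))"
    by (simp add: prod_ennreal dot_def sum_divide_distrib exp_sum power2_eq_square)
  finally show "(\<integral>\<^sup>+x. ennreal (exp (dot ?K (\<lambda>k. V k x) w)) \<partial>M) \<le> ennreal (exp (dot ?K w w / 8))" .
qed

subsection \<open>Error bounds and rates\<close>

text \<open>The first bound lets the sub-Gaussian tail reach the quantile of the claim: the square
  root only adds to it. The last one replaces twice the geometric mean of \<open>N - 1\<close> and
  \<open>- ln \<delta>\<close> by their sum and absorbs the constants using
  \<open>1 \<le> N\<close>.\<close>

lemma noise_quantile_bounds:
  fixes \<delta> :: real
  assumes "1 \<le> N" "0 < \<delta>" "\<delta> < 1"
  defines "q \<equiv> real N - 1 + 2 * sqrt (- (real N - 1) * ln \<delta>) - 2 * ln \<delta>"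
  shows "real (N - 1) - 2 * ln \<delta> \<le> q" "0 \<le> q" "q \<le> (2 - 3 * ln \<delta>) * real N"
proof -
  have ln: "ln \<delta> < 0" using assms by simp
  have "0 \<le> - (real N - 1) * ln \<delta>"
    using assms ln by (intro mult_nonpos_nonpos) auto
  then have s: "0 \<le> sqrt (- (real N - 1) * ln \<delta>)" by simp
  moreover have "real (N - 1) = real N - 1" "0 \<le> real N - 1" using assms by (auto simp: of_nat_diff)
  ultimately show "real (N - 1) - 2 * ln \<delta> \<le> q" "0 \<le> q"
    unfolding q_def using ln by linarith+
  have "sqrt ((real N - 1) * (- ln \<delta>)) \<le> ((real N - 1) + - ln \<delta>) / 2"
    using assms ln by (intro arith_geo_mean_sqrt) auto
  moreover have "(real N - 1) * (- ln \<delta>) = - (real N - 1) * ln \<delta>" by (simp add: algebra_simps)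
  ultimately have "q \<le> 2 * real N - 3 * ln \<delta>" by (simp add: q_def)
  moreover have "3 * ln \<delta> * real N \<le> 3 * ln \<delta> * 1" using assms ln by (intro mult_left_mono_neg) auto
  ultimately show "q \<le> (2 - 3 * ln \<delta>) * real N" by (simp add: algebra_simps)
qed

lemma noise_term_bounds:
  assumes "1 \<le> N" "0 < \<delta>" "\<delta> < 1"
  shows "0 \<le> noise_term c \<delta> N K"
    and "noise_term c \<delta> N K \<le> (2 - 3 * ln \<delta>) / (omega c)\<^sup>2 * (real N / real K)"
proof -
  show "0 \<le> noise_term c \<delta> N K"
    unfolding noise_term_def using noise_quantile_bounds(2)[OF assms] by (intro divide_nonneg_nonneg) auto
  have "noise_term c \<delta> N K \<le> ((2 - 3 * ln \<delta>) * real N) / ((omega c)\<^sup>2 * real K)"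
    unfolding noise_term_def using noise_quantile_bounds(3)[OF assms] by (intro divide_right_mono) auto
  then show "noise_term c \<delta> N K \<le> (2 - 3 * ln \<delta>) / (omega c)\<^sup>2 * (real N / real K)" by simp
qed

lemma bound_regular_nonneg:
  assumes "1 \<le> N" "0 < \<delta>" "\<delta> < 1" "0 < l"
  shows "0 \<le> bound_regular c l \<delta> N K"
  unfolding bound_regular_def using noise_term_bounds(1)[OF assms(1-3)] assms by simp

definition regular_constant :: "real \<Rightarrow> real \<Rightarrow> real \<Rightarrow> real" where
  "regular_constant c l \<delta> = 2 / sqrt l * sqrt ((2 - 3 * ln \<delta>) / (omega c)\<^sup>2)"

lemma bound_regular_le:
  assumes "1 \<le> N" "0 < \<delta>" "\<delta> < 1" "0 < l"
  shows "bound_regular c l \<delta> N K \<le> regular_constant c l \<delta> * sqrt (real N / real K)"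
proof -
  have "sqrt (noise_term c \<delta> N K) \<le> sqrt ((2 - 3 * ln \<delta>) / (omega c)\<^sup>2) * sqrt (real N / real K)"
    using noise_term_bounds(2)[OF assms(1-3)] by (simp flip: real_sqrt_mult)
  from mult_left_mono[OF this, of "2 / sqrt l"] show ?thesis
    using assms by (simp add: bound_regular_def regular_constant_def)
qed

text \<open>The factor \<open>l\<close> under the root cancels against \<open>2 / sqrt l\<close>,
  which leaves twice the bound of \<open>err_l2_le_diameter\<close>.\<close>

lemma bound_singular_ge:
  assumes "1 \<le> N" "0 < \<delta>" "\<delta> < 1" "0 < l" "0 < c"
  shows "2 * (c * sqrt (real N - 1)) \<le> bound_singular c l \<delta> N K"
proof -
  have "2 * (c * sqrt (real N - 1)) = 2 / sqrt l * sqrt (l * (c * sqrt (real N - 1))\<^sup>2)"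
    using assms by (simp add: real_sqrt_mult)
  also have "\<dots> \<le> bound_singular c l \<delta> N K"
    unfolding bound_singular_def using assms noise_term_bounds(1)[OF assms(1-3)]
    by (intro mult_left_mono real_sqrt_le_mono) auto
  finally show ?thesis .
qed

text \<open>Subadditivity of the square root separates the noise from the diameter term; these are
  the two summands of the O-statement.\<close>

lemma bound_singular_le:
  assumes "1 \<le> N" "0 < \<delta>" "\<delta> < 1" "0 < l" "0 < c"
  shows "bound_regular c l \<delta> N K \<le> bound_singular c l \<delta> N K"
    and "bound_singular c l \<delta> N K \<le> bound_regular c l \<delta> N K + 2 * (c * sqrt (real N - 1))"
proof -
  let ?B = "l * (c * sqrt (real N - 1))\<^sup>2"
  show "bound_regular c l \<delta> N K \<le> bound_singular c l \<delta> N K"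
    unfolding bound_regular_def bound_singular_def using assms
    by (intro mult_left_mono real_sqrt_le_mono) auto
  have "sqrt (noise_term c \<delta> N K + ?B) \<le> sqrt (noise_term c \<delta> N K) + sqrt ?B"
    using noise_term_bounds(1)[OF assms(1-3)] assms by (intro sqrt_add_le_add_sqrt) auto
  from mult_left_mono[OF this, of "2 / sqrt l"]
  have "bound_singular c l \<delta> N K \<le> bound_regular c l \<delta> N K + 2 / sqrt l * sqrt ?B"
    using assms(4) by (simp add: bound_singular_def bound_regular_def distrib_left)
  also have "2 / sqrt l * sqrt ?B = 2 * (c * sqrt (real N - 1))"
    using assms by (simp add: real_sqrt_mult)
  finally show "bound_singular c l \<delta> N K \<le> bound_regular c l \<delta> N K + 2 * (c * sqrt (real N - 1))" .
qed

lemma bound_regular_bigo: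
  assumes "0 < \<delta>" "\<delta> < 1" "0 < l"
  shows "(\<lambda>(N, K). bound_regular c l \<delta> N K) \<in> O[all_sizes](\<lambda>(N, K). sqrt (real N / real K))"
proof (rule bigoI[where c = "regular_constant c l \<delta>"], unfold all_sizes_def eventually_principal, safe)
  fix N K :: nat assume "2 \<le> N"
  then show "norm (bound_regular c l \<delta> N K) \<le> regular_constant c l \<delta> * norm (sqrt (real N / real K))"
    using bound_regular_le[of N \<delta> l c K] bound_regular_nonneg[of N \<delta> l c K] assms by auto
qed

lemma bound_singular_bigo:
  assumes "0 < \<delta>" "\<delta> < 1" "0 < l" "0 < c"
  shows "(\<lambda>(N, K). bound_singular c l \<delta> N K - bound_regular c l \<delta> N K)
    \<in> O[all_sizes](\<lambda>(N, K). c * sqrt (real N))"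
proof (rule bigoI[where c = 2], unfold all_sizes_def eventually_principal, safe)
  fix N K :: nat assume N: "2 \<le> N"
  have "sqrt (real N - 1) \<le> sqrt (real N)" by simp
  then have "c * sqrt (real N - 1) \<le> c * sqrt (real N)" using assms by (intro mult_left_mono) auto
  moreover have "bound_regular c l \<delta> N K \<le> bound_singular c l \<delta> N K"
    "bound_singular c l \<delta> N K \<le> bound_regular c l \<delta> N K + 2 * (c * sqrt (real N - 1))"
    using bound_singular_le[of N \<delta> l c K] N assms by auto
  moreover have "norm (c * sqrt (real N)) = c * sqrt (real N)" using assms(4) by simp
  ultimately show "norm (bound_singular c l \<delta> N K - bound_regular c l \<delta> N K) \<le> 2 * norm (c * sqrt (real N))"
    using \<open>c * sqrt (real N - 1) \<le> c * sqrt (real N)\<close> unfolding real_norm_def by linarith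
qed

lemma choice_experimentD:
  assumes "choice_experiment b L c \<sigma> M D eps est"
  shows "valid_queries b D" "response_errors M \<sigma> (length D) eps" "prob_space M" "D \<noteq> []"
    and "optimal b L c D (responses u D eps x) (estimate u D eps est x)"
proof -
  show "valid_queries b D" "response_errors M \<sigma> (length D) eps" "prob_space M" "D \<noteq> []"
    using assms by (auto simp: choice_experiment_def response_errors_def valid_queries_def)
  show "optimal b L c D (responses u D eps x) (estimate u D eps est x)"
    using assms set_responses[of u D eps x]
    by (auto simp: choice_experiment_def mle_rule_def estimate_def)
qed

text \<open>Stated for any positive lower bound \<open>l\<close> of the smallest eigenvalue, because
  the asymptotic claims need one constant along a whole sequence of designs;
  \<open>l = lambda_min (Sigma_mat b D)\<close> gives the finite-sample bound.\<close>

lemma mle_error_regular: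
  assumes "0 < b" and u: "u \<in> utility_class b L" and c: "0 < c" "1 / c \<le> \<sigma>"
    and ex: "choice_experiment b L c \<sigma> M D eps est"
    and l: "0 < l" "l \<le> lambda_min (Sigma_mat b D)" and \<delta>: "0 < \<delta>" "\<delta> < 1"
  shows "1 - \<delta> \<le> measure M {x \<in> space M. err_l2 b u \<sigma> D (estimate u D eps est x)
    \<le> bound_regular c l \<delta> (num_bp b D) (length D)}"
proof -
  let ?K = "length D" and ?N = "num_bp b D" and ?lam = "lambda_min (Sigma_mat b D)"
  note D = choice_experimentD[OF ex]
  interpret prob_space M by (rule D(3))
  have N: "2 \<le> ?N" using num_bp_ge_2[OF \<open>0 < b\<close> D(1)] .
  have "0 < 1 / c" using c by simp
  then have "0 < \<sigma>" using c by linarith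
  obtain e where e: "orthonormal_or_zero ?K (?N - 1) e"
    and rep: "\<And>i k. i < ?N - 1 \<Longrightarrow> k < ?K \<Longrightarrow> pdiff b D k (i + 2)
      = (\<Sum>j<?N - 1. dot ?K (\<lambda>k. pdiff b D k (i + 2)) (e j) * e j k)"
    by (rule gram_schmidt_family[of ?K "?N - 1" "\<lambda>i k. pdiff b D k (i + 2)"]) (rule that, assumption, blast)
  define q where "q = real ?N - 1 + 2 * sqrt (- (real ?N - 1) * ln \<delta>) - 2 * ln \<delta>"
  have q: "real (?N - 1) - 2 * ln \<delta> \<le> q" "0 \<le> q"
    unfolding q_def using N \<delta> by (intro noise_quantile_bounds; simp)+
  let ?Q = "\<lambda>x. \<Sum>j<?N - 1. (dot ?K (\<lambda>k. residual u \<sigma> D (responses u D eps x) k) (e j))\<^sup>2"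
  have "1 - \<delta> \<le> prob {x \<in> space M. ?Q x \<le> q}"
    by (rule quadratic_tail_bound[OF residual_measurable[OF D(2) \<open>0 < \<sigma>\<close>]
          residual_subgaussian[OF D(2) \<open>0 < \<sigma>\<close>] e \<delta>(1) q(1)])
  also have "\<dots> \<le> prob {x \<in> space M. err_l2 b u \<sigma> D (estimate u D eps est x) \<le> bound_regular c l \<delta> ?N ?K}"
  proof (intro finite_measure_mono estimate_event_measurable[OF D(2)] subsetI)
    fix x assume x: "x \<in> {x \<in> space M. ?Q x \<le> q}"
    let ?s = "estimate u D eps est x"
    have K: "0 < real ?K" using D(4) by simp
    have "real ?K * ?lam * (err_l2 b u \<sigma> D ?s)\<^sup>2 \<le> 4 / (omega c)\<^sup>2 * ?Q x"
      by (rule err_l2_sq_le_projected_residual[OF \<open>0 < b\<close> D(1) u c _ set_responses D(5) rep]) auto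
    also have "\<dots> \<le> 4 / (omega c)\<^sup>2 * q" using x by (intro mult_left_mono) auto
    finally have "real ?K * ?lam * (err_l2 b u \<sigma> D ?s)\<^sup>2 \<le> 4 / (omega c)\<^sup>2 * q" .
    moreover have "real ?K * l * (err_l2 b u \<sigma> D ?s)\<^sup>2 \<le> real ?K * ?lam * (err_l2 b u \<sigma> D ?s)\<^sup>2"
      using l K by (intro mult_right_mono mult_left_mono) auto
    ultimately have "(err_l2 b u \<sigma> D ?s)\<^sup>2 * (real ?K * l) \<le> 4 / (omega c)\<^sup>2 * q"
      by (simp only: mult.commute)
    then have "(err_l2 b u \<sigma> D ?s)\<^sup>2 \<le> 4 / (omega c)\<^sup>2 * q / (real ?K * l)"
      using K l by (subst pos_le_divide_eq) auto
    also have "\<dots> = (bound_regular c l \<delta> ?N ?K)\<^sup>2"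
      using noise_term_bounds(1)[of ?N \<delta> c ?K] N \<delta> l
      by (simp add: bound_regular_def power_mult_distrib power_divide)
        (simp add: noise_term_def q_def mult_ac)
    finally have "(err_l2 b u \<sigma> D ?s)\<^sup>2 \<le> (bound_regular c l \<delta> ?N ?K)\<^sup>2" .
    moreover have "0 \<le> bound_regular c l \<delta> ?N ?K"
      using N by (intro bound_regular_nonneg \<delta> l(1)) simp
    ultimately have "err_l2 b u \<sigma> D ?s \<le> bound_regular c l \<delta> ?N ?K" by (rule power2_le_imp_le)
    then show "x \<in> {x \<in> space M. err_l2 b u \<sigma> D (estimate u D eps est x) \<le> bound_regular c l \<delta> ?N ?K}"
      using x by simp
  qed
  finally show ?thesis .
qed

lemma mle_error_singular:
  assumes "0 < b" and u: "u \<in> utility_class b L" and c: "0 < c" "1 / c \<le> \<sigma>"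
    and ex: "choice_experiment b L c \<sigma> M D eps est" and "0 < l" "0 < \<delta>" "\<delta> < 1"
  shows "err_l2 b u \<sigma> D (estimate u D eps est x) \<le> bound_singular c l \<delta> (num_bp b D) (length D)"
proof -
  note D = choice_experimentD[OF ex]
  have N: "2 \<le> num_bp b D" using num_bp_ge_2[OF \<open>0 < b\<close> D(1)] .
  have "feasible b L c D (estimate u D eps est x)"
    using D(5)[of u x] by (simp add: optimal_def)
  from err_l2_le_diameter[OF \<open>0 < b\<close> D(1) u c this]
  have "err_l2 b u \<sigma> D (estimate u D eps est x) \<le> c * sqrt (real (num_bp b D) - 1)" .
  also have "\<dots> \<le> 2 * (c * sqrt (real (num_bp b D) - 1))" using c N by simp
  also have "\<dots> \<le> bound_singular c l \<delta> (num_bp b D) (length D)"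
    using assms N by (intro bound_singular_ge) auto
  finally show ?thesis .
qed

lemma abs_err_le_l2:
  assumes "0 < b" "valid_queries b D" "err \<in> {err_l2, err_linf}"
  shows "\<bar>err b u \<sigma> D s\<bar> \<le> err_l2 b u \<sigma> D s"
  using assms(3) err_linf_le_l2[OF assms(1,2), of u \<sigma> s] by auto

text \<open>To push the exceedance probability below \<open>r\<close>, fix a confidence parameter
  \<open>\<delta> < r\<close>. At that fixed level the error bound is a constant times
  \<open>sqrt (N / K)\<close>, hence eventually below \<open>e\<close>.\<close>

lemma mle_error_tendsto_zero:
  fixes M :: "nat \<Rightarrow> 'w measure"
  assumes "0 < b" and u: "u \<in> utility_class b L" and c: "0 < c" "1 / c \<le> \<sigma>"
    and ex: "\<And>n. choice_experiment b L c \<sigma> (M n) (D n) (eps n) (est n)"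
    and l: "0 < l" "\<And>n. l \<le> lambda_min (Sigma_mat b (D n))"
    and ratio: "(\<lambda>n. real (num_bp b (D n)) / real (length (D n))) \<longlonglongrightarrow> 0"
    and err: "err \<in> {err_l2, err_linf}"
  shows "tendsto_zero_in_prob M (\<lambda>n x. err b u \<sigma> (D n) (estimate u (D n) (eps n) (est n) x))"
  unfolding tendsto_zero_in_prob_def
proof (intro allI impI)
  fix e :: real assume "0 < e"
  let ?X = "\<lambda>n x. err b u \<sigma> (D n) (estimate u (D n) (eps n) (est n) x)"
  show "(\<lambda>n. measure (M n) {x \<in> space (M n). e < \<bar>?X n x\<bar>}) \<longlonglongrightarrow> 0"
  proof (rule LIMSEQ_I)
    fix r :: real assume "0 < r"
    define \<delta> where "\<delta> = min (r / 2) (1 / 2)"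
    have \<delta>: "0 < \<delta>" "\<delta> < 1" "\<delta> < r" using \<open>0 < r\<close> by (auto simp: \<delta>_def min_def)
    have "(\<lambda>n. regular_constant c l \<delta> * sqrt (real (num_bp b (D n)) / real (length (D n)))) \<longlonglongrightarrow> regular_constant c l \<delta> * sqrt 0"
      by (intro tendsto_intros ratio)
    then have "eventually (\<lambda>n. regular_constant c l \<delta> * sqrt (real (num_bp b (D n)) / real (length (D n))) < e) sequentially"
      using \<open>0 < e\<close> by (intro order_tendstoD) auto
    then obtain n0 where n0: "\<And>n. n \<ge> n0 \<Longrightarrow>
        regular_constant c l \<delta> * sqrt (real (num_bp b (D n)) / real (length (D n))) < e"
      by (auto simp: eventually_sequentially)
    have "measure (M n) {x \<in> space (M n). e < \<bar>?X n x\<bar>} < r" if "n \<ge> n0" for n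
    proof -
      note D = choice_experimentD[OF ex[of n]]
      interpret prob_space "M n" by (rule D(3))
      let ?B = "bound_regular c l \<delta> (num_bp b (D n)) (length (D n))"
      let ?A = "{x \<in> space (M n). err_l2 b u \<sigma> (D n) (estimate u (D n) (eps n) (est n) x) \<le> ?B}"
      have "?B < e"
        using bound_regular_le[of "num_bp b (D n)" \<delta> l c "length (D n)"] num_bp_ge_2[OF \<open>0 < b\<close> D(1)]
          \<delta> l n0[OF that] by auto
      have "{x \<in> space (M n). e < \<bar>?X n x\<bar>} \<subseteq> space (M n) - ?A"
      proof safe
        fix x assume "e < \<bar>?X n x\<bar>" "err_l2 b u \<sigma> (D n) (estimate u (D n) (eps n) (est n) x) \<le> ?B"
        with \<open>?B < e\<close> abs_err_le_l2[OF \<open>0 < b\<close> D(1) err, of u \<sigma> "estimate u (D n) (eps n) (est n) x"]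
        show False by linarith
      qed
      then have "prob {x \<in> space (M n). e < \<bar>?X n x\<bar>} \<le> prob (space (M n) - ?A)"
        using estimate_event_measurable[OF D(2)] by (intro finite_measure_mono) auto
      also have "\<dots> = 1 - prob ?A"
        by (rule prob_compl[OF estimate_event_measurable[OF D(2)]])
      also have "\<dots> \<le> \<delta>"
        using mle_error_regular[OF \<open>0 < b\<close> u c ex l \<delta>(1,2), of n] by linarith
      finally show ?thesis using \<delta>(3) by simp
    qed
    then show "\<exists>n0. \<forall>n\<ge>n0. norm (measure (M n) {x \<in> space (M n). e < \<bar>?X n x\<bar>} - 0) < r"
      by (intro exI[of _ n0]) auto
  qed
qed

lemma mle_error_rate:
  fixes M :: "nat \<Rightarrow> 'w measure"
  assumes "0 < b" and u: "u \<in> utility_class b L" and c: "0 < c" "1 / c \<le> \<sigma>"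
    and ex: "\<And>n. choice_experiment b L c \<sigma> (M n) (D n) (eps n) (est n)"
    and l: "0 < l" "\<And>n. l \<le> lambda_min (Sigma_mat b (D n))"
    and N: "\<And>n. num_bp b (D n) = N"
    and err: "err \<in> {err_l2, err_linf}"
  shows "rate_in_prob M (\<lambda>n x. err b u \<sigma> (D n) (estimate u (D n) (eps n) (est n) x))
    (\<lambda>n. 1 / sqrt (real (length (D n))))"
  unfolding rate_in_prob_def
proof (intro allI impI exI)
  fix \<delta> :: real and n assume \<delta>: "0 < \<delta> \<and> \<delta> < 1"
  let ?C = "regular_constant c l \<delta> * sqrt (real N)"
  note D = choice_experimentD[OF ex[of n]]
  interpret prob_space "M n" by (rule D(3))
  have "1 \<le> N" using num_bp_ge_2[OF \<open>0 < b\<close> D(1)] N[of n] by simp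
  then have "bound_regular c l \<delta> N (length (D n)) \<le> regular_constant c l \<delta> * sqrt (real N / real (length (D n)))"
    using \<delta> l by (intro bound_regular_le) auto
  also have "\<dots> = ?C * (1 / sqrt (real (length (D n))))" by (simp add: real_sqrt_divide)
  finally have B: "bound_regular c l \<delta> N (length (D n)) \<le> ?C * (1 / sqrt (real (length (D n))))" .
  have "1 - \<delta> \<le> prob {x \<in> space (M n). err_l2 b u \<sigma> (D n) (estimate u (D n) (eps n) (est n) x)
      \<le> bound_regular c l \<delta> N (length (D n))}"
    using mle_error_regular[OF \<open>0 < b\<close> u c ex l, of \<delta> n] \<delta> N by simp
  also have "\<dots> \<le> prob {x \<in> space (M n). \<bar>err b u \<sigma> (D n) (estimate u (D n) (eps n) (est n) x)\<bar>
      \<le> ?C * (1 / sqrt (real (length (D n))))}"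
  proof (intro finite_measure_mono estimate_event_measurable[OF D(2)] subsetI CollectI conjI)
    fix x assume x: "x \<in> {x \<in> space (M n). err_l2 b u \<sigma> (D n) (estimate u (D n) (eps n) (est n) x)
      \<le> bound_regular c l \<delta> N (length (D n))}"
    then show "x \<in> space (M n)" by simp
    show "\<bar>err b u \<sigma> (D n) (estimate u (D n) (eps n) (est n) x)\<bar> \<le> ?C * (1 / sqrt (real (length (D n))))"
      using abs_err_le_l2[OF \<open>0 < b\<close> D(1) err, of u \<sigma> "estimate u (D n) (eps n) (est n) x"] B x by simp
  qed
  finally show "1 - \<delta> \<le> prob {x \<in> space (M n). \<bar>err b u \<sigma> (D n) (estimate u (D n) (eps n) (est n) x)\<bar>
      \<le> ?C * (1 / sqrt (real (length (D n))))}" .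
qed

subsection \<open>Non-identifiability of the scale\<close>

text \<open>The quadratic form is a sum of squares, so its value at an eigenvector shows the sign of
  the eigenvalue. This is the half of \<open>midpoint_lambda_min\<close> that a kernel vector cannot
  supply.\<close>

lemma lambda_min_Sigma_mat_nonneg:
  assumes "2 \<le> num_bp b D"
  shows "0 \<le> lambda_min (Sigma_mat b D)"
proof -
  let ?A = "Sigma_mat b D" and ?n = "num_bp b D - 1"
  have "eigenvalue ?A (lambda_min ?A)"
    using assms by (intro lambda_min_symmetric(1)[OF Sigma_mat_carrier Sigma_mat_symmetric]) simp
  then obtain v where v: "v \<in> carrier_vec ?n" "v \<noteq> 0\<^sub>v ?n" "?A *\<^sub>v v = lambda_min ?A \<cdot>\<^sub>v v"
    using Sigma_mat_carrier[of b D] unfolding eigenvalue_def eigenvector_def by auto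
  have "0 \<le> scalar_prod v (?A *\<^sub>v v)"
    unfolding Sigma_mat_quadratic_form[OF v(1)] by (intro divide_nonneg_nonneg sum_nonneg) auto
  then have "0 \<le> lambda_min ?A * scalar_prod v v"
    unfolding v(3) scalar_prod_smult_distrib[OF v(1) v(1)] .
  moreover have "0 < scalar_prod v v"
  proof -
    have "0 \<le> scalar_prod v v" by (simp add: scalar_prod_def sum_nonneg)
    moreover have "scalar_prod v v \<noteq> 0"
    proof
      assume "scalar_prod v v = 0"
      then have "v = 0\<^sub>v ?n"
        using v(1) by (intro eq_vecI) (auto simp: scalar_prod_def sum_nonneg_eq_0_iff)
      with v(2) show False by simp
    qed
    ultimately show ?thesis by simp
  qed
  ultimately show ?thesis by (simp add: zero_le_mult_iff)
qed

section \<open>The repeated midpoint query\<close>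

definition midpoint_query :: "real \<Rightarrow> real pmf \<times> real pmf" where
  "midpoint_query b = (return_pmf (b / 2), pmf_of_set {0, b})"

definition midpoint_queries :: "real \<Rightarrow> nat \<Rightarrow> queries" where
  "midpoint_queries b n = replicate (Suc n) (midpoint_query b)"

lemma length_midpoint_queries[simp]: "length (midpoint_queries b n) = Suc n"
  by (simp add: midpoint_queries_def)

lemma nth_midpoint_queries: "k < Suc n \<Longrightarrow> midpoint_queries b n ! k = midpoint_query b"
  unfolding midpoint_queries_def by (rule nth_replicate)

lemma midpoint_queries_nonempty[simp]: "midpoint_queries b n \<noteq> []"
  by (simp add: midpoint_queries_def)

lemma set_midpoint_queries: "set (midpoint_queries b n) = {midpoint_query b}"
  unfolding midpoint_queries_def by (rule set_replicate_Suc)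

lemma one_plus_exp_neq_zero: "1 + exp t \<noteq> (0 :: real)"
proof -
  have "0 < 1 + exp t" by (simp add: add_pos_pos)
  then show ?thesis by simp
qed

context
  fixes b :: real and n :: nat
  assumes b: "0 < b"
begin

lemma midpoint_support: "support_set b (midpoint_queries b n) = {0, b / 2, b}"
  using b by (auto simp: support_set_def set_midpoint_queries midpoint_query_def)

lemma midpoint_valid: "valid_queries b (midpoint_queries b n)"
  using b by (auto simp: valid_queries_def lottery_def set_midpoint_queries midpoint_query_def)

lemma midpoint_num_bp: "num_bp b (midpoint_queries b n) = 3"
  using b by (simp add: num_bp_def midpoint_support)

lemma midpoint_bp:
  "bp b (midpoint_queries b n) (Suc 0) = 0" "bp b (midpoint_queries b n) 2 = b / 2"
  "bp b (midpoint_queries b n) 3 = b"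
proof -
  have "sorted_list_of_set (set [0, b / 2, b]) = [0, b / 2, b]"
    using b by (intro sorted_list_of_set.idem_if_sorted_distinct) auto
  then have "sorted_list_of_set {0, b / 2, b} = [0, b / 2, b]" by simp
  then show "bp b (midpoint_queries b n) (Suc 0) = 0" "bp b (midpoint_queries b n) 2 = b / 2"
    "bp b (midpoint_queries b n) 3 = b"
    unfolding bp_def midpoint_support by simp_all
qed

lemma midpoint_pdiff:
  assumes "k < Suc n"
  shows "pdiff b (midpoint_queries b n) k (Suc 0) = - 1 / 2"
    and "pdiff b (midpoint_queries b n) k 2 = 1" and "pdiff b (midpoint_queries b n) k 3 = - 1 / 2"
  using b assms by (simp_all add: pdiff_def midpoint_bp nth_midpoint_queries midpoint_query_def)

lemma midpoint_lambda_min: "lambda_min (Sigma_mat b (midpoint_queries b n)) = 0"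
proof (rule antisym)
  \<comment> \<open>Up to scale, \<open>?d\<close> lists the linear utility at \<open>b / 2\<close>
    and \<open>b\<close>. It is orthogonal to every row \<open>(1, - 1 / 2)\<close> of the design
    matrix.\<close>
  let ?D = "midpoint_queries b n" and ?d = "\<lambda>i::nat. if i = 0 then 1 else 2 :: real"
  have two: "(\<Sum>i<2. f i) = f 0 + f (Suc 0)" for f :: "nat \<Rightarrow> real"
    by (simp add: numeral_2_eq_2)
  have "real (length ?D) * lambda_min (Sigma_mat b ?D) * (\<Sum>i<num_bp b ?D - 1. (?d i)\<^sup>2)
    \<le> (\<Sum>k<length ?D. (\<Sum>i<num_bp b ?D - 1. pdiff b ?D k (i + 2) * ?d i)\<^sup>2)"
    by (intro lambda_min_Sigma_mat) (simp_all add: midpoint_num_bp)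
  also have "\<dots> = (\<Sum>k<length ?D. 0)"
    by (intro sum.cong)
      (auto simp: midpoint_num_bp two midpoint_pdiff numeral_2_eq_2[symmetric] numeral_3_eq_3[symmetric])
  finally have "real (length ?D) * lambda_min (Sigma_mat b ?D) * (\<Sum>i<2. (?d i)\<^sup>2) \<le> 0"
    by (simp add: midpoint_num_bp)
  moreover have "(\<Sum>i<2. (?d i)\<^sup>2) = 5" by (simp add: numeral_2_eq_2)
  ultimately show "lambda_min (Sigma_mat b ?D) \<le> 0"
    by (simp add: mult_le_0_iff)
  show "0 \<le> lambda_min (Sigma_mat b ?D)"
    by (intro lambda_min_Sigma_mat_nonneg) (simp add: midpoint_num_bp)
qed

lemma midpoint_feasible_iff:
  "feasible b L c (midpoint_queries b n) (\<alpha>, \<beta>, \<gamma>) \<longleftrightarrow>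
    0 \<le> \<gamma> \<and> \<gamma> \<le> c \<and> \<beta> 1 = \<alpha> 2 / (b / 2) \<and> \<beta> 2 = (\<gamma> - \<alpha> 2) / (b / 2) \<and>
    \<beta> 2 \<le> \<beta> 1 \<and> \<beta> 1 \<le> L * \<gamma> \<and> 0 \<le> \<beta> 2 \<and> \<alpha> 1 = 0 \<and> \<alpha> 3 = \<gamma>"
proof -
  have "{1..3 - 1} = {1, 2 :: nat}" "{1..3 - 2} = {1 :: nat}" by auto
  then show ?thesis
    unfolding feasible_def Let_def midpoint_num_bp prod.case
    by (auto simp: midpoint_bp numeral_2_eq_2[symmetric] numeral_3_eq_3[symmetric])
qed

lemma midpoint_log_likelihood:
  "log_likelihood b (midpoint_queries b n) z \<alpha>
    = - (\<Sum>k<Suc n. ln (1 + exp (- of_int (z ! k) * (\<alpha> 2 - (\<alpha> 1 + \<alpha> 3) / 2))))"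
proof -
  have "{1..3} = {1, 2, 3 :: nat}" by auto
  then have "(\<Sum>j = 1..num_bp b (midpoint_queries b n). - of_int (z ! k) * pdiff b (midpoint_queries b n) k j * \<alpha> j)
      = - of_int (z ! k) * (\<alpha> 2 - (\<alpha> 1 + \<alpha> 3) / 2)" if "k < Suc n" for k
    using that unfolding midpoint_num_bp by (simp add: midpoint_pdiff field_simps)
  then show ?thesis
    unfolding log_likelihood_def by simp
qed

text \<open>The likelihood depends on a candidate only through \<open>\<alpha> 2 - \<gamma> / 2\<close>, which ranges over a compact
  interval.\<close>

lemma midpoint_optimal_exists:
  assumes "0 < c" "1 \<le> L * b"
  shows "\<exists>s. optimal b L c (midpoint_queries b n) z s"
proof -
  define F where "F h = - (\<Sum>k<Suc n. ln (1 + exp (- of_int (z ! k) * h)))" for h :: real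
  \<comment> \<open>For \<open>\<gamma> = c\<close> and \<open>h = \<alpha> 2 - c / 2\<close>,
    concavity gives \<open>0 \<le> h\<close>, monotonicity gives \<open>h \<le> c / 2\<close>, and
    the Lipschitz constraint gives \<open>h \<le> c / 2 * (L * b - 1)\<close>.\<close>
  define H where "H = c / 2 * min 1 (L * b - 1)"
  have "0 \<le> H" using assms by (simp add: H_def)
  have "continuous_on {0..H} F"
    unfolding F_def by (intro continuous_intros) (auto simp: one_plus_exp_neq_zero)
  then obtain h where h: "h \<in> {0..H}" and max: "\<And>h'. h' \<in> {0..H} \<Longrightarrow> F h' \<le> F h"
    using continuous_attains_sup[of "{0..H}" F] \<open>0 \<le> H\<close> by auto
  define \<alpha> where "\<alpha> j = (if j = 2 then c / 2 + h else if j = 3 then c else 0)" for j :: nat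
  define \<beta> where "\<beta> j = (if j = 1 then \<alpha> 2 / (b / 2) else (c - \<alpha> 2) / (b / 2))" for j :: nat
  have h': "h \<le> c / 2" "h \<le> c / 2 * (L * b - 1)"
  proof -
    have "H \<le> c / 2 * 1" "H \<le> c / 2 * (L * b - 1)"
      unfolding H_def using assms by (auto intro!: mult_left_mono)
    then show "h \<le> c / 2" "h \<le> c / 2 * (L * b - 1)" using h by auto
  qed
  have "feasible b L c (midpoint_queries b n) (\<alpha>, \<beta>, c)"
  proof -
    have "(c - \<alpha> 2) / (b / 2) \<le> \<alpha> 2 / (b / 2)" "0 \<le> (c - \<alpha> 2) / (b / 2)"
      using h h' b by (auto simp: \<alpha>_def intro!: divide_right_mono)
    moreover have "\<alpha> 2 / (b / 2) \<le> L * c"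
      using h' b by (simp add: \<alpha>_def pos_divide_le_eq algebra_simps)
    ultimately show ?thesis
      unfolding midpoint_feasible_iff using assms by (simp add: \<alpha>_def \<beta>_def)
  qed
  moreover have "log_likelihood b (midpoint_queries b n) z \<alpha> = F h"
    unfolding midpoint_log_likelihood F_def by (simp add: \<alpha>_def)
  moreover have "log_likelihood b (midpoint_queries b n) z \<alpha>' \<le> F h"
    if "feasible b L c (midpoint_queries b n) (\<alpha>', \<beta>', \<gamma>)" for \<alpha>' \<beta>' \<gamma>
  proof -
    note f = that[unfolded midpoint_feasible_iff]
    let ?h = "\<alpha>' 2 - \<gamma> / 2"
    have "\<gamma> - \<alpha>' 2 \<le> \<alpha>' 2" "0 \<le> \<gamma> - \<alpha>' 2"
      using f b by (auto simp: divide_le_cancel zero_le_divide_iff)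
    moreover have "\<alpha>' 2 \<le> L * \<gamma> * (b / 2)"
      using f b by (auto simp: pos_divide_le_eq)
    ultimately have h0: "0 \<le> ?h" "?h \<le> \<gamma> / 2 * 1" "?h \<le> \<gamma> / 2 * (L * b - 1)"
      by (auto simp: algebra_simps)
    \<comment> \<open>A smaller \<open>\<gamma>\<close> only shrinks the interval of attainable
      values, so fixing \<open>\<gamma> = c\<close> loses no likelihood.\<close>
    have "?h \<le> \<gamma> / 2 * min 1 (L * b - 1)" using h0 by (auto simp: min_def)
    also have "\<dots> \<le> H" unfolding H_def using f assms by (intro mult_right_mono) auto
    finally have "F ?h \<le> F h" using h0 by (intro max) auto
    then show ?thesis
      using f unfolding midpoint_log_likelihood F_def by simp
  qed
  ultimately have "optimal b L c (midpoint_queries b n) z (\<alpha>, \<beta>, c)"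
    unfolding optimal_def by (auto)
  then show ?thesis ..
qed

end

lemma midpoint_mle_rule_exists:
  assumes "0 < b" "0 < c" "1 \<le> L * b"
  shows "\<exists>est. \<forall>n. mle_rule b L c (midpoint_queries b n) (est n)"
proof (intro exI allI)
  fix n
  show "mle_rule b L c (midpoint_queries b n) ((\<lambda>n z. SOME s. optimal b L c (midpoint_queries b n) z s) n)"
    unfolding mle_rule_def using midpoint_optimal_exists[OF assms] by (auto intro: someI_ex)
qed

lemma linear_in_utility_class:
  assumes "0 < b" "1 \<le> L * b"
  shows "(\<lambda>x. x / b) \<in> utility_class b L"
proof -
  have "mono_on {0..b} (\<lambda>x. x / b)" using assms by (auto intro!: mono_onI divide_right_mono)
  moreover have "concave_on {0..b} (\<lambda>x. x / b)"
    unfolding concave_on_iff by (auto simp: add_divide_distrib)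
  moreover have "lipschitz_on L {0..b} (\<lambda>x. x / b)"
  proof (rule lipschitz_onI)
    have L: "1 / b \<le> L" using assms by (simp add: pos_divide_le_eq)
    then show "0 \<le> L" using assms(1) by (meson less_imp_le order_trans zero_le_divide_1_iff)
    fix x y
    have "dist (x / b) (y / b) = 1 / b * dist x y"
      using assms(1) by (simp add: dist_real_def flip: diff_divide_distrib)
    also have "\<dots> \<le> L * dist x y" using L by (intro mult_right_mono) auto
    finally show "dist (x / b) (y / b) \<le> L * dist x y" .
  qed
  ultimately show ?thesis using assms by (simp add: utility_class_def)
qed

section \<open>A probability space carrying Gumbel errors of every scale\<close>

definition gumbel_measure :: "real measure" where
  "gumbel_measure = interval_measure (gumbel_cdf 0 1)"

lemma
  shows real_distribution_gumbel: "real_distribution gumbel_measure"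
    and cdf_gumbel: "cdf gumbel_measure = gumbel_cdf 0 1"
proof -
  have mono: "gumbel_cdf 0 1 x \<le> gumbel_cdf 0 1 y" if "x \<le> y" for x y
    using that by (simp add: gumbel_cdf_def)
  have cont: "continuous (at_right a) (gumbel_cdf 0 1)" for a
    unfolding gumbel_cdf_def[abs_def] by (intro continuous_intros) auto
  have bot: "(gumbel_cdf 0 1 \<longlongrightarrow> 0) at_bot"
    unfolding gumbel_cdf_def[abs_def] by real_asymp
  have top: "(gumbel_cdf 0 1 \<longlongrightarrow> 1) at_top"
    unfolding gumbel_cdf_def[abs_def] by real_asymp
  show "real_distribution gumbel_measure"
    unfolding gumbel_measure_def by (rule real_distribution_interval_measure[OF mono cont bot top])
  show "cdf gumbel_measure = gumbel_cdf 0 1"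
    unfolding gumbel_measure_def by (rule cdf_interval_measure[OF mono cont bot])
qed

text \<open>A coordinate for every pair of indices lets one space serve all numbers of queries;
  rescaling the coordinates serves all \<open>\<sigma>\<close> and couples different scales.\<close>

definition gumbel_space :: "(nat \<times> nat \<Rightarrow> real) measure" where
  "gumbel_space = PiM UNIV (\<lambda>_. gumbel_measure)"

lemma gumbel_space_response_errors:
  assumes "0 < \<sigma>"
  shows "response_errors gumbel_space \<sigma> K (\<lambda>i k w. \<sigma> * w (i, k))"
proof -
  interpret G: real_distribution gumbel_measure by (rule real_distribution_gumbel)
  interpret P: product_prob_space "\<lambda>_. gumbel_measure" "UNIV :: (nat \<times> nat) set" ..
  have sp: "prob_space gumbel_space"
    unfolding gumbel_space_def by (intro prob_space_PiM G.prob_space_axioms)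
  interpret prob_space gumbel_space by (rule sp)
  have comp: "distr gumbel_space borel (\<lambda>w. w j) = gumbel_measure" for j
  proof -
    have "distr gumbel_space borel (\<lambda>w. w j) = distr gumbel_space gumbel_measure (\<lambda>w. w j)"
      by (intro distr_cong) auto
    then show ?thesis unfolding gumbel_space_def using P.PiM_component[of j] by simp
  qed
  have rv: "(\<lambda>w. w j) \<in> borel_measurable gumbel_space" for j
  proof -
    have "(\<lambda>w. w j) \<in> measurable gumbel_space gumbel_measure"
      unfolding gumbel_space_def by (rule measurable_component_singleton) simp
    then show ?thesis by (subst (asm) measurable_cong_sets[OF refl G.events_eq_borel])
  qed
  have sets_eq: "sets gumbel_space = sets (PiM UNIV (\<lambda>_. borel))"
    unfolding gumbel_space_def by (intro sets_PiM_cong) auto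
  have "(\<lambda>w. restrict w UNIV) = (\<lambda>w :: nat \<times> nat \<Rightarrow> real. w)" by (simp add: fun_eq_iff)
  then have distr_restrict_UNIV: "distr gumbel_space (PiM UNIV (\<lambda>_. borel)) (\<lambda>w. restrict w UNIV) = gumbel_space"
    by (simp add: distr_id2[OF sets_eq[symmetric]])
  have "indep_vars (\<lambda>_. borel) (\<lambda>j w. w j) (UNIV :: (nat \<times> nat) set)"
    using rv distr_restrict_UNIV by (subst indep_vars_iff_distr_eq_PiM)
      (auto simp: comp gumbel_space_def[symmetric])
  then have "indep_vars (\<lambda>_. borel) (\<lambda>j w. \<sigma> * w j) (UNIV :: (nat \<times> nat) set)"
    by (rule indep_vars_compose2) simp
  then have "indep_vars (\<lambda>_. borel) (\<lambda>j w. \<sigma> * w j) ({1, 2} \<times> {..<K})"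
    by (rule indep_vars_subset) simp
  then have "indep_vars (\<lambda>_. borel) (\<lambda>(i, k) w. \<sigma> * w (i, k)) ({1, 2} \<times> {..<K})"
    by (rule indep_vars_cong[THEN iffD1, rotated -1]) auto
  moreover have "cdf (distr gumbel_space borel (\<lambda>w. \<sigma> * w j)) = gumbel_cdf 0 \<sigma>" for j
  proof
    fix x
    have "distr gumbel_space borel (\<lambda>w. \<sigma> * w j) = distr (distr gumbel_space borel (\<lambda>w. w j)) borel (\<lambda>t. \<sigma> * t)"
      using rv by (subst distr_distr) (auto simp: comp_def)
    then have "cdf (distr gumbel_space borel (\<lambda>w. \<sigma> * w j)) x = measure gumbel_measure ((\<lambda>t. \<sigma> * t) -` {..x})"
      unfolding comp by (simp add: cdf_def measure_distr)
    also have "(\<lambda>t. \<sigma> * t) -` {..x} = {..x / \<sigma>}" using assms by (auto simp: field_simps)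
    also have "measure gumbel_measure {..x / \<sigma>} = gumbel_cdf 0 1 (x / \<sigma>)"
      using fun_cong[OF cdf_gumbel, of "x / \<sigma>"] by (simp add: cdf_def)
    also have "\<dots> = gumbel_cdf 0 \<sigma> x" by (simp add: gumbel_cdf_def)
    finally show "cdf (distr gumbel_space borel (\<lambda>w. \<sigma> * w j)) x = gumbel_cdf 0 \<sigma> x" .
  qed
  ultimately show ?thesis using sp by (simp add: response_errors_def)
qed

text \<open>For the linear utility the midpoint query is a fair coin flip, so the scale parameter leaves no
  trace in the responses.\<close>

lemma midpoint_utility_gap:
  assumes "0 < b" "k < Suc n"
  shows "utility_gap (\<lambda>x. x / b) (midpoint_queries b n) k = 0"
proof -
  have "measure_pmf.expectation (pmf_of_set {0, b}) (\<lambda>x. x / b) = 1 / 2"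
    using assms(1) by (subst integral_pmf_of_set) auto
  then show ?thesis using assms by (simp add: utility_gap_def nth_midpoint_queries midpoint_query_def)
qed

text \<open>With zero utility gap a choice depends only on the order of the two errors, which a
  positive factor preserves. The equality holds outcome by outcome, not merely in
  distribution.\<close>

lemma midpoint_responses_scale:
  assumes "0 < b" "0 < \<sigma>" "0 < \<sigma>'"
  shows "responses (\<lambda>x. x / b) (midpoint_queries b n) (\<lambda>i k w. \<sigma> * w (i, k)) w
    = responses (\<lambda>x. x / b) (midpoint_queries b n) (\<lambda>i k w. \<sigma>' * w (i, k)) w"
  using assms by (intro nth_equalityI) (simp_all add: responses_nth midpoint_utility_gap)

lemma est_err_le_linf:
  assumes "0 < b" "valid_queries b D" "j \<in> {1..num_bp b D}"
  shows "\<bar>est_err b u \<sigma> D s j\<bar> \<le> err_linf b u \<sigma> D s"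
  unfolding err_linf_def using assms by (intro Max_ge) auto

lemma tendsto_zero_linf_if_l2:
  fixes M :: "nat \<Rightarrow> 'w measure"
  assumes "0 < b" and ex: "\<And>n. choice_experiment b L c \<sigma> (M n) (D n) (eps n) (est n)"
    and conv: "tendsto_zero_in_prob M (\<lambda>n x. err_l2 b u \<sigma> (D n) (estimate u (D n) (eps n) (est n) x))"
  shows "tendsto_zero_in_prob M (\<lambda>n x. err_linf b u \<sigma> (D n) (estimate u (D n) (eps n) (est n) x))"
  unfolding tendsto_zero_in_prob_def
proof (intro allI impI)
  fix e :: real assume "0 < e"
  let ?X = "\<lambda>err n x. err b u \<sigma> (D n) (estimate u (D n) (eps n) (est n) x)"
  have lim: "(\<lambda>n. measure (M n) {x \<in> space (M n). e < \<bar>?X err_l2 n x\<bar>}) \<longlonglongrightarrow> 0"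
    using conv \<open>0 < e\<close> by (simp add: tendsto_zero_in_prob_def)
  have le: "measure (M n) {x \<in> space (M n). e < \<bar>?X err_linf n x\<bar>}
      \<le> measure (M n) {x \<in> space (M n). e < \<bar>?X err_l2 n x\<bar>}" for n
  proof -
    note D = choice_experimentD[OF ex[of n]]
    interpret prob_space "M n" by (rule D(3))
    have "\<bar>?X err_linf n x\<bar> \<le> \<bar>?X err_l2 n x\<bar>" for x
      using err_linf_le_l2[OF \<open>0 < b\<close> D(1), of u \<sigma> "estimate u (D n) (eps n) (est n) x"] by linarith
    then show ?thesis
      by (intro finite_measure_mono estimate_event_measurable[OF D(2)]) (auto intro: less_le_trans)
  qed
  show "(\<lambda>n. measure (M n) {x \<in> space (M n). e < \<bar>?X err_linf n x\<bar>}) \<longlonglongrightarrow> 0"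
  proof (rule tendsto_sandwich[OF _ _ tendsto_const lim])
    show "\<forall>\<^sub>F n in sequentially. 0 \<le> measure (M n) {x \<in> space (M n). e < \<bar>?X err_linf n x\<bar>}" by simp
    show "\<forall>\<^sub>F n in sequentially. measure (M n) {x \<in> space (M n). e < \<bar>?X err_linf n x\<bar>}
        \<le> measure (M n) {x \<in> space (M n). e < \<bar>?X err_l2 n x\<bar>}"
      by (intro always_eventually allI le)
  qed
qed

text \<open>The scales \<open>1 / c\<close> and \<open>2 / c\<close> share the same estimate, but
  their targets at the last breakpoint are \<open>c\<close> and \<open>c / 2\<close>. The two errors
  therefore add up to at least \<open>c / 2\<close> at every outcome and cannot both vanish in
  probability. Which scale fails depends on \<open>est\<close>.\<close>

lemma midpoint_not_consistent:
  assumes "0 < b" "0 < c" "1 \<le> L * b"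
    and rule: "\<And>n. mle_rule b L c (midpoint_queries b n) (est n)"
  defines "X \<equiv> \<lambda>(err :: real \<Rightarrow> (real \<Rightarrow> real) \<Rightarrow> real \<Rightarrow> queries \<Rightarrow> candidate \<Rightarrow> real) \<sigma> n w.
    err b (\<lambda>x. x / b) \<sigma> (midpoint_queries b n)
      (estimate (\<lambda>x. x / b) (midpoint_queries b n) (\<lambda>i k w. \<sigma> * w (i, k)) (est n) w)"
  shows "\<exists>\<sigma>\<ge>1 / c. (\<forall>n. choice_experiment b L c \<sigma> gumbel_space (midpoint_queries b n)
        (\<lambda>i k w. \<sigma> * w (i, k)) (est n)) \<and>
      (\<forall>err\<in>{err_l2, err_linf}. \<not> tendsto_zero_in_prob (\<lambda>_. gumbel_space) (X err \<sigma>))"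
proof -
  let ?u = "\<lambda>x. x / b" and ?eps = "\<lambda>\<sigma> i k (w :: nat \<times> nat \<Rightarrow> real). \<sigma> * w (i, k) :: real"
  let ?D = "midpoint_queries b"
  have pos: "0 < 1 / c" "0 < 2 / c" using assms by auto
  have ex: "choice_experiment b L c \<sigma> gumbel_space (?D n) (?eps \<sigma>) (est n)" if "0 < \<sigma>" for \<sigma> n
    unfolding choice_experiment_def
    using midpoint_valid[OF assms(1)] gumbel_space_response_errors[OF that] rule by blast
  have "\<not> (tendsto_zero_in_prob (\<lambda>_. gumbel_space) (X err_linf (1 / c))
      \<and> tendsto_zero_in_prob (\<lambda>_. gumbel_space) (X err_linf (2 / c)))"
  proof
    assume conv: "tendsto_zero_in_prob (\<lambda>_. gumbel_space) (X err_linf (1 / c))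
      \<and> tendsto_zero_in_prob (\<lambda>_. gumbel_space) (X err_linf (2 / c))"
    \<comment> \<open>Errors with sum at least \<open>c / 2\<close> include one of at least
      \<open>c / 4\<close>, which is strictly above the threshold \<open>c / 8\<close>; hence the
      two events cover the space.\<close>
    define A where "A \<sigma> n = {w \<in> space gumbel_space. c / 8 < \<bar>X err_linf \<sigma> n w\<bar>}" for \<sigma> n
    have "(\<lambda>n. measure gumbel_space (A (1 / c) n) + measure gumbel_space (A (2 / c) n)) \<longlonglongrightarrow> 0 + 0"
    proof (intro tendsto_add)
      have "0 < c / 8" using assms(2) by simp
      then show "(\<lambda>n. measure gumbel_space (A (1 / c) n)) \<longlonglongrightarrow> 0"
        "(\<lambda>n. measure gumbel_space (A (2 / c) n)) \<longlonglongrightarrow> 0"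
        unfolding A_def using conv unfolding tendsto_zero_in_prob_def by blast+
    qed
    moreover have "1 \<le> measure gumbel_space (A (1 / c) n) + measure gumbel_space (A (2 / c) n)" for n
    proof -
      note D1 = choice_experimentD[OF ex[OF pos(1), of n]]
      note D2 = choice_experimentD[OF ex[OF pos(2), of n]]
      interpret prob_space gumbel_space by (rule D1(3))
      have sets: "A (1 / c) n \<in> sets gumbel_space" "A (2 / c) n \<in> sets gumbel_space"
        unfolding A_def X_def by (rule estimate_event_measurable[OF D1(2)] estimate_event_measurable[OF D2(2)])+
      have "space gumbel_space \<subseteq> A (1 / c) n \<union> A (2 / c) n"
      proof
        fix w assume w: "w \<in> space gumbel_space"
        let ?s = "estimate ?u (?D n) (?eps (1 / c)) (est n) w"
        have same: "estimate ?u (?D n) (?eps (2 / c)) (est n) w = ?s"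
          unfolding estimate_def using midpoint_responses_scale[OF assms(1) pos(2,1)] by simp
        have feas: "feasible b L c (?D n) ?s" using D1(5)[of ?u w] by (simp add: optimal_def)
        \<comment> \<open>The third breakpoint is \<open>b\<close>, where the linear utility equals
          1, so the target there is \<open>1 / \<sigma>\<close>.\<close>
        have j: "3 \<in> {1..num_bp b (?D n)}" by (simp add: midpoint_num_bp[OF assms(1)])
        have err: "est_err b ?u \<sigma> (?D n) ?s 3 = fst ?s 3 - 1 / \<sigma>" for \<sigma>
          using ratio_hat_eq_alpha[OF assms(1) D1(1) feas j] assms(1)
          by (simp add: est_err_def midpoint_bp[OF assms(1)])
        have "\<bar>fst ?s 3 - c\<bar> \<le> X err_linf (1 / c) n w"
          using est_err_le_linf[OF assms(1) D1(1) j, of ?u "1 / c" ?s] err[of "1 / c"] by (simp add: X_def)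
        moreover have "\<bar>fst ?s 3 - c / 2\<bar> \<le> X err_linf (2 / c) n w"
          using est_err_le_linf[OF assms(1) D1(1) j, of ?u "2 / c" ?s] err[of "2 / c"]
          unfolding X_def same by simp
        ultimately have "c / 2 \<le> X err_linf (1 / c) n w + X err_linf (2 / c) n w"
          using assms(2) by linarith
        then have "c / 8 < \<bar>X err_linf (1 / c) n w\<bar> \<or> c / 8 < \<bar>X err_linf (2 / c) n w\<bar>"
          using assms(2) by linarith
        then show "w \<in> A (1 / c) n \<union> A (2 / c) n" using w by (auto simp: A_def)
      qed
      then have "prob (space gumbel_space) \<le> prob (A (1 / c) n \<union> A (2 / c) n)"
        using sets by (intro finite_measure_mono) auto
      also have "\<dots> \<le> prob (A (1 / c) n) + prob (A (2 / c) n)"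
        using sets by (rule measure_Un_le)
      finally show ?thesis by (simp add: prob_space)
    qed
    ultimately have "1 \<le> (0 :: real) + 0"
      by (intro LIMSEQ_le_const) auto
    then show False by simp
  qed
  then obtain \<sigma> where \<sigma>: "\<sigma> = 1 / c \<or> \<sigma> = 2 / c"
    and linf: "\<not> tendsto_zero_in_prob (\<lambda>_. gumbel_space) (X err_linf \<sigma>)" by blast
  have "0 < \<sigma>" "1 / c \<le> \<sigma>" using \<sigma> pos assms(2) by (auto simp: divide_right_mono)
  moreover have "\<not> tendsto_zero_in_prob (\<lambda>_. gumbel_space) (X err_l2 \<sigma>)"
  proof
    assume "tendsto_zero_in_prob (\<lambda>_. gumbel_space) (X err_l2 \<sigma>)"
    then have "tendsto_zero_in_prob (\<lambda>_. gumbel_space) (X err_linf \<sigma>)"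
      unfolding X_def by (rule tendsto_zero_linf_if_l2[OF assms(1) ex[OF \<open>0 < \<sigma>\<close>]])
    with linf show False by contradiction
  qed
  ultimately show ?thesis using ex linf by blast
qed

theorem corollary1:
  fixes b L c \<sigma> :: real and u :: "real \<Rightarrow> real"
  assumes "0 < b" and "0 < L" and "0 < c"
    and "u \<in> utility_class b L" and "\<sigma> \<ge> 1 / c"
  shows
    "(\<forall>D. valid_queries b D \<and> lambda_min (Sigma_mat b D) > 0 \<longrightarrow>
        invertible_mat (Sigma_mat b D) \<and>
        vec_space.rank (num_bp b D - 1) (Sigma_mat b D) = num_bp b D - 1) \<and>
     (\<forall>(M :: 'w measure) D eps est.
        choice_experiment b L c \<sigma> M D eps est \<and> lambda_min (Sigma_mat b D) > 0 \<longrightarrow>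
        (\<forall>\<delta>. 0 < \<delta> \<and> \<delta> < 1 \<longrightarrow>
           \<P>(x in M.
              err_linf b u \<sigma> D (estimate u D eps est x) \<le> err_l2 b u \<sigma> D (estimate u D eps est x) \<and>
              err_l2 b u \<sigma> D (estimate u D eps est x)
                \<le> bound_regular c (lambda_min (Sigma_mat b D)) \<delta> (num_bp b D) (length D))
           \<ge> 1 - \<delta>)) \<and>
     (\<forall>l \<delta>. 0 < l \<and> 0 < \<delta> \<and> \<delta> < 1 \<longrightarrow>
        (\<lambda>(N, K). bound_regular c l \<delta> N K) \<in> O[all_sizes](\<lambda>(N, K). sqrt (real N / real K))) \<and>
     \<comment> \<open>fixed number of breakpoints\<close>
     (\<forall>(M :: nat \<Rightarrow> 'w measure) D eps est l N.
        (\<forall>n. choice_experiment b L c \<sigma> (M n) (D n) (eps n) (est n)) \<and>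
        0 < l \<and> (\<forall>n. lambda_min (Sigma_mat b (D n)) \<ge> l) \<and>
        filterlim (\<lambda>n. length (D n)) at_top sequentially \<and>
        (\<forall>n. num_bp b (D n) = N) \<longrightarrow>
        (\<forall>err\<in>{err_l2, err_linf}.
           tendsto_zero_in_prob M (\<lambda>n x. err b u \<sigma> (D n) (estimate u (D n) (eps n) (est n) x)) \<and>
           rate_in_prob M (\<lambda>n x. err b u \<sigma> (D n) (estimate u (D n) (eps n) (est n) x))
             (\<lambda>n. 1 / sqrt (real (length (D n)))))) \<and>
     \<comment> \<open>number of breakpoints of smaller order than the number of queries\<close>
     (\<forall>(M :: nat \<Rightarrow> 'w measure) D eps est l.
        (\<forall>n. choice_experiment b L c \<sigma> (M n) (D n) (eps n) (est n)) \<and>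
        0 < l \<and> (\<forall>n. lambda_min (Sigma_mat b (D n)) \<ge> l) \<and>
        filterlim (\<lambda>n. length (D n)) at_top sequentially \<and>
        (\<lambda>n. real (num_bp b (D n))) \<in> o(\<lambda>n. real (length (D n))) \<longrightarrow>
        (\<forall>err\<in>{err_l2, err_linf}.
           tendsto_zero_in_prob M (\<lambda>n x. err b u \<sigma> (D n) (estimate u (D n) (eps n) (est n) x)))) \<and>
     \<comment> \<open>singular design\<close>
     (\<forall>D. valid_queries b D \<and> lambda_min (Sigma_mat b D) = 0 \<longrightarrow>
        \<not> invertible_mat (Sigma_mat b D) \<and>
        vec_space.rank (num_bp b D - 1) (Sigma_mat b D) < num_bp b D - 1) \<and>
     (\<forall>(M :: 'w measure) D eps est.
        choice_experiment b L c \<sigma> M D eps est \<and> lambda_min (Sigma_mat b D) = 0 \<longrightarrow>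
        (\<forall>l \<delta>. 0 < l \<and> 0 < \<delta> \<and> \<delta> < 1 \<longrightarrow>
           \<P>(x in M.
              err_linf b u \<sigma> D (estimate u D eps est x) \<le> err_l2 b u \<sigma> D (estimate u D eps est x) \<and>
              err_l2 b u \<sigma> D (estimate u D eps est x)
                \<le> bound_singular c l \<delta> (num_bp b D) (length D))
           \<ge> 1 - \<delta>)) \<and>
     (\<forall>l \<delta>. 0 < l \<and> 0 < \<delta> \<and> \<delta> < 1 \<longrightarrow>
        (\<exists>f g. (\<forall>N\<ge>2. \<forall>K\<ge>1. bound_singular c l \<delta> N K = f (N, K) + g (N, K)) \<and>
           f \<in> O[all_sizes](\<lambda>(N, K). sqrt (real N / real K)) \<and>
           g \<in> O[all_sizes](\<lambda>(N, K). c * sqrt (real N)))) \<and>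
     \<comment> \<open>the error may fail to vanish. Repeating one query between two different lotteries,
        whichever optimal solutions are selected, some true parameters are not recovered.\<close>
     (\<exists>W Y. W \<noteq> Y \<and>
        (\<forall>n. valid_queries b (replicate (Suc n) (W, Y)) \<and>
             lambda_min (Sigma_mat b (replicate (Suc n) (W, Y))) = 0) \<and>
        (\<exists>est. \<forall>n. mle_rule b L c (replicate (Suc n) (W, Y)) (est n)) \<and>
        (\<forall>est. (\<forall>n. mle_rule b L c (replicate (Suc n) (W, Y)) (est n)) \<longrightarrow>
           (\<exists>u' \<sigma>' (M :: (nat \<times> nat \<Rightarrow> real) measure) eps.
              u' \<in> utility_class b L \<and> \<sigma>' \<ge> 1 / c \<and>
              (\<forall>n. choice_experiment b L c \<sigma>' M (replicate (Suc n) (W, Y)) eps (est n)) \<and>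
              (\<forall>err\<in>{err_l2, err_linf}.
                 \<not> tendsto_zero_in_prob (\<lambda>_. M)
                     (\<lambda>n x. err b u' \<sigma>' (replicate (Suc n) (W, Y))
                        (estimate u' (replicate (Suc n) (W, Y)) eps (est n) x))))))"
proof (intro conjI)
  note b = \<open>0 < b\<close> and u = \<open>u \<in> utility_class b L\<close> and c = \<open>0 < c\<close> \<open>1 / c \<le> \<sigma>\<close>
  \<comment> \<open>The given utility climbs from 0 to 1 over a length \<open>b\<close> with slope
    at most \<open>L\<close>. This places the linear utility in the class and makes the midpoint
    problem solvable.\<close>
  have Lb: "1 \<le> L * b"
    using utility_lipschitz[OF u, of 0 b] utility_ends[OF u] b by simp
  show "\<forall>D. valid_queries b D \<and> lambda_min (Sigma_mat b D) > 0 \<longrightarrow>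
      invertible_mat (Sigma_mat b D) \<and>
      vec_space.rank (num_bp b D - 1) (Sigma_mat b D) = num_bp b D - 1"
    using Sigma_mat_regular num_bp_ge_2[OF b] by blast
  show "\<forall>D. valid_queries b D \<and> lambda_min (Sigma_mat b D) = 0 \<longrightarrow>
      \<not> invertible_mat (Sigma_mat b D) \<and>
      vec_space.rank (num_bp b D - 1) (Sigma_mat b D) < num_bp b D - 1"
    using Sigma_mat_singular num_bp_ge_2[OF b] by blast
  show "\<forall>l \<delta>. 0 < l \<and> 0 < \<delta> \<and> \<delta> < 1 \<longrightarrow>
      (\<lambda>(N, K). bound_regular c l \<delta> N K) \<in> O[all_sizes](\<lambda>(N, K). sqrt (real N / real K))"
    using bound_regular_bigo by blast
  show "\<forall>l \<delta>. 0 < l \<and> 0 < \<delta> \<and> \<delta> < 1 \<longrightarrow>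
      (\<exists>f g. (\<forall>N\<ge>2. \<forall>K\<ge>1. bound_singular c l \<delta> N K = f (N, K) + g (N, K)) \<and>
         f \<in> O[all_sizes](\<lambda>(N, K). sqrt (real N / real K)) \<and>
         g \<in> O[all_sizes](\<lambda>(N, K). c * sqrt (real N)))"
  \<comment> \<open>The summands are \<open>bound_regular\<close> and its difference from
    \<open>bound_singular\<close>; the goals below instantiate them.\<close>
  proof (intro allI impI exI conjI)
    fix l \<delta> :: real assume *: "0 < l \<and> 0 < \<delta> \<and> \<delta> < 1"
    show "(\<lambda>(N, K). bound_regular c l \<delta> N K) \<in> O[all_sizes](\<lambda>(N, K). sqrt (real N / real K))"
      using * by (intro bound_regular_bigo) auto
    show "(\<lambda>(N, K). bound_singular c l \<delta> N K - bound_regular c l \<delta> N K)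
        \<in> O[all_sizes](\<lambda>(N, K). c * sqrt (real N))"
      using * c by (intro bound_singular_bigo) auto
  qed simp
  show "\<forall>(M :: 'w measure) D eps est.
      choice_experiment b L c \<sigma> M D eps est \<and> lambda_min (Sigma_mat b D) > 0 \<longrightarrow>
      (\<forall>\<delta>. 0 < \<delta> \<and> \<delta> < 1 \<longrightarrow>
         \<P>(x in M.
            err_linf b u \<sigma> D (estimate u D eps est x) \<le> err_l2 b u \<sigma> D (estimate u D eps est x) \<and>
            err_l2 b u \<sigma> D (estimate u D eps est x)
              \<le> bound_regular c (lambda_min (Sigma_mat b D)) \<delta> (num_bp b D) (length D))
         \<ge> 1 - \<delta>)"
  proof (intro allI impI)
    fix M :: "'w measure" and D eps est and \<delta> :: real
    assume ex: "choice_experiment b L c \<sigma> M D eps est \<and> lambda_min (Sigma_mat b D) > 0"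
      and \<delta>: "0 < \<delta> \<and> \<delta> < 1"
    have "err_linf b u \<sigma> D s \<le> err_l2 b u \<sigma> D s" for s
      using err_linf_le_l2(2)[OF b choice_experimentD(1)] ex by blast
    then show "1 - \<delta> \<le> \<P>(x in M.
            err_linf b u \<sigma> D (estimate u D eps est x) \<le> err_l2 b u \<sigma> D (estimate u D eps est x) \<and>
            err_l2 b u \<sigma> D (estimate u D eps est x)
              \<le> bound_regular c (lambda_min (Sigma_mat b D)) \<delta> (num_bp b D) (length D))"
      using mle_error_regular[OF b u c conjunct1[OF ex] conjunct2[OF ex] order_refl, of \<delta>] \<delta> by simp
  qed
  show "\<forall>(M :: 'w measure) D eps est.
      choice_experiment b L c \<sigma> M D eps est \<and> lambda_min (Sigma_mat b D) = 0 \<longrightarrow>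
      (\<forall>l \<delta>. 0 < l \<and> 0 < \<delta> \<and> \<delta> < 1 \<longrightarrow>
         \<P>(x in M.
            err_linf b u \<sigma> D (estimate u D eps est x) \<le> err_l2 b u \<sigma> D (estimate u D eps est x) \<and>
            err_l2 b u \<sigma> D (estimate u D eps est x)
              \<le> bound_singular c l \<delta> (num_bp b D) (length D))
         \<ge> 1 - \<delta>)"
  proof (intro allI impI)
    fix M :: "'w measure" and D eps est and l \<delta> :: real
    assume ex: "choice_experiment b L c \<sigma> M D eps est \<and> lambda_min (Sigma_mat b D) = 0"
      and *: "0 < l \<and> 0 < \<delta> \<and> \<delta> < 1"
    note ex' = conjunct1[OF ex]
    interpret prob_space M by (rule choice_experimentD(3)[OF ex'])
    have "err_linf b u \<sigma> D (estimate u D eps est x) \<le> err_l2 b u \<sigma> D (estimate u D eps est x)" for x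
      by (rule err_linf_le_l2(2)[OF b choice_experimentD(1)[OF ex']])
    moreover have "err_l2 b u \<sigma> D (estimate u D eps est x) \<le> bound_singular c l \<delta> (num_bp b D) (length D)" for x
      by (rule mle_error_singular[OF b u c ex']) (use * in auto)
    ultimately show "1 - \<delta> \<le> \<P>(x in M.
            err_linf b u \<sigma> D (estimate u D eps est x) \<le> err_l2 b u \<sigma> D (estimate u D eps est x) \<and>
            err_l2 b u \<sigma> D (estimate u D eps est x)
              \<le> bound_singular c l \<delta> (num_bp b D) (length D))"
      using * by (simp add: prob_space)
  qed
  show "\<forall>(M :: nat \<Rightarrow> 'w measure) D eps est l N.
      (\<forall>n. choice_experiment b L c \<sigma> (M n) (D n) (eps n) (est n)) \<and>
      0 < l \<and> (\<forall>n. lambda_min (Sigma_mat b (D n)) \<ge> l) \<and>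
      filterlim (\<lambda>n. length (D n)) at_top sequentially \<and>
      (\<forall>n. num_bp b (D n) = N) \<longrightarrow>
      (\<forall>err\<in>{err_l2, err_linf}.
         tendsto_zero_in_prob M (\<lambda>n x. err b u \<sigma> (D n) (estimate u (D n) (eps n) (est n) x)) \<and>
         rate_in_prob M (\<lambda>n x. err b u \<sigma> (D n) (estimate u (D n) (eps n) (est n) x))
           (\<lambda>n. 1 / sqrt (real (length (D n)))))"
  proof (intro allI impI ballI)
    fix M :: "nat \<Rightarrow> 'w measure" and D eps est and l :: real and N err
    assume *: "(\<forall>n. choice_experiment b L c \<sigma> (M n) (D n) (eps n) (est n)) \<and>
        0 < l \<and> (\<forall>n. lambda_min (Sigma_mat b (D n)) \<ge> l) \<and>
        filterlim (\<lambda>n. length (D n)) at_top sequentially \<and> (\<forall>n. num_bp b (D n) = N)"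
      and err: "err \<in> {err_l2, err_linf}"
    have "filterlim (\<lambda>n. real (length (D n))) at_top sequentially"
      using * by (intro filterlim_compose[OF filterlim_real_sequentially]) auto
    then have "(\<lambda>n. real N / real (length (D n))) \<longlonglongrightarrow> 0"
      by (intro real_tendsto_divide_at_top[OF tendsto_const])
    then have "(\<lambda>n. real (num_bp b (D n)) / real (length (D n))) \<longlonglongrightarrow> 0" using * by simp
    then have "tendsto_zero_in_prob M (\<lambda>n x. err b u \<sigma> (D n) (estimate u (D n) (eps n) (est n) x))"
      by (rule mle_error_tendsto_zero[OF b u c, where l = l, rotated -2]) (use * err in auto)
    moreover have "rate_in_prob M (\<lambda>n x. err b u \<sigma> (D n) (estimate u (D n) (eps n) (est n) x))
        (\<lambda>n. 1 / sqrt (real (length (D n))))"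
      by (rule mle_error_rate[OF b u c, where l = l and N = N]) (use * err in auto)
    ultimately show "tendsto_zero_in_prob M (\<lambda>n x. err b u \<sigma> (D n) (estimate u (D n) (eps n) (est n) x)) \<and>
        rate_in_prob M (\<lambda>n x. err b u \<sigma> (D n) (estimate u (D n) (eps n) (est n) x))
          (\<lambda>n. 1 / sqrt (real (length (D n))))" by (rule conjI)
  qed
  show "\<forall>(M :: nat \<Rightarrow> 'w measure) D eps est l.
      (\<forall>n. choice_experiment b L c \<sigma> (M n) (D n) (eps n) (est n)) \<and>
      0 < l \<and> (\<forall>n. lambda_min (Sigma_mat b (D n)) \<ge> l) \<and>
      filterlim (\<lambda>n. length (D n)) at_top sequentially \<and>
      (\<lambda>n. real (num_bp b (D n))) \<in> o(\<lambda>n. real (length (D n))) \<longrightarrow>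
      (\<forall>err\<in>{err_l2, err_linf}.
         tendsto_zero_in_prob M (\<lambda>n x. err b u \<sigma> (D n) (estimate u (D n) (eps n) (est n) x)))"
  proof (intro allI impI ballI)
    fix M :: "nat \<Rightarrow> 'w measure" and D eps est and l :: real and err
    assume *: "(\<forall>n. choice_experiment b L c \<sigma> (M n) (D n) (eps n) (est n)) \<and>
        0 < l \<and> (\<forall>n. lambda_min (Sigma_mat b (D n)) \<ge> l) \<and>
        filterlim (\<lambda>n. length (D n)) at_top sequentially \<and>
        (\<lambda>n. real (num_bp b (D n))) \<in> o(\<lambda>n. real (length (D n)))"
      and err: "err \<in> {err_l2, err_linf}"
    then have "(\<lambda>n. real (num_bp b (D n)) / real (length (D n))) \<longlonglongrightarrow> 0"
      by (intro smalloD_tendsto) auto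
    then show "tendsto_zero_in_prob M (\<lambda>n x. err b u \<sigma> (D n) (estimate u (D n) (eps n) (est n) x))"
      by (rule mle_error_tendsto_zero[OF b u c, where l = l, rotated -2]) (use * err in auto)
  qed
  obtain W Y where WY: "midpoint_query b = (W, Y)" by (cases "midpoint_query b") auto
  then have eq: "replicate (Suc n) (W, Y) = midpoint_queries b n" for n
    by (simp add: midpoint_queries_def)
  show "\<exists>W Y. W \<noteq> Y \<and>
      (\<forall>n. valid_queries b (replicate (Suc n) (W, Y)) \<and>
           lambda_min (Sigma_mat b (replicate (Suc n) (W, Y))) = 0) \<and>
      (\<exists>est. \<forall>n. mle_rule b L c (replicate (Suc n) (W, Y)) (est n)) \<and>
      (\<forall>est. (\<forall>n. mle_rule b L c (replicate (Suc n) (W, Y)) (est n)) \<longrightarrow>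
         (\<exists>u' \<sigma>' (M :: (nat \<times> nat \<Rightarrow> real) measure) eps.
            u' \<in> utility_class b L \<and> \<sigma>' \<ge> 1 / c \<and>
            (\<forall>n. choice_experiment b L c \<sigma>' M (replicate (Suc n) (W, Y)) eps (est n)) \<and>
            (\<forall>err\<in>{err_l2, err_linf}.
               \<not> tendsto_zero_in_prob (\<lambda>_. M)
                   (\<lambda>n x. err b u' \<sigma>' (replicate (Suc n) (W, Y))
                      (estimate u' (replicate (Suc n) (W, Y)) eps (est n) x)))))"
  proof (intro exI[of _ W] exI[of _ Y], unfold eq, intro conjI allI impI)
    show "W \<noteq> Y"
    proof
      assume "W = Y"
      then have "set_pmf (return_pmf (b / 2)) = set_pmf (pmf_of_set {0, b})"
        using WY by (simp add: midpoint_query_def)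
      then show False using b by auto
    qed
    show "\<exists>est. \<forall>n. mle_rule b L c (midpoint_queries b n) (est n)"
      using midpoint_mle_rule_exists[OF b c(1) Lb] .
    fix est assume "\<forall>n. mle_rule b L c (midpoint_queries b n) (est n)"
    then have "\<And>n. mle_rule b L c (midpoint_queries b n) (est n)" by blast
    from midpoint_not_consistent[OF b c(1) Lb this] linear_in_utility_class[OF b Lb]
    show "\<exists>u' \<sigma>' (M :: (nat \<times> nat \<Rightarrow> real) measure) eps.
        u' \<in> utility_class b L \<and> \<sigma>' \<ge> 1 / c \<and>
        (\<forall>n. choice_experiment b L c \<sigma>' M (midpoint_queries b n) eps (est n)) \<and>
        (\<forall>err\<in>{err_l2, err_linf}.
           \<not> tendsto_zero_in_prob (\<lambda>_. M)
               (\<lambda>n x. err b u' \<sigma>' (midpoint_queries b n) (estimate u' (midpoint_queries b n) eps (est n) x)))"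
      by blast
  qed (use midpoint_valid[OF b] midpoint_lambda_min[OF b] in auto)
qed

end
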